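(* Suppose $\alpha\in(-\infty,-3/2)\cup[1/2,\infty)\setminus\mathbb{N}$ and $c\ge 1$ are fixed. The following hold, where $A_\alpha>0$ denotes a constant depending only on $\alpha$ (its value may differ from one part to another): (i) With $\Lambda_{\alpha,c}(x):=\sum_{j\in\mathbb{Z}}|L_{\alpha,c}(x+j)|$, one has $\Lambda_{\alpha,c}(x)\le A_\alpha\ln(c)$ for all $x\in\mathbb{R}$; (ii) $\|\mathscr{I}_{\alpha,c}\|_{\ell_\infty(\mathbb{Z})\to L_\infty(\mathbb{R})}\le A_\alpha\ln(c)$; (iii) $\|\mathscr{I}_{\alpha,c}\|_{\ell_1(\mathbb{Z})\to L_1(\mathbb{R})}\le A_\alpha\ln(c)$.
   Context: For $c>0$ and $\alpha\in\mathbb{R}\setminus\{0,1,2,\dots\}$, the one-dimensional general multiquadric $\phi_{\alpha,c}(x)=(x^2+c^2)^\alpha$ has generalized Fourier transform $$\widehat{\phi}_{\alpha,c}(\xi)=\frac{2^{1+\alpha}}{\Gamma(-\alpha)}\Big(\frac{c}{|\xi|}\Big)^{\alpha+\frac12}K_{\alpha+\frac12}(c|\xi|),\quad \xi\neq 0,$$ where $K_\nu=K_{-\nu}$ is the modified Bessel function of the second kind. Set $$\widehat{L}_{\alpha,c}(\xi)=\frac{\widehat{\phi}_{\alpha,c}(\xi)}{\sum_{j\in\mathbb{Z}}\widehat{\phi}_{\alpha,c}(\xi+2\pi j)},\quad\xi\in\mathbb{R}$$ (extended by continuity to $\xi\in2\pi\mathbb{Z}$). This is in $L_1(\mathbb{R})$,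 and the fundamental function is $L_{\alpha,c}(x)=\frac1{2\pi}\int_{\mathbb{R}}\widehat{L}_{\alpha,c}(\xi)e^{ix\xi}d\xi$. The cardinal interpolation operator acts on sequences $\mathbf{y}=(y_j)_{j\in\mathbb{Z}}$ by $\mathscr{I}_{\alpha,c}\mathbf{y}(x)=\sum_{j\in\mathbb{Z}}y_jL_{\alpha,c}(x-j)$, $x\in\mathbb{R}$; $\|\cdot\|_{\ell_p\to L_p}$ is the operator norm.
   Formalization: The bound A_α ln(c) is replaced by A_α max(1, ln c) in all three parts, since at c = 1 one has ln(c) = 0 while Λ(0) ≥ |L(0)| = 1 and the operator norms are positive; for c ≥ c₀ > 1 the original bound follows. *)

theory Defs
  imports "HOL-Analysis.Analysis" "HOL-Probability.Essential_Supremum"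
begin

(* Modified Bessel function of the second kind, by its standard integral representation
   for r > 0; the integrand is even in nu, so K_nu = K_{-nu}. *)
definition bessel_K :: "real \<Rightarrow> real \<Rightarrow> real" where
  "bessel_K \<nu> r = (LBINT t:{0..}. exp (- r * cosh t) * cosh (\<nu> * t))"

(* Generalized Fourier transform of x |-> (x^2 + c^2) powr alpha away from the origin.
   The value at xi = 0 has no meaning. *)
definition multiquadric_hat :: "real \<Rightarrow> real \<Rightarrow> real \<Rightarrow> real" where
  "multiquadric_hat \<alpha> c \<xi> =
     2 powr (1 + \<alpha>) / Gamma (- \<alpha>) * (c / \<bar>\<xi>\<bar>) powr (\<alpha> + 1/2) * bessel_K (\<alpha> + 1/2) (c * \<bar>\<xi>\<bar>)"

definition cardinal_ratio :: "real \<Rightarrow> real \<Rightarrow> real \<Rightarrow> real" where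
  "cardinal_ratio \<alpha> c \<xi> =
     multiquadric_hat \<alpha> c \<xi> / (\<Sum>\<^sub>\<infinity>j\<in>(UNIV::int set). multiquadric_hat \<alpha> c (\<xi> + 2 * pi * of_int j))"

(* At the points of 2 pi Z the quotient involves the meaningless value at the origin;
   there the transform is the continuous extension of the quotient. *)
definition L_hat :: "real \<Rightarrow> real \<Rightarrow> real \<Rightarrow> real" where
  "L_hat \<alpha> c \<xi> =
     (if \<exists>k::int. \<xi> = 2 * pi * of_int k then Lim (at \<xi>) (cardinal_ratio \<alpha> c)
      else cardinal_ratio \<alpha> c \<xi>)"

definition fundamental_L :: "real \<Rightarrow> real \<Rightarrow> real \<Rightarrow> complex" where
  "fundamental_L \<alpha> c x =
     1 / (2 * of_real pi) * (LINT \<xi>|lborel. of_real (L_hat \<alpha> c \<xi>) * exp (\<i> * of_real (x * \<xi>)))"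

(* Valued in ennreal, so that a finite bound includes convergence of the series. *)
definition Lambda :: "real \<Rightarrow> real \<Rightarrow> real \<Rightarrow> ennreal" where
  "Lambda \<alpha> c x = (\<Sum>\<^sub>\<infinity>j\<in>(UNIV::int set). ennreal (norm (fundamental_L \<alpha> c (x + of_int j))))"

definition cardinal_interp :: "real \<Rightarrow> real \<Rightarrow> (int \<Rightarrow> complex) \<Rightarrow> real \<Rightarrow> complex" where
  "cardinal_interp \<alpha> c y x = (\<Sum>\<^sub>\<infinity>j\<in>(UNIV::int set). y j * fundamental_L \<alpha> c (x - of_int j))"

definition ell_1_norm :: "(int \<Rightarrow> complex) \<Rightarrow> ennreal" where
  "ell_1_norm y = (\<Sum>\<^sub>\<infinity>j\<in>UNIV. ennreal (norm (y j)))"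

definition ell_infty_norm :: "(int \<Rightarrow> complex) \<Rightarrow> ennreal" where
  "ell_infty_norm y = (SUP j. ennreal (norm (y j)))"

(* Both function norms are infinite on non-measurable functions. *)
definition L_1_norm :: "(real \<Rightarrow> complex) \<Rightarrow> ennreal" where
  "L_1_norm f = (if f \<in> borel_measurable lborel then \<integral>\<^sup>+ x. ennreal (norm (f x)) \<partial>lborel else \<infinity>)"

definition L_infty_norm :: "(real \<Rightarrow> complex) \<Rightarrow> ennreal" where
  "L_infty_norm f =
     (if f \<in> borel_measurable lborel then esssup lborel (\<lambda>x. ennreal (norm (f x))) else \<infinity>)"

definition operator_norm ::
  "((int \<Rightarrow> complex) \<Rightarrow> ennreal) \<Rightarrow> ((real \<Rightarrow> complex) \<Rightarrow> ennreal) \<Rightarrow>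
   ((int \<Rightarrow> complex) \<Rightarrow> real \<Rightarrow> complex) \<Rightarrow> ennreal" where
  "operator_norm N M T = (SUP y\<in>{y. N y \<le> 1}. M (T y))"

end

(*
The symbol is g / sum_j g(. + 2 pi j) with g(xi) = |xi|^(-mu) K_mu(c |xi|) and mu = alpha + 1/2. The
Bessel recurrences show that -g'/g is comparable to c away from the origin, so the symbol is a
smoothed indicator function of [-pi, pi] with transition layers of width 1/c: for some kappa > 0
its first two derivatives at xi are O(c exp (- kappa c | |xi| - pi |)) and
O(c^2 exp (- kappa c | |xi| - pi |)), with L_1 norms O(1) and O(c). Hence
|L(x)| <= A min(1, 1/|x|, c/x^2) <= A' c / ((1 + |x|) (1 + |x| + c)), and the last expression, the
difference of 1/(1 + |x|) and 1/(1 + |x| + c), has sums over x + Z and integral O(1 + ln c).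
*)
theory Submission
  imports Defs
begin

section \<open>Modified Bessel functions\<close>

text \<open>The range of \<alpha> is what makes two derivatives affordable at the lattice points,
  where the symbol inherits the regularity of 1 / g or of g. For \<mu> > 0 there is a pole |xi|^(-2
  \<mu>) at the origin, and |xi|^(2 \<mu>) has a bounded second derivative near 0 only if \<mu> >=
  1. For \<mu> < 0 the function g is finite at the origin but has a singular term |xi|^(-2 \<mu>),
  with a logarithm at \<mu> = -1; hence the strict bound \<alpha> < -3/2 on one side against
  \<alpha> >= 1/2 on the other. Integration by parts on the whole line wants derivatives everywhere,
  the origin and its translates included. Therefore |xi| is regularized, every estimate is kept
  uniform in the regularization, and only the resulting bound on the integral passes to the limit.
  This is why all hypotheses on the profile are inequalities relative to its own size. The logarithm
  is the contribution of 1 <= |x| <= c, where 1 / |x| is the effective bound: the second derivative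
  improves on it only beyond the scale c.\<close>

lemma has_real_derivative_quadratic_error:
  fixes f :: "real \<Rightarrow> real"
  assumes "0 < d" and "\<And>y. \<bar>y - x\<bar> < d \<Longrightarrow> \<bar>f y - f x - (y - x) * D\<bar> \<le> M * (y - x)\<^sup>2"
  shows "(f has_real_derivative D) (at x)"
proof -
  have "((\<lambda>y. (f y - f x) / (y - x) - D) \<longlongrightarrow> 0) (at x)"
  proof (rule Lim_null_comparison)
    show "\<forall>\<^sub>F y in at x. norm ((f y - f x) / (y - x) - D) \<le> M * \<bar>y - x\<bar>"
      unfolding eventually_at
    proof (intro exI[of _ d] conjI ballI impI)
      fix y assume y: "y \<noteq> x \<and> dist y x < d"
      have "(f y - f x) / (y - x) - D = (f y - f x - (y - x) * D) / (y - x)"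
        using y by (simp add: field_simps)
      also have "\<bar>\<dots>\<bar> \<le> M * (y - x)\<^sup>2 / \<bar>y - x\<bar>"
        using assms(2)[of y] y by (simp add: dist_real_def divide_right_mono)
      also have "\<dots> = M * \<bar>y - x\<bar>"
        using y by (simp add: power2_eq_square field_simps abs_if)
      finally show "norm ((f y - f x) / (y - x) - D) \<le> M * \<bar>y - x\<bar>" by simp
    qed (use \<open>0 < d\<close> in auto)
    show "((\<lambda>y. M * \<bar>y - x\<bar>) \<longlongrightarrow> 0) (at x)"
      by (rule tendsto_eq_intros | simp)+
  qed
  then show ?thesis
    unfolding has_field_derivative_iff using LIM_zero_iff by blast
qed

lemma exp_minus_linear_bound: "\<bar>exp z - 1 - z\<bar> \<le> z\<^sup>2 * exp \<bar>z\<bar>" for z :: real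
proof -
  have 0: "0 \<le> exp z - 1 - z" using exp_ge_add_one_self[of z] by linarith
  have 1: "exp z - 1 \<le> z * exp z"
    using mult_right_mono[OF exp_ge_add_one_self[of "-z"], of "exp z"]
    by (simp add: algebra_simps flip: exp_add)
  show ?thesis
  proof (cases "0 \<le> z")
    case True
    have "exp z - 1 - z \<le> z * (exp z - 1)" using 1 by (simp add: algebra_simps)
    also have "\<dots> \<le> z * (z * exp z)" using 1 True by (intro mult_left_mono) auto
    finally show ?thesis using 0 True by (simp add: power2_eq_square)
  next
    case False
    have "exp z - 1 - z \<le> (- z) * (1 - exp z)" using 1 by (simp add: algebra_simps)
    also have "\<dots> \<le> (- z) * (- z)"
      using False exp_ge_add_one_self[of z] by (intro mult_left_mono) linarith+
    also have "\<dots> \<le> z\<^sup>2 * exp \<bar>z\<bar>"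
      using False by (simp add: power2_eq_square mult_le_cancel_left1)
    finally show ?thesis using 0 by simp
  qed
qed

section \<open>Integrals against the weight \<open>exp (- x * cosh t)\<close>\<close>

lemma cosh_ge_quadratic: "t\<^sup>2 / 4 \<le> cosh t" if "0 \<le> t" for t :: real
proof -
  have "1 + t + t\<^sup>2 / 2 \<le> exp t" using exp_lower_Taylor_quadratic that by blast
  moreover have "1 - t \<le> exp (- t)" using exp_ge_add_one_self[of "-t"] by simp
  ultimately show ?thesis by (simp add: cosh_def)
qed

lemma cosh_le_exp: "cosh s \<le> exp \<bar>s\<bar>" for s :: real
  unfolding cosh_def by (auto simp: abs_if)

text \<open>Complete the square in t after replacing cosh t by its quadratic minorant. Splitting off
  one extra unit of growth, hence a + 1, leaves exp (- t) as an integrable majorant.\<close>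

lemma exp_cosh_decay:
  fixes x a t :: real
  assumes "0 < x" "0 \<le> t"
  shows "exp (- x * cosh t) * exp (a * t) \<le> exp ((a + 1)\<^sup>2 / x) * exp (- t)"
proof -
  have "0 \<le> (x * t / 2 - (a + 1))\<^sup>2 / x" using assms by simp
  also have "\<dots> = x * (t\<^sup>2 / 4) - (a + 1) * t + (a + 1)\<^sup>2 / x"
    using assms by (simp add: power2_eq_square field_simps)
  also have "\<dots> \<le> x * cosh t - (a + 1) * t + (a + 1)\<^sup>2 / x"
    using assms cosh_ge_quadratic[of t] by (simp add: mult_left_mono)
  finally show ?thesis by (simp add: algebra_simps flip: exp_add)
qed

lemma set_integrable_exp_minus_Ici: "set_integrable lborel {0..} (\<lambda>t::real. exp (- t))"
proof -
  have "(\<integral>\<^sup>+t. ennreal (exp (- t)) * indicator {0..} t \<partial>lborel) = ennreal (0 - (- exp (- 0)))"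
  proof (rule nn_integral_FTC_atLeast)
    show "((\<lambda>t::real. - exp (- t)) \<longlongrightarrow> 0) at_top"
      using tendsto_minus[OF filterlim_compose[OF exp_at_bot filterlim_uminus_at_bot_at_top]] by simp
  qed (auto intro!: derivative_eq_intros)
  then show ?thesis
    unfolding set_integrable_def
    by (intro integrableI_nonneg)
      (simp_all add: ennreal_mult ennreal_indicator mult.commute[of _ "indicator _ _"])
qed

text \<open>One criterion for the Bessel integrals, their derivatives in x and the second-order
  remainder: each is the weight times a factor of at most exponential growth.\<close>

lemma set_integrable_exp_cosh:
  fixes h :: "real \<Rightarrow> real"
  assumes "0 < x" and [continuous_intros]: "continuous_on UNIV h"
    and h: "\<And>t. 0 \<le> t \<Longrightarrow> \<bar>h t\<bar> \<le> M * exp (a * t)"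
  shows "set_integrable lborel {0..} (\<lambda>t. exp (- x * cosh t) * h t)"
proof (rule set_integrable_bound)
  let ?B = "\<lambda>t. (M * exp ((a + 1)\<^sup>2 / x)) * exp (- t)"
  show "set_integrable lborel {0..} ?B"
    by (rule set_integrable_mult_right) (use set_integrable_exp_minus_Ici in simp)
  have "continuous_on UNIV (\<lambda>t. exp (- x * cosh t) * h t)" by (intro continuous_intros)
  then show "set_borel_measurable lborel {0..} (\<lambda>t. exp (- x * cosh t) * h t)"
    unfolding set_borel_measurable_def
    by (intro borel_measurable_scaleR borel_measurable_indicator)
      (simp_all add: borel_measurable_continuous_onI)
  have M: "0 \<le> M" using h[of 0] by simp
  have "norm (exp (- x * cosh t) * h t) \<le> norm (?B t)" if "0 \<le> t" for t
  proof -
    have "norm (exp (- x * cosh t) * h t) \<le> exp (- x * cosh t) * (M * exp (a * t))"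
      using h[OF that] by (simp add: abs_mult)
    also have "\<dots> = M * (exp (- x * cosh t) * exp (a * t))" by simp
    also have "\<dots> \<le> M * (exp ((a + 1)\<^sup>2 / x) * exp (- t))"
      using exp_cosh_decay[OF \<open>0 < x\<close> that] M by (rule mult_left_mono)
    finally show ?thesis using M by simp
  qed
  then show "AE t in lborel. t \<in> {0..} \<longrightarrow> norm (exp (- x * cosh t) * h t) \<le> norm (?B t)"
    by auto
qed

lemma cosh_mult_cosh: "cosh s * cosh t = (cosh (s + t) + cosh (s - t)) / 2"
  for s t :: real by (simp add: cosh_add cosh_diff)

lemma sinh_mult_sinh: "sinh s * sinh t = (cosh (s + t) - cosh (s - t)) / 2"
  for s t :: real by (simp add: cosh_add cosh_diff)

section \<open>Order, positivity, derivative and recurrence of the Bessel functions\<close>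

lemma bessel_K_integrable:
  fixes x \<nu> :: real
  assumes "0 < x" shows "set_integrable lborel {0..} (\<lambda>t. exp (- x * cosh t) * cosh (\<nu> * t))"
proof (rule set_integrable_exp_cosh[where M = 1 and a = "\<bar>\<nu>\<bar>"])
  show "\<bar>cosh (\<nu> * t)\<bar> \<le> 1 * exp (\<bar>\<nu>\<bar> * t)" if "0 \<le> t" for t
    using cosh_le_exp[of "\<nu> * t"] that by (simp add: abs_mult)
qed (use assms in \<open>auto intro!: continuous_intros\<close>)

lemma bessel_K_minus: "bessel_K (- \<nu>) x = bessel_K \<nu> x"
  by (simp add: bessel_K_def)

lemma bessel_K_lincomb:
  assumes "0 < x"
  shows "(LBINT t:{0..}. p * (exp (- x * cosh t) * cosh (\<mu> * t)) + q * (exp (- x * cosh t) * cosh (\<nu> * t)))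
    = p * bessel_K \<mu> x + q * bessel_K \<nu> x"
  unfolding bessel_K_def
  by (simp only: set_integral_add(2) set_integrable_mult_right bessel_K_integrable[OF assms] set_integral_mult_right)

text \<open>The weight is positive, so linear inequalities between hyperbolic cosines carry over to
  the Bessel functions of the corresponding orders.\<close>

lemma bessel_K_combine_le:
  assumes "0 < x"
    and "\<And>t. 0 \<le> t \<Longrightarrow> p * cosh (\<nu>1 * t) + q * cosh (\<nu>2 * t) \<le> r * cosh (\<nu>3 * t)"
  shows "p * bessel_K \<nu>1 x + q * bessel_K \<nu>2 x \<le> r * bessel_K \<nu>3 x"
proof -
  let ?k = "\<lambda>\<nu> t. exp (- x * cosh t) * cosh (\<nu> * t)"
  note I = bessel_K_integrable[OF assms(1)]
  have "p * bessel_K \<nu>1 x + q * bessel_K \<nu>2 x = (LBINT t:{0..}. p * ?k \<nu>1 t + q * ?k \<nu>2 t)"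
    by (rule bessel_K_lincomb[OF assms(1), symmetric])
  also have "\<dots> \<le> (LBINT t:{0..}. r * ?k \<nu>3 t)"
  proof (rule set_integral_mono)
    fix t :: real assume "t \<in> {0..}"
    then show "p * ?k \<nu>1 t + q * ?k \<nu>2 t \<le> r * ?k \<nu>3 t"
      using mult_left_mono[OF assms(2)[of t], of "exp (- x * cosh t)"] by (simp add: algebra_simps)
  qed (use I in \<open>auto intro!: set_integrable_mult_right set_integral_add\<close>)
  finally show ?thesis by (simp add: bessel_K_def)
qed

lemma bessel_K_mono:
  assumes "0 < x" "\<bar>\<mu>\<bar> \<le> \<bar>\<nu>\<bar>" shows "bessel_K \<mu> x \<le> bessel_K \<nu> x"
proof -
  have "cosh (\<mu> * t) \<le> cosh (\<nu> * t)" if "0 \<le> t" for t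
    using that assms(2) cosh_real_nonneg_le_iff[of "\<bar>\<mu> * t\<bar>" "\<bar>\<nu> * t\<bar>"]
    unfolding cosh_real_abs by (simp add: abs_mult mult_right_mono)
  then show ?thesis using bessel_K_combine_le[OF assms(1), of 1 \<mu> 0 0 1 \<nu>] by simp
qed

lemma bessel_K_pos:
  assumes "0 < x" shows "0 < bessel_K \<nu> x"
proof -
  have "0 < (LBINT t:{0..1::real}. exp (- x * cosh 1))"
    by (simp add: set_lebesgue_integral_def)
  also have "\<dots> \<le> (LBINT t:{0..}. exp (- x * cosh t) * cosh (\<nu> * t))"
    unfolding set_lebesgue_integral_def
  proof (rule integral_mono)
    show "integrable lborel (\<lambda>t. indicat_real {0..1::real} t *\<^sub>R exp (- x * cosh 1))"
      by (intro integrable_scaleR_left impI, rule integrable_real_indicator) simp_all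
    show "integrable lborel (\<lambda>t. indicat_real {0..} t *\<^sub>R (exp (- x * cosh t) * cosh (\<nu> * t)))"
      using bessel_K_integrable[OF assms] by (simp add: set_integrable_def)
    fix t :: real
    have "exp (- x * cosh 1) \<le> exp (- x * cosh t) * cosh (\<nu> * t)" if "0 \<le> t" "t \<le> 1"
    proof -
      have "cosh t \<le> cosh 1" using that by (simp add: cosh_real_nonneg_le_iff)
      then have "exp (- x * cosh 1) * 1 \<le> exp (- x * cosh t) * cosh (\<nu> * t)"
        using assms by (intro mult_mono) (auto simp: cosh_real_ge_1)
      then show ?thesis by simp
    qed
    then show "indicat_real {0..1} t *\<^sub>R exp (- x * cosh 1)
        \<le> indicat_real {0..} t *\<^sub>R (exp (- x * cosh t) * cosh (\<nu> * t))"
      by (auto simp: indicator_def)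
  qed
  finally show ?thesis by (simp add: bessel_K_def)
qed

text \<open>Differentiation under the integral sign: the integrated Taylor remainder of the
  exponential is quadratic in y - x. The product formula for cosh t * cosh (\<nu> * t) produces the
  two neighbouring orders.\<close>

lemma bessel_K_has_derivative:
  assumes "0 < x"
  shows "(bessel_K \<nu> has_real_derivative - (bessel_K (\<nu> + 1) x + bessel_K (\<nu> - 1) x) / 2) (at x)"
proof -
  let ?k = "\<lambda>\<nu> x t. exp (- x * cosh t) * cosh (\<nu> * t)"
  \<comment> \<open>For |y - x| < x / 2 the remainder costs at most a factor exp (x / 2 * cosh t);
    the surviving half of the decay gives a majorant free of y.\<close>
  let ?r = "\<lambda>t. exp (- (x / 2) * cosh t) * ((cosh t)\<^sup>2 * cosh (\<nu> * t))"
  define M where "M = (LBINT t:{0..}. ?r t)"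
  note I = bessel_K_integrable
  have Ir: "set_integrable lborel {0..} ?r"
  proof (rule set_integrable_exp_cosh[where M = 1 and a = "2 + \<bar>\<nu>\<bar>"])
    fix t :: real assume "0 \<le> t"
    then have "(cosh t)\<^sup>2 * cosh (\<nu> * t) \<le> (exp t)\<^sup>2 * exp (\<bar>\<nu>\<bar> * t)"
      using cosh_le_exp[of t] cosh_le_exp[of "\<nu> * t"]
      by (intro mult_mono power_mono) (auto simp: abs_mult)
    also have "\<dots> = exp ((2 + \<bar>\<nu>\<bar>) * t)"
      by (simp add: power2_eq_square algebra_simps flip: exp_add)
    finally show "\<bar>(cosh t)\<^sup>2 * cosh (\<nu> * t)\<bar> \<le> 1 * exp ((2 + \<bar>\<nu>\<bar>) * t)" by simp
  qed (use assms in \<open>auto intro!: continuous_intros\<close>)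
  have D: "- (bessel_K (\<nu> + 1) x + bessel_K (\<nu> - 1) x) / 2 = (LBINT t:{0..}. - (cosh t * ?k \<nu> x t))"
  proof -
    have "(LBINT t:{0..}. - (cosh t * ?k \<nu> x t))
        = (LBINT t:{0..}. (-1/2) * ?k (\<nu> + 1) x t + (-1/2) * ?k (\<nu> - 1) x t)"
    proof (rule set_lebesgue_integral_cong)
      have "cosh t * cosh (\<nu> * t) = (cosh ((\<nu> + 1) * t) + cosh ((\<nu> - 1) * t)) / 2" for t
        using cosh_mult_cosh[of "\<nu> * t" t] by (simp add: algebra_simps)
      then show "\<forall>t. t \<in> {0..} \<longrightarrow> - (cosh t * ?k \<nu> x t)
          = (-1/2) * ?k (\<nu> + 1) x t + (-1/2) * ?k (\<nu> - 1) x t"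
        by (simp only: mult.left_commute[of "cosh _" "exp _"]) (simp add: algebra_simps add_divide_distrib)
    qed simp
    also have "\<dots> = (-1/2) * bessel_K (\<nu> + 1) x + (-1/2) * bessel_K (\<nu> - 1) x"
      by (rule bessel_K_lincomb[OF assms])
    finally show ?thesis by simp
  qed
  have ID: "set_integrable lborel {0..} (\<lambda>t. - (cosh t * ?k \<nu> x t))"
  proof -
    have "set_integrable lborel {0..} (\<lambda>t. exp (- x * cosh t) * (- (cosh t * cosh (\<nu> * t))))"
    proof (rule set_integrable_exp_cosh[where M = 1 and a = "1 + \<bar>\<nu>\<bar>"])
      fix t :: real assume "0 \<le> t"
      then have "cosh t * cosh (\<nu> * t) \<le> exp t * exp (\<bar>\<nu>\<bar> * t)"
        using cosh_le_exp[of t] cosh_le_exp[of "\<nu> * t"]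
        by (intro mult_mono) (auto simp: abs_mult)
      then show "\<bar>- (cosh t * cosh (\<nu> * t))\<bar> \<le> 1 * exp ((1 + \<bar>\<nu>\<bar>) * t)"
        by (simp add: abs_mult algebra_simps flip: exp_add)
    qed (use assms in \<open>auto intro!: continuous_intros\<close>)
    then show ?thesis by (simp add: algebra_simps)
  qed
  show ?thesis
  proof (rule has_real_derivative_quadratic_error)
    show "0 < x / 2" using assms by simp
    fix y assume y: "\<bar>y - x\<bar> < x / 2"
    have y0: "0 < y" using y assms by linarith
    let ?e = "\<lambda>t. ?k \<nu> y t - ?k \<nu> x t - (y - x) * - (cosh t * ?k \<nu> x t)"
    have pw: "\<bar>?e t\<bar> \<le> (y - x)\<^sup>2 * ?r t" for t
    proof -
      let ?z = "- (y - x) * cosh t"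
      have "exp (- y * cosh t) = exp (- x * cosh t) * exp ?z"
        by (simp add: algebra_simps flip: exp_add)
      then have "?e t = exp (- x * cosh t) * cosh (\<nu> * t) * (exp ?z - 1 - ?z)"
        by (simp add: algebra_simps)
      also have "\<bar>\<dots>\<bar> \<le> exp (- x * cosh t) * cosh (\<nu> * t) * (?z\<^sup>2 * exp \<bar>?z\<bar>)"
        unfolding abs_mult[of "exp (- x * cosh t) * cosh (\<nu> * t)"]
        by (intro mult_mono exp_minus_linear_bound) (auto simp: abs_mult)
      also have "\<dots> \<le> exp (- x * cosh t) * cosh (\<nu> * t) * (?z\<^sup>2 * exp (x / 2 * cosh t))"
        using y by (intro mult_left_mono) (auto simp: abs_mult abs_minus_commute)
      also have "\<dots> = (y - x)\<^sup>2 * (exp (- x * cosh t + x / 2 * cosh t) * ((cosh t)\<^sup>2 * cosh (\<nu> * t)))"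
        unfolding exp_add by (simp add: power2_eq_square algebra_simps)
      also have "- x * cosh t + x / 2 * cosh t = - (x / 2) * cosh t" by simp
      finally show ?thesis .
    qed
    have eq: "bessel_K \<nu> y - bessel_K \<nu> x - (y - x) * (- (bessel_K (\<nu> + 1) x + bessel_K (\<nu> - 1) x) / 2)
        = (LBINT t:{0..}. ?e t)"
      unfolding D unfolding bessel_K_def
      by (simp only: set_integral_diff set_integrable_mult_right set_integral_mult_right I[OF assms] I[OF y0] ID)
    have Ie: "set_integrable lborel {0..} ?e"
      by (intro set_integral_diff set_integrable_mult_right impI I assms y0 ID)
    have "\<bar>LBINT t:{0..}. ?e t\<bar> \<le> (LBINT t:{0..}. \<bar>?e t\<bar>)"
      using set_integral_norm_bound[OF Ie] by simp
    also have "\<dots> \<le> (LBINT t:{0..}. (y - x)\<^sup>2 * ?r t)"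
      by (rule set_integral_mono) (use Ie Ir pw in \<open>auto intro!: set_integrable_mult_right set_integrable_abs\<close>)
    also have "\<dots> = M * (y - x)\<^sup>2" by (simp add: M_def)
    finally show "\<bar>bessel_K \<nu> y - bessel_K \<nu> x - (y - x) * (- (bessel_K (\<nu> + 1) x + bessel_K (\<nu> - 1) x) / 2)\<bar>
        \<le> M * (y - x)\<^sup>2" unfolding eq .
  qed
qed


lemma set_integral_Ioi_eq_Ici:
  fixes f :: "real \<Rightarrow> real"
  shows "(LBINT t:{a<..}. f t) = (LBINT t:{a..}. f t)"
  unfolding set_lebesgue_integral_def
  by (rule integral_discrete_difference[where X = "{a}"]) (auto simp: indicator_def)

text \<open>Integrate the derivative of \<open>exp (- x * cosh t) * sinh (\<nu> * t)\<close> over the half line.\<close>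

lemma bessel_K_recurrence:
  assumes "0 < x"
  shows "bessel_K (\<nu> + 1) x = bessel_K (\<nu> - 1) x + 2 * \<nu> / x * bessel_K \<nu> x"
proof -
  let ?k = "\<lambda>\<nu> t. exp (- x * cosh t) * cosh (\<nu> * t)"
  let ?F = "\<lambda>t. exp (- x * cosh t) * sinh (\<nu> * t)"
  let ?f = "\<lambda>t. \<nu> * ?k \<nu> t + ((- x / 2) * ?k (\<nu> + 1) t + (x / 2) * ?k (\<nu> - 1) t)"
  note I = bessel_K_integrable[OF assms]
  have int: "set_integrable lborel {0..} ?f"
    by (intro set_integral_add set_integrable_mult_right I)
  have int': "set_integrable lborel {0<..} ?f"
    by (rule set_integrable_subset[OF int]) auto
  have "(LBINT t=0..\<infinity>. ?f t) = 0 - 0"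
  proof (rule interval_integral_FTC_integrable)
    fix t :: real
    have eq: "sinh t * sinh (\<nu> * t) = (cosh ((\<nu> + 1) * t) - cosh ((\<nu> - 1) * t)) / 2"
      using sinh_mult_sinh[of "\<nu> * t" t] by (simp add: algebra_simps)
    have "?f t = exp (- x * cosh t) * (\<nu> * cosh (\<nu> * t)
        - x * ((cosh ((\<nu> + 1) * t) - cosh ((\<nu> - 1) * t)) / 2))"
      by (simp only: algebra_simps add_divide_distrib diff_divide_distrib times_divide_eq_right
        times_divide_eq_left minus_divide_left [symmetric])
    then have "?f t = exp (- x * cosh t) * (\<nu> * cosh (\<nu> * t) - x * (sinh t * sinh (\<nu> * t)))"
      unfolding eq .
    then show "(?F has_vector_derivative ?f t) (at t)"
      by (auto intro!: derivative_eq_intros simp: algebra_simps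
        simp flip: has_real_derivative_iff_has_vector_derivative)
    show "isCont ?f t"
      by (intro continuous_intros) auto
  next
    show "set_integrable lborel (einterval 0 \<infinity>) ?f"
      using int' by (simp add: zero_ereal_def)
    show "((?F \<circ> real_of_ereal) \<longlongrightarrow> 0) (at_right 0)"
      unfolding zero_ereal_def ereal_tendsto_simps
      by (rule tendsto_eq_intros isCont_tendsto_compose refl | simp)+
    have "(?F \<longlongrightarrow> 0) at_top"
    proof (rule Lim_null_comparison)
      show "\<forall>\<^sub>F t in at_top. norm (?F t) \<le> exp ((\<bar>\<nu>\<bar> + 1)\<^sup>2 / x) * exp (- t)"
        using eventually_ge_at_top[of "0::real"]
      proof eventually_elim
        case (elim t)
        have "\<bar>sinh (\<nu> * t)\<bar> \<le> cosh (\<nu> * t)"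
          using sinh_le_cosh_real[of "\<nu> * t"] sinh_le_cosh_real[of "- (\<nu> * t)"] by (simp add: abs_if)
        also have "\<dots> \<le> exp (\<bar>\<nu>\<bar> * t)" using cosh_le_exp[of "\<nu> * t"] elim by (simp add: abs_mult)
        finally have "norm (?F t) \<le> exp (- x * cosh t) * exp (\<bar>\<nu>\<bar> * t)" by (simp add: abs_mult)
        also have "\<dots> \<le> exp ((\<bar>\<nu>\<bar> + 1)\<^sup>2 / x) * exp (- t)"
          by (rule exp_cosh_decay[OF assms elim])
        finally show ?case .
      qed
      show "((\<lambda>t. exp ((\<bar>\<nu>\<bar> + 1)\<^sup>2 / x) * exp (- t)) \<longlongrightarrow> 0) at_top"
        using tendsto_mult_right_zero[OF filterlim_compose[OF exp_at_bot filterlim_uminus_at_bot_at_top]] .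
    qed
    then show "((?F \<circ> real_of_ereal) \<longlongrightarrow> 0) (at_left \<infinity>)"
      unfolding ereal_tendsto_simps .
  qed simp
  then have "0 = (LBINT t:{0<..}. ?f t)"
    by (simp add: interval_lebesgue_integral_le_eq zero_ereal_def)
  also have "\<dots> = (LBINT t:{0..}. ?f t)" by (rule set_integral_Ioi_eq_Ici)
  also have "\<dots> = \<nu> * bessel_K \<nu> x + ((- x / 2) * bessel_K (\<nu> + 1) x + (x / 2) * bessel_K (\<nu> - 1) x)"
    unfolding bessel_K_def
    by (simp only: set_integral_add set_integrable_mult_right I set_integral_mult_right)
  finally show ?thesis using assms by (simp add: field_simps)
qed

text \<open>This yields the lower bound for the logarithmic derivative when \<mu> < -1. For \<nu> >=
  3/2 it is the recurrence together with |\<nu> - 2| <= \<nu> - 1. Below 3/2 that comparison of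
  orders fails; instead 2 - \<nu> is the convex combination of \<nu> and \<nu> - 1 with weights 1 -
  \<theta> and \<theta> = 2 \<nu> - 2. The recurrence contains the same \<theta>, which
  cancels.\<close>

lemma bessel_K_le_pred:
  assumes "0 < x" "1 < \<nu>"
  shows "bessel_K \<nu> x \<le> (1 + max 1 (2 * \<nu> - 2) / x) * bessel_K (\<nu> - 1) x"
proof -
  have pos: "0 < bessel_K (\<nu> - 1) x" by (rule bessel_K_pos[OF assms(1)])
  have rec: "bessel_K \<nu> x = bessel_K (\<nu> - 2) x + 2 * (\<nu> - 1) / x * bessel_K (\<nu> - 1) x"
    using bessel_K_recurrence[OF assms(1), of "\<nu> - 1"] by simp
  show ?thesis
  proof (cases "3 / 2 \<le> \<nu>")
    case True
    then have "bessel_K (\<nu> - 2) x \<le> bessel_K (\<nu> - 1) x"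
      using assms by (intro bessel_K_mono) auto
    moreover have "2 * (\<nu> - 1) / x * bessel_K (\<nu> - 1) x \<le> max 1 (2 * \<nu> - 2) / x * bessel_K (\<nu> - 1) x"
      using assms pos by (intro mult_right_mono divide_right_mono) auto
    ultimately show ?thesis unfolding rec by (simp add: algebra_simps)
  next
    case False
    define \<theta> where "\<theta> = 2 * \<nu> - 2"
    have \<theta>: "0 < \<theta>" "\<theta> < 1" using False assms by (auto simp: \<theta>_def)
    have "(1 * bessel_K (\<nu> - 2) x + (- \<theta>) * bessel_K (\<nu> - 1) x) \<le> (1 - \<theta>) * bessel_K \<nu> x"
    proof (rule bessel_K_combine_le[OF assms(1)])
      fix t :: real
      have "convex_on UNIV (cosh :: real \<Rightarrow> real)"
        by (rule f''_ge0_imp_convex[where f' = sinh and f'' = cosh])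
          (auto intro!: derivative_eq_intros)
      from convex_onD[OF this, of \<theta> "\<nu> * t" "(\<nu> - 1) * t"] \<theta>
      have "cosh ((1 - \<theta>) * (\<nu> * t) + \<theta> * ((\<nu> - 1) * t))
          \<le> (1 - \<theta>) * cosh (\<nu> * t) + \<theta> * cosh ((\<nu> - 1) * t)" by simp
      moreover have "(1 - \<theta>) * (\<nu> * t) + \<theta> * ((\<nu> - 1) * t) = - ((\<nu> - 2) * t)"
        by (simp add: \<theta>_def algebra_simps)
      ultimately show "1 * cosh ((\<nu> - 2) * t) + (- \<theta>) * cosh ((\<nu> - 1) * t) \<le> (1 - \<theta>) * cosh (\<nu> * t)"
        by (simp only: cosh_minus)
    qed
    then have "\<theta> * bessel_K \<nu> x \<le> bessel_K \<nu> x - bessel_K (\<nu> - 2) x + \<theta> * bessel_K (\<nu> - 1) x"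
      by (simp add: algebra_simps)
    also have "bessel_K \<nu> x - bessel_K (\<nu> - 2) x = \<theta> / x * bessel_K (\<nu> - 1) x"
      unfolding rec \<theta>_def by simp
    also have "\<theta> / x * bessel_K (\<nu> - 1) x + \<theta> * bessel_K (\<nu> - 1) x = \<theta> * ((1 + 1 / x) * bessel_K (\<nu> - 1) x)"
      by (simp add: algebra_simps)
    finally have "\<theta> * bessel_K \<nu> x \<le> \<theta> * ((1 + 1 / x) * bessel_K (\<nu> - 1) x)" .
    then have "bessel_K \<nu> x \<le> (1 + 1 / x) * bessel_K (\<nu> - 1) x"
      using \<theta> by simp
    also have "\<dots> \<le> (1 + max 1 (2 * \<nu> - 2) / x) * bessel_K (\<nu> - 1) x"
      using assms pos by (intro mult_right_mono add_left_mono divide_right_mono) auto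
    finally show ?thesis .
  qed
qed

section \<open>The profile of the multiquadric transform\<close>

text \<open>
  The weight \<open>N\<close> bounds the logarithmic derivatives of \<open>G\<close>, which grow like \<open>1 / r\<close> if \<open>G\<close> has
  a pole at the origin. The factor \<open>(N a)\<^sup>2\<close> in \<open>decay\<close> records that such a pole is strong
  enough to absorb two derivatives of \<open>1 / G\<close>; for the Bessel profile this is where \<open>\<mu> \<ge> 1\<close> enters.
\<close>

locale radial_profile =
  fixes G W V N :: "real \<Rightarrow> real" and c C \<delta> :: real
  assumes c: "1 \<le> c" and C: "1 \<le> C" and \<delta>: "0 < \<delta>"
    and G_pos: "0 < r \<Longrightarrow> 0 < G r"
    and G_deriv: "0 < r \<Longrightarrow> (G has_real_derivative - W r) (at r)"
    and W_deriv: "0 < r \<Longrightarrow> (W has_real_derivative - V r) (at r)"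
    and W_nonneg: "0 < r \<Longrightarrow> 0 \<le> W r"
    and W_le: "0 < r \<Longrightarrow> W r \<le> C * N r * G r"
    and W_div_le: "0 < r \<Longrightarrow> W r / r \<le> C * (N r)\<^sup>2 * G r"
    and V_le: "0 < r \<Longrightarrow> \<bar>V r\<bar> \<le> C * (N r)\<^sup>2 * G r"
    and N_ge: "0 < r \<Longrightarrow> c \<le> N r"
    and N_le: "1 \<le> r \<Longrightarrow> N r \<le> 2 * c"
    and N_antimono: "0 < a \<Longrightarrow> a \<le> b \<Longrightarrow> N b \<le> N a"
    and decay: "0 < a \<Longrightarrow> a \<le> b \<Longrightarrow> 1 \<le> b \<Longrightarrow>
      G b * (N a)\<^sup>2 \<le> 4 * c\<^sup>2 * G a * exp (- \<delta> * c * (b - max 1 a))"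

section \<open>Verification of the profile conditions for the Bessel functions\<close>

lemma antimono_on_interval:
  fixes f f' :: "real \<Rightarrow> real"
  assumes "a \<le> b" "\<And>x. a \<le> x \<Longrightarrow> x \<le> b \<Longrightarrow> (f has_real_derivative f' x) (at x)"
    and "\<And>x. a \<le> x \<Longrightarrow> x \<le> b \<Longrightarrow> f' x \<le> 0"
  shows "f b \<le> f a"
  using assms by (intro DERIV_nonpos_imp_nonincreasing[of a b f]) auto

text \<open>On [1, \<infinity>) the function G r * exp (\<kappa> * r) decreases; below 1, where no
  lower bound for W / G is at hand, plain monotonicity of G leads from a to max 1 a.\<close>

lemma exp_decay_of_log_derivative:
  fixes G W :: "real \<Rightarrow> real"
  assumes der: "\<And>r. 0 < r \<Longrightarrow> (G has_real_derivative - W r) (at r)"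
    and pos: "\<And>r. 0 < r \<Longrightarrow> 0 \<le> W r"
    and low: "\<And>r. 1 \<le> r \<Longrightarrow> \<kappa> * G r \<le> W r"
    and ab: "0 < a" "a \<le> b" "1 \<le> b"
  shows "G b \<le> G a * exp (- \<kappa> * (b - max 1 a))"
proof -
  let ?m = "max 1 a"
  have "G b * exp (\<kappa> * b) \<le> G ?m * exp (\<kappa> * ?m)"
  proof (rule antimono_on_interval[where f = "\<lambda>r. G r * exp (\<kappa> * r)"])
    fix r assume r: "?m \<le> r" "r \<le> b"
    show "((\<lambda>r. G r * exp (\<kappa> * r)) has_real_derivative (\<kappa> * G r - W r) * exp (\<kappa> * r)) (at r)"
      using r ab by (auto intro!: derivative_eq_intros der simp: algebra_simps)
    show "(\<kappa> * G r - W r) * exp (\<kappa> * r) \<le> 0"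
      using low[of r] r by (intro mult_nonpos_nonneg) auto
  qed (use ab in auto)
  also have "G ?m \<le> G a"
  proof (rule antimono_on_interval[where f = G and f' = "\<lambda>r. - W r"])
    fix r assume "a \<le> r" "r \<le> ?m"
    then show "(G has_real_derivative - W r) (at r)" "- W r \<le> 0"
      using der pos ab by auto
  qed simp
  finally have "G b * exp (\<kappa> * b) \<le> G a * exp (\<kappa> * ?m)" by simp
  then have "G b * exp (\<kappa> * b) * exp (- \<kappa> * b) \<le> G a * exp (\<kappa> * ?m) * exp (- \<kappa> * b)"
    by (rule mult_right_mono) simp
  then show ?thesis by (simp add: mult.assoc algebra_simps flip: exp_add)
qed

text \<open>By the recurrence the two terms of the product rule merge into a single Bessel function
  of order \<mu> + 1, so the derivative has constant sign.\<close>

lemma powr_bessel_K_has_derivative: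
  assumes "0 < c" "0 < r"
  shows "((\<lambda>r. r powr (- \<mu>) * bessel_K \<mu> (c * r)) has_real_derivative
    - (c * (r powr (- \<mu>) * bessel_K (\<mu> + 1) (c * r)))) (at r)"
proof -
  have 1: "((\<lambda>r. bessel_K \<mu> (c * r)) has_real_derivative
      - (bessel_K (\<mu> + 1) (c * r) + bessel_K (\<mu> - 1) (c * r)) / 2 * c) (at r)"
  proof (rule DERIV_chain2[where f = "bessel_K \<mu>" and g = "\<lambda>r. c * r"])
    show "(bessel_K \<mu> has_real_derivative - (bessel_K (\<mu> + 1) (c * r) + bessel_K (\<mu> - 1) (c * r)) / 2) (at (c * r))"
      using assms by (intro bessel_K_has_derivative) simp
  qed (auto intro!: derivative_eq_intros)
  have 2: "((\<lambda>r. r powr (- \<mu>)) has_real_derivative (- \<mu>) * (r powr (- \<mu>) / r)) (at r)"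
    using assms by (auto intro!: derivative_eq_intros simp: powr_diff)
  have rec: "bessel_K (\<mu> - 1) (c * r) = bessel_K (\<mu> + 1) (c * r) - 2 * \<mu> / (c * r) * bessel_K \<mu> (c * r)"
    using bessel_K_recurrence[of "c * r" \<mu>] assms by simp
  show ?thesis
    by (rule DERIV_cong[OF DERIV_mult[OF 2 1]]) (use assms in \<open>simp add: rec field_simps\<close>)
qed

text \<open>In terms of G this is a form of the modified Bessel equation, G'' + (2 \<mu> + 1) / r *
  G' = c^2 * G. It comes from the first-derivative formula at order \<mu> + 1, applied to W / (c *
  r).\<close>

lemma powr_bessel_K_has_derivative2:
  fixes \<mu> c r :: real
  assumes "0 < c" "0 < r"
  defines "G \<equiv> \<lambda>r. r powr (- \<mu>) * bessel_K \<mu> (c * r)"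
    and "W \<equiv> \<lambda>r. c * (r powr (- \<mu>) * bessel_K (\<mu> + 1) (c * r))"
  shows "(W has_real_derivative - (c\<^sup>2 * G r + (2 * \<mu> + 1) * W r / r)) (at r)"
proof -
  have "((\<lambda>r. c * (r * (r powr (- (\<mu> + 1)) * bessel_K (\<mu> + 1) (c * r)))) has_real_derivative
      c * ((r powr (- (\<mu> + 1)) * bessel_K (\<mu> + 1) (c * r))
        + r * - (c * (r powr (- (\<mu> + 1)) * bessel_K (\<mu> + 1 + 1) (c * r))))) (at r)"
    by (rule DERIV_cong[OF DERIV_cmult[OF DERIV_mult[OF DERIV_ident
        powr_bessel_K_has_derivative[OF assms(1,2)]]]]) simp
  moreover have "\<forall>\<^sub>F r in nhds r. c * (r * (r powr (- (\<mu> + 1)) * bessel_K (\<mu> + 1) (c * r))) = W r"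
    using eventually_nhds_in_open[of "{0<..}" r] assms(2)
    by (auto elim!: eventually_mono simp: W_def powr_diff)
  moreover have "bessel_K (\<mu> + 1 + 1) (c * r) = bessel_K \<mu> (c * r) + 2 * (\<mu> + 1) / (c * r) * bessel_K (\<mu> + 1) (c * r)"
    using bessel_K_recurrence[of "c * r" "\<mu> + 1"] assms by simp
  ultimately have D: "(W has_real_derivative
      c * ((r powr (- (\<mu> + 1)) * bessel_K (\<mu> + 1) (c * r))
        + r * - (c * (r powr (- (\<mu> + 1)) * (bessel_K \<mu> (c * r) + 2 * (\<mu> + 1) / (c * r) * bessel_K (\<mu> + 1) (c * r)))))) (at r)"
    by (subst DERIV_cong_ev[OF refl _ refl, symmetric]) auto
  have p: "r powr (- (\<mu> + 1)) = r powr (- \<mu>) / r"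
    using assms(2) by (simp add: powr_diff powr_minus_divide powr_add)
  show ?thesis
    by (rule DERIV_cong[OF D[unfolded p]])
      (use assms(1,2) in \<open>simp add: G_def W_def power2_eq_square field_simps\<close>)
qed

text \<open>Because of the pole, W / G grows like 1 / r, so N needs the summand 1 / r. The two lower
  bounds for W serve different ends: c * G gives the decay rate, while 2 / r * G, which rests on
  \<mu> >= 1, makes r^2 * G decreasing and pays for (N a)^2 near the pole.\<close>

lemma bessel_profile_pos:
  assumes "1 \<le> \<mu>" "1 \<le> c"
  defines "G \<equiv> \<lambda>r. r powr (- \<mu>) * bessel_K \<mu> (c * r)"
    and "W \<equiv> \<lambda>r. c * (r powr (- \<mu>) * bessel_K (\<mu> + 1) (c * r))"
  shows "radial_profile G W (\<lambda>r. c\<^sup>2 * G r + (2 * \<mu> + 1) * W r / r) (\<lambda>r. c + 1 / r)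
    c (1 + (2 * \<mu> + 1) * (2 * \<mu>)) 1"
proof -
  have Gpos: "0 < G r" if "0 < r" for r
    unfolding G_def using that assms(2) by (intro mult_pos_pos bessel_K_pos) auto
  have Wpos: "0 < W r" if "0 < r" for r
    unfolding W_def using that assms(2) by (intro mult_pos_pos bessel_K_pos) auto
  have Gder: "(G has_real_derivative - W r) (at r)" if "0 < r" for r
    unfolding G_def W_def using that assms(2) by (intro powr_bessel_K_has_derivative) auto
  have W_rec: "W r = c * (r powr (- \<mu>) * bessel_K (\<mu> - 1) (c * r)) + 2 * \<mu> / r * G r" if "0 < r" for r
    unfolding W_def G_def using that assms(2)
    by (subst bessel_K_recurrence) (auto simp: field_simps)
  have W_low: "c * G r \<le> W r" if "0 < r" for r
    unfolding W_def G_def using that assms by (intro mult_left_mono bessel_K_mono) auto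
  have W_low': "2 / r * G r \<le> W r" if "0 < r" for r
  proof -
    have "2 / r * G r \<le> 2 * \<mu> / r * G r"
      using that assms Gpos[OF that] by (intro mult_right_mono divide_right_mono) auto
    moreover have "0 \<le> c * (r powr (- \<mu>) * bessel_K (\<mu> - 1) (c * r))"
      using that assms(2) bessel_K_pos[of "c * r" "\<mu> - 1"] by (intro mult_nonneg_nonneg) auto
    ultimately show ?thesis unfolding W_rec[OF that] by linarith
  qed
  have W_up: "W r \<le> 2 * \<mu> * (c + 1 / r) * G r" if "0 < r" for r
  proof -
    have "c * (r powr (- \<mu>) * bessel_K (\<mu> - 1) (c * r)) \<le> c * G r"
      unfolding G_def using that assms by (intro mult_left_mono bessel_K_mono) auto
    also have "\<dots> \<le> 2 * \<mu> * c * G r"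
      using that assms Gpos[OF that] by (intro mult_right_mono) auto
    finally show ?thesis unfolding W_rec[OF that] by (simp add: algebra_simps)
  qed
  \<comment> \<open>The summands come from V: 1 from c^2 * G, and (2 \<mu> + 1) * (2 \<mu>) from (2
    \<mu> + 1) * W / r. The sum also exceeds the constant 2 \<mu> in the bounds for W and W /
    r.\<close>
  let ?C = "1 + (2 * \<mu> + 1) * (2 * \<mu>)"
  have C: "2 * \<mu> \<le> ?C" "1 \<le> ?C" using assms(1) by (auto simp: algebra_simps)
  have W_up2: "W r / r \<le> 2 * \<mu> * ((c + 1 / r)\<^sup>2 * G r)" if "0 < r" for r
  proof -
    have "W r / r \<le> 2 * \<mu> * (c + 1 / r) * G r * (1 / r)"
      using W_up[OF that] that by (simp add: divide_right_mono)
    also have "\<dots> \<le> 2 * \<mu> * (c + 1 / r) * G r * (c + 1 / r)"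
      using that assms Gpos[OF that] by (intro mult_left_mono) auto
    finally show ?thesis by (simp only: power2_eq_square mult_ac)
  qed
  show ?thesis
  proof
    fix r :: real assume r: "0 < r"
    show "W r \<le> ?C * (c + 1 / r) * G r"
      by (rule order_trans[OF W_up[OF r]])
        (use C r assms Gpos[OF r] in \<open>intro mult_right_mono, auto\<close>)
    have "2 * \<mu> * ((c + 1 / r)\<^sup>2 * G r) \<le> ?C * ((c + 1 / r)\<^sup>2 * G r)"
      using C Gpos[OF r] by (intro mult_right_mono) auto
    then show "W r / r \<le> ?C * (c + 1 / r)\<^sup>2 * G r"
      using W_up2[OF r] by simp
    have "c\<^sup>2 * G r \<le> (c + 1 / r)\<^sup>2 * G r"
      using assms r Gpos[OF r] by (intro mult_right_mono power_mono) auto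
    moreover have "(2 * \<mu> + 1) * (W r / r) \<le> (2 * \<mu> + 1) * (2 * \<mu> * ((c + 1 / r)\<^sup>2 * G r))"
      using W_up2[OF r] assms by (intro mult_left_mono) auto
    moreover have "0 \<le> c\<^sup>2 * G r" "0 \<le> (2 * \<mu> + 1) * (W r / r)"
      using Gpos[OF r] Wpos[OF r] r assms by auto
    ultimately have "\<bar>c\<^sup>2 * G r + (2 * \<mu> + 1) * (W r / r)\<bar>
        \<le> (c + 1 / r)\<^sup>2 * G r + (2 * \<mu> + 1) * (2 * \<mu> * ((c + 1 / r)\<^sup>2 * G r))" by linarith
    also have "\<dots> = ?C * (c + 1 / r)\<^sup>2 * G r" by (simp add: algebra_simps)
    finally show "\<bar>c\<^sup>2 * G r + (2 * \<mu> + 1) * W r / r\<bar> \<le> ?C * (c + 1 / r)\<^sup>2 * G r" by simp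
  next
    fix a b :: real assume ab: "0 < a" "a \<le> b" "1 \<le> b"
    have dec: "G y \<le> G x * exp (- c * (y - max 1 x))" if "0 < x" "x \<le> y" "1 \<le> y" for x y
      by (rule exp_decay_of_log_derivative[where W = W])
        (use that Gder Wpos W_low in \<open>auto intro: less_imp_le\<close>)
    show "G b * (c + 1 / a)\<^sup>2 \<le> 4 * c\<^sup>2 * G a * exp (- 1 * c * (b - max 1 a))"
    proof (cases "1 \<le> a")
      case True
      then have "(c + 1 / a)\<^sup>2 \<le> (2 * c)\<^sup>2"
        using assms(2) by (intro power_mono) (auto simp: field_simps intro: order_trans)
      then have "G b * (c + 1 / a)\<^sup>2 \<le> (G a * exp (- c * (b - max 1 a))) * (2 * c)\<^sup>2"
        using dec[OF ab] Gpos[of b] Gpos[of a] ab by (intro mult_mono) auto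
      then show ?thesis by (simp add: power2_eq_square algebra_simps)
    next
      case False
      \<comment> \<open>Monotonicity of r^2 * G gains the factor a^2, and a * (c + 1 / a) = c * a +
        1 <= 2 * c for a < 1.\<close>
      have "G 1 * 1\<^sup>2 \<le> G a * a\<^sup>2"
      proof (rule antimono_on_interval[where f = "\<lambda>r. G r * r\<^sup>2"])
        fix r :: real assume r: "a \<le> r" "r \<le> 1"
        then have r0: "0 < r" using ab by simp
        show "((\<lambda>r. G r * r\<^sup>2) has_real_derivative (2 / r * G r - W r) * r\<^sup>2) (at r)"
          using r0 by (auto intro!: derivative_eq_intros Gder simp: field_simps power2_eq_square)
        show "(2 / r * G r - W r) * r\<^sup>2 \<le> 0"
          using W_low'[OF r0] by (intro mult_nonpos_nonneg) auto
      qed (use False in auto)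
      then have "G b * (c + 1 / a)\<^sup>2 \<le> (G a * a\<^sup>2 * exp (- c * (b - 1))) * (c + 1 / a)\<^sup>2"
        using dec[of 1 b] ab
        by (intro mult_right_mono) (auto intro: order_trans mult_right_mono)
      also have "\<dots> = G a * exp (- c * (b - 1)) * (c * a + 1)\<^sup>2"
        using ab by (simp add: power2_eq_square field_simps)
      also have "\<dots> \<le> G a * exp (- c * (b - 1)) * (2 * c)\<^sup>2"
      proof (intro mult_left_mono power_mono)
        show "c * a + 1 \<le> 2 * c"
          using mult_left_mono[of a 1 c] False assms(2) by linarith
      qed (use ab assms Gpos[of a] in auto)
      finally show ?thesis using False by (simp add: algebra_simps)
    qed
  next
    show "(W has_real_derivative - (c\<^sup>2 * G r + (2 * \<mu> + 1) * W r / r)) (at r)" if "0 < r" for r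
      using powr_bessel_K_has_derivative2[of c r \<mu>] that assms(2) by (simp add: G_def W_def)
  next
    show "c + 1 / r \<le> 2 * c" if "1 \<le> r" for r
      using that assms(2) order_trans[of "1 / r" 1 c] by simp
  qed (use assms(1,2) Gpos Gder Wpos C in \<open>auto intro: less_imp_le divide_left_mono\<close>)
qed

text \<open>G is finite at the origin and W <= c * G holds throughout, so the constant weight c
  suffices. In return W / G tends to 0 at the origin, and its lower bound is established only for r
  >= 1.\<close>

lemma bessel_profile_neg:
  assumes "\<mu> < -1" "1 \<le> c"
  defines "G \<equiv> \<lambda>r. r powr (- \<mu>) * bessel_K \<mu> (c * r)"
    and "W \<equiv> \<lambda>r. c * (r powr (- \<mu>) * bessel_K (\<mu> + 1) (c * r))"
  shows "radial_profile G W (\<lambda>r. c\<^sup>2 * G r + (2 * \<mu> + 1) * W r / r) (\<lambda>r. c)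
    c (1 + (1 - 2 * \<mu>) / (- 2 * \<mu> - 2)) (1 / (1 + max 1 (- 2 * \<mu> - 2)))"
proof -
  define m where "m = max 1 (- 2 * \<mu> - 2)"
  have m: "1 \<le> m" by (simp add: m_def)
  have Kminus: "bessel_K (- \<mu> - 1) x = bessel_K (\<mu> + 1) x" for x
    using bessel_K_minus[of "\<mu> + 1" x] by simp
  have Gpos: "0 < G r" if "0 < r" for r
    unfolding G_def using that assms(2) by (intro mult_pos_pos bessel_K_pos) auto
  have Wpos: "0 < W r" if "0 < r" for r
    unfolding W_def using that assms(2) by (intro mult_pos_pos bessel_K_pos) auto
  have Gder: "(G has_real_derivative - W r) (at r)" if "0 < r" for r
    unfolding G_def W_def using that assms(2) by (intro powr_bessel_K_has_derivative) auto
  have W_up: "W r \<le> c * G r" if "0 < r" for r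
    unfolding W_def G_def using that assms by (intro mult_left_mono bessel_K_mono) auto
  \<comment> \<open>The Bessel function of order \<mu> + 2 is positive, which turns the recurrence
    into an inequality. The divisor -2 \<mu> - 2 is positive since \<mu> < -1; it makes the constant
    blow up as \<mu> approaches -1.\<close>
  have W_up2: "W r / r \<le> c\<^sup>2 * G r / (- 2 * \<mu> - 2)" if "0 < r" for r
  proof -
    have "0 \<le> bessel_K (\<mu> + 2) (c * r)" using bessel_K_pos[of "c * r" "\<mu> + 2"] that assms by simp
    moreover have "bessel_K (\<mu> + 2) (c * r)
        = bessel_K \<mu> (c * r) + 2 * (\<mu> + 1) / (c * r) * bessel_K (\<mu> + 1) (c * r)"
      using bessel_K_recurrence[of "c * r" "\<mu> + 1"] that assms by (simp add: add.assoc)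
    ultimately have "- (2 * (\<mu> + 1)) / (c * r) * bessel_K (\<mu> + 1) (c * r) \<le> bessel_K \<mu> (c * r)"
      by (simp only: minus_divide_left[symmetric] mult_minus_left)
    then have "r powr (- \<mu>) * (- (2 * (\<mu> + 1)) / (c * r) * bessel_K (\<mu> + 1) (c * r)) \<le> G r"
      unfolding G_def by (rule mult_left_mono) simp
    then have "c\<^sup>2 * (r powr (- \<mu>) * (- (2 * (\<mu> + 1)) / (c * r) * bessel_K (\<mu> + 1) (c * r))) \<le> c\<^sup>2 * G r"
      by (rule mult_left_mono) simp
    also have "c\<^sup>2 * (r powr (- \<mu>) * (- (2 * (\<mu> + 1)) / (c * r) * bessel_K (\<mu> + 1) (c * r)))
        = W r / r * (- 2 * \<mu> - 2)"
      unfolding W_def using that assms(2) by (simp add: power2_eq_square field_simps)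
    finally show ?thesis
      using assms(1) by (subst pos_le_divide_eq) auto
  qed
  \<comment> \<open>Here c * r >= 1, so the factor 1 + m / (c * r) is at most 1 + m; this determines
    the rate \<delta> = 1 / (1 + m).\<close>
  have W_low: "c / (1 + m) * G r \<le> W r" if "1 \<le> r" for r
  proof -
    have cr: "1 \<le> c * r" using that assms mult_mono[of 1 c 1 r] by simp
    have "bessel_K \<mu> (c * r) \<le> (1 + m / (c * r)) * bessel_K (\<mu> + 1) (c * r)"
      using bessel_K_le_pred[of "c * r" "- \<mu>"] assms cr bessel_K_minus[of \<mu>] Kminus
      by (simp add: m_def)
    also have "\<dots> \<le> (1 + m) * bessel_K (\<mu> + 1) (c * r)"
      using cr m bessel_K_pos[of "c * r" "\<mu> + 1"]
      by (intro mult_right_mono) (auto simp: divide_le_eq mult_le_cancel_left1)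
    finally have "G r \<le> r powr (- \<mu>) * ((1 + m) * bessel_K (\<mu> + 1) (c * r))"
      unfolding G_def by (rule mult_left_mono) simp
    then have "c / (1 + m) * G r \<le> c / (1 + m) * (r powr (- \<mu>) * ((1 + m) * bessel_K (\<mu> + 1) (c * r)))"
      by (rule mult_left_mono) (use m assms(2) in auto)
    then show ?thesis using m by (simp add: W_def)
  qed
  let ?C = "1 + (1 - 2 * \<mu>) / (- 2 * \<mu> - 2)"
  have \<mu>2: "0 < - 2 * \<mu> - 2" using assms by simp
  have C: "1 / (- 2 * \<mu> - 2) \<le> ?C" "1 \<le> ?C"
    using assms \<mu>2 divide_right_mono[of 1 "1 - 2 * \<mu>" "- 2 * \<mu> - 2"] by auto
  show ?thesis
    unfolding m_def[symmetric]
  proof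
    fix r :: real assume r: "0 < r"
    have "1 * (c * G r) \<le> ?C * (c * G r)"
      using C Gpos[OF r] assms by (intro mult_right_mono) auto
    then show "W r \<le> ?C * c * G r" using W_up[OF r] by simp
    have "1 / (- 2 * \<mu> - 2) * (c\<^sup>2 * G r) \<le> ?C * (c\<^sup>2 * G r)"
      using C Gpos[OF r] by (intro mult_right_mono) auto
    then show "W r / r \<le> ?C * c\<^sup>2 * G r"
      using W_up2[OF r] by simp
    have c2G: "0 \<le> c\<^sup>2 * G r" using Gpos[OF r] by simp
    have "\<bar>(2 * \<mu> + 1) * (W r / r)\<bar> = (- 2 * \<mu> - 1) * (W r / r)"
      unfolding abs_mult using assms r Wpos[OF r] by auto
    also have "\<dots> \<le> (1 - 2 * \<mu>) * (c\<^sup>2 * G r / (- 2 * \<mu> - 2))"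
      using W_up2[OF r] assms r Wpos[OF r] by (intro mult_mono) auto
    finally have "\<bar>c\<^sup>2 * G r + (2 * \<mu> + 1) * (W r / r)\<bar>
        \<le> c\<^sup>2 * G r + (1 - 2 * \<mu>) * (c\<^sup>2 * G r / (- 2 * \<mu> - 2))"
      using abs_triangle_ineq[of "c\<^sup>2 * G r" "(2 * \<mu> + 1) * (W r / r)"] c2G by linarith
    also have "\<dots> = ?C * c\<^sup>2 * G r" using \<mu>2 by (simp add: algebra_simps)
    finally show "\<bar>c\<^sup>2 * G r + (2 * \<mu> + 1) * W r / r\<bar> \<le> ?C * c\<^sup>2 * G r" by simp
  next
    fix a b :: real assume ab: "0 < a" "a \<le> b" "1 \<le> b"
    have "G b \<le> G a * exp (- (c / (1 + m)) * (b - max 1 a))"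
      by (rule exp_decay_of_log_derivative[where W = W])
        (use ab Gder Wpos W_low in \<open>auto intro: less_imp_le\<close>)
    then have "G b * c\<^sup>2 \<le> G a * exp (- (c / (1 + m)) * (b - max 1 a)) * (4 * c\<^sup>2)"
      using Gpos[of a] ab by (intro mult_mono) auto
    then show "G b * c\<^sup>2 \<le> 4 * c\<^sup>2 * G a * exp (- (1 / (1 + m)) * c * (b - max 1 a))"
      by (simp add: algebra_simps)
  next
    show "(W has_real_derivative - (c\<^sup>2 * G r + (2 * \<mu> + 1) * W r / r)) (at r)" if "0 < r" for r
      using powr_bessel_K_has_derivative2[of c r \<mu>] that assms(2) by (simp add: G_def W_def)
  qed (use assms(1,2) Gpos Gder Wpos C m in \<open>auto intro: less_imp_le\<close>)
qed

lemma bessel_profile: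
  assumes "\<mu> \<in> {..<-1} \<union> {1..}"
  obtains C \<delta> where "\<And>c. 1 \<le> c \<Longrightarrow>
    \<exists>W V N. radial_profile (\<lambda>r. r powr (- \<mu>) * bessel_K \<mu> (c * r)) W V N c C \<delta>"
proof (cases "1 \<le> \<mu>")
  case True
  show ?thesis by (rule that) (use bessel_profile_pos[OF True] in blast)
next
  case False
  then have "\<mu> < -1" using assms by auto
  show ?thesis by (rule that) (use bessel_profile_neg[OF \<open>\<mu> < -1\<close>] in blast)
qed

section \<open>Quotients by periodizations\<close>

lemma int_eq_nonneg_Un_neg: "(UNIV::int set) = range int \<union> range (\<lambda>n. - int n - 1)"
proof -
  have "j \<in> range int \<union> range (\<lambda>n. - int n - 1)" for j :: int
  proof (cases "0 \<le> j")
    case True then show ?thesis by (auto intro!: image_eqI[of _ _ "nat j"])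
  next
    case False then show ?thesis by (auto intro!: image_eqI[of _ _ "nat (- j - 1)"])
  qed
  then show ?thesis by blast
qed

lemma summable_on_int:
  fixes f :: "int \<Rightarrow> 'a::{topological_comm_monoid_add, t2_space}"
  assumes "(\<lambda>n::nat. f (int n)) summable_on UNIV" "(\<lambda>n::nat. f (- int n - 1)) summable_on UNIV"
  shows "f summable_on UNIV"
  unfolding int_eq_nonneg_Un_neg
  by (intro summable_on_Un_disjoint)
    (use assms in \<open>auto simp: summable_on_reindex inj_on_def o_def\<close>)

text \<open>Pairing n with - n - 1 meets every integer once and turns unordered sums into ordinary
  series, to which termwise differentiation and Tannery's theorem apply.\<close>

lemma sums_infsum_int:
  fixes f :: "int \<Rightarrow> 'a::{topological_comm_monoid_add, t2_space}"
  assumes "(\<lambda>n::nat. f (int n)) summable_on UNIV" "(\<lambda>n::nat. f (- int n - 1)) summable_on UNIV"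
  shows "(\<lambda>n. f (int n) + f (- int n - 1)) sums (\<Sum>\<^sub>\<infinity>j. f j)"
proof -
  have "infsum f UNIV = infsum f (range int) + infsum f (range (\<lambda>n. - int n - 1))"
    unfolding int_eq_nonneg_Un_neg by (intro infsum_Un_disjoint)
      (use assms in \<open>auto simp: summable_on_reindex inj_on_def o_def\<close>)
  also have "\<dots> = (\<Sum>\<^sub>\<infinity>n. f (int n)) + (\<Sum>\<^sub>\<infinity>n. f (- int n - 1))"
    by (simp add: infsum_reindex inj_on_def o_def)
  finally show ?thesis
    using sums_add[OF has_sum_imp_sums has_sum_imp_sums, OF has_sum_infsum has_sum_infsum, OF assms] by simp
qed

definition periodize :: "(real \<Rightarrow> real) \<Rightarrow> real \<Rightarrow> real" where
  "periodize f x = (\<Sum>\<^sub>\<infinity>j\<in>(UNIV::int set). f (x + 2 * pi * of_int j))"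

definition exp_decaying :: "(real \<Rightarrow> real) \<Rightarrow> bool" where
  "exp_decaying f \<longleftrightarrow> (\<exists>K>0. \<exists>l>0. \<forall>x. \<bar>f x\<bar> \<le> K * exp (- l * \<bar>x\<bar>))"

lemma summable_exp_linear:
  fixes l :: real assumes "0 < l" shows "summable (\<lambda>n::nat. exp (- l * real n))"
proof -
  have "exp (- l * real n) = exp (- l) ^ n" for n by (simp add: exp_of_nat_mult[symmetric] mult.commute)
  then show ?thesis using assms by (simp add: summable_geometric)
qed

text \<open>A summable bound uniform for |x| <= R is what the M-test asks for, so 2 * pi * n is
  simply estimated below by n.\<close>

lemma exp_decaying_shift_bound:
  assumes "0 \<le> K" "0 < l" and f: "\<And>x. \<bar>f x\<bar> \<le> K * exp (- l * \<bar>x\<bar>)" and "\<bar>x\<bar> \<le> R"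
  shows "\<bar>f (x + 2 * pi * of_int (int n))\<bar> \<le> K * exp (l * R) * exp (- l * real n)"
    and "\<bar>f (x + 2 * pi * of_int (- int n - 1))\<bar> \<le> K * exp (l * R) * exp (- l * real n)"
proof -
  have gen: "\<bar>f y\<bar> \<le> K * exp (l * R) * exp (- l * real n)" if "real n - R \<le> \<bar>y\<bar>" for y
  proof -
    have "\<bar>f y\<bar> \<le> K * exp (- l * \<bar>y\<bar>)" by (rule f)
    also have "\<dots> \<le> K * exp (- l * (real n - R))"
      using that assms by (intro mult_left_mono) auto
    also have "\<dots> = K * exp (l * R) * exp (- l * real n)"
      by (simp add: mult.assoc algebra_simps flip: exp_add)
    finally show ?thesis .
  qed
  have n: "real n \<le> 2 * pi * real n" using pi_gt3 by (simp add: mult_le_cancel_right1)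
  then show "\<bar>f (x + 2 * pi * of_int (int n))\<bar> \<le> K * exp (l * R) * exp (- l * real n)"
    using assms(4) by (intro gen) auto
  have "2 * pi * of_int (- int n - 1) = - (2 * pi * real n) - 2 * pi" by (simp add: algebra_simps)
  then show "\<bar>f (x + 2 * pi * of_int (- int n - 1))\<bar> \<le> K * exp (l * R) * exp (- l * real n)"
    using assms(4) n pi_gt3 by (intro gen) linarith
qed

lemma exp_decaying_summable:
  assumes "exp_decaying f"
  shows "(\<lambda>n::nat. f (x + 2 * pi * of_int (int n))) summable_on UNIV"
    and "(\<lambda>n::nat. f (x + 2 * pi * of_int (- int n - 1))) summable_on UNIV"
    and "(\<lambda>j::int. f (x + 2 * pi * of_int j)) summable_on UNIV"
proof -
  from assms obtain K l where Kl: "0 < K" "0 < l" "\<And>x. \<bar>f x\<bar> \<le> K * exp (- l * \<bar>x\<bar>)"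
    unfolding exp_decaying_def by auto
  note b = exp_decaying_shift_bound[of K l f x "\<bar>x\<bar>", OF less_imp_le[OF Kl(1)] Kl(2) Kl(3) order_refl]
  have s: "summable (\<lambda>n::nat. K * exp (l * \<bar>x\<bar>) * exp (- l * real n))"
    by (intro summable_mult summable_exp_linear Kl)
  show 1: "(\<lambda>n::nat. f (x + 2 * pi * of_int (int n))) summable_on UNIV"
    by (intro norm_summable_imp_summable_on summable_comparison_test'[OF s, where N = 0])
      (use b(1) in \<open>simp only: real_norm_def abs_idempotent\<close>)
  show 2: "(\<lambda>n::nat. f (x + 2 * pi * of_int (- int n - 1))) summable_on UNIV"
    by (intro norm_summable_imp_summable_on summable_comparison_test'[OF s, where N = 0])
      (use b(2) in \<open>simp only: real_norm_def abs_idempotent\<close>)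
  show "(\<lambda>j::int. f (x + 2 * pi * of_int j)) summable_on UNIV"
    by (intro summable_on_int 1 2)
qed

lemma periodize_sums:
  assumes "exp_decaying f"
  shows "(\<lambda>n. f (x + 2 * pi * of_int (int n)) + f (x + 2 * pi * of_int (- int n - 1))) sums periodize f x"
  unfolding periodize_def
  using sums_infsum_int[OF exp_decaying_summable(1,2)[OF assms]] .

lemma periodize_has_derivative:
  assumes f: "exp_decaying f" and f': "exp_decaying f'"
    and der: "\<And>x. (f has_real_derivative f' x) (at x)"
  shows "(periodize f has_real_derivative periodize f' x) (at x)"
proof -
  from f' obtain K l where Kl: "0 < K" "0 < l" "\<And>x. \<bar>f' x\<bar> \<le> K * exp (- l * \<bar>x\<bar>)"
    unfolding exp_decaying_def by auto
  define R where "R = \<bar>x\<bar> + 1"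
  define T where "T f n x = f (x + 2 * pi * of_int (int n)) + f (x + 2 * pi * of_int (- int n - 1))"
    for f :: "real \<Rightarrow> real" and n x
  have b: "\<bar>T f' n y\<bar> \<le> 2 * (K * exp (l * R) * exp (- l * real n))" if "y \<in> {-R..R}" for n y
  proof -
    have "\<bar>y\<bar> \<le> R" using that by auto
    from exp_decaying_shift_bound[OF less_imp_le[OF Kl(1)] Kl(2) Kl(3) this, of n]
    show ?thesis unfolding T_def by linarith
  qed
  have "((\<lambda>x. \<Sum>n. T f n x) has_real_derivative (\<Sum>n. T f' n x)) (at x)"
  proof (rule has_field_derivative_series'(2)[where S = "{-R..R}" and ?x0.0 = x])
    show "uniformly_convergent_on {- R..R} (\<lambda>n x. \<Sum>i<n. T f' i x)"
      by (rule Weierstrass_m_test'[where M = "\<lambda>n. 2 * (K * exp (l * R) * exp (- l * real n))"])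
        (use b summable_exp_linear[OF Kl(2)] in \<open>auto intro!: summable_mult\<close>)
    show "summable (\<lambda>n. T f n x)"
      unfolding T_def using periodize_sums[OF f] by (rule sums_summable)
    show "(T f n has_real_derivative T f' n y) (at y within {- R..R})" for n y
      unfolding T_def
      by (auto intro!: derivative_eq_intros DERIV_chain2[OF has_field_derivative_at_within[OF der]]
        DERIV_chain'[of "\<lambda>x. x + a" for a] simp: o_def)
    show "x \<in> interior {-R..R}" by (auto simp: R_def)
  qed (auto simp: R_def)
  moreover have "(\<Sum>n. T f n x) = periodize f x" for x
    unfolding T_def by (rule sums_unique[symmetric, OF periodize_sums[OF f]])
  moreover have "(\<Sum>n. T f' n x) = periodize f' x"
    unfolding T_def by (rule sums_unique[symmetric, OF periodize_sums[OF f']])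
  ultimately show ?thesis by simp
qed

lemma periodize_shift: "periodize f (x + 2 * pi * of_int k) = periodize f x"
  unfolding periodize_def
  by (rule infsum_reindex_bij_witness[where i = "\<lambda>j. j - k" and j = "\<lambda>j. j + k"])
    (auto simp: algebra_simps)

lemma periodize_split:
  assumes "exp_decaying f"
  shows "(\<lambda>j::int. f (x + 2 * pi * of_int j)) summable_on (- {0})"
    and "periodize f x = f x + (\<Sum>\<^sub>\<infinity>j\<in>-{0}. f (x + 2 * pi * of_int j))"
proof -
  show s: "(\<lambda>j::int. f (x + 2 * pi * of_int j)) summable_on (- {0})"
    by (rule summable_on_subset_banach[OF exp_decaying_summable(3)[OF assms]]) simp
  have "periodize f x = infsum (\<lambda>j. f (x + 2 * pi * of_int j)) (insert 0 (- {0}))"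
    unfolding periodize_def by (rule infsum_cong_neutral) auto
  then show "periodize f x = f x + (\<Sum>\<^sub>\<infinity>j\<in>-{0}. f (x + 2 * pi * of_int j))"
    using s by (subst (asm) infsum_insert) auto
qed

lemma nearest_lattice_point:
  obtains k :: int and \<eta> :: real where "x = \<eta> + 2 * pi * of_int k" "\<bar>\<eta>\<bar> \<le> pi"
proof
  let ?k = "round (x / (2 * pi))"
  show "x = (x - 2 * pi * of_int ?k) + 2 * pi * of_int ?k" by simp
  have "\<bar>x / (2 * pi) - of_int ?k\<bar> \<le> 1 / 2"
    using of_int_round_abs_le[of "x / (2 * pi)"] by (simp add: abs_minus_commute)
  then have "2 * pi * \<bar>x / (2 * pi) - of_int ?k\<bar> \<le> pi"
    using mult_left_mono[of _ "1 / 2" "2 * pi"] by simp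
  also have "2 * pi * \<bar>x / (2 * pi) - of_int ?k\<bar> = \<bar>2 * pi * (x / (2 * pi) - of_int ?k)\<bar>"
    by (simp add: abs_mult)
  also have "2 * pi * (x / (2 * pi) - of_int ?k) = x - 2 * pi * of_int ?k"
    by (simp add: right_diff_distrib)
  finally show "\<bar>x - 2 * pi * of_int ?k\<bar> \<le> pi" .
qed

text \<open>Normalized so that j = 1 and j = -1 contribute 1 each. It sums the translates at the
  slowest admissible rate, c = 1, and thus depends on \<kappa> alone.\<close>

definition lattice_sum :: "real \<Rightarrow> real" where
  "lattice_sum \<kappa> = (\<Sum>\<^sub>\<infinity>j\<in>-{0::int}. exp (- \<kappa> * pi * (\<bar>of_int j\<bar> - 1)))"

lemma lattice_sum:
  assumes "0 < \<kappa>"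
  shows "(\<lambda>j::int. exp (- \<kappa> * pi * (\<bar>of_int j\<bar> - 1))) summable_on (-{0})" (is "?e summable_on _")
    and "1 \<le> lattice_sum \<kappa>"
proof -
  have "(\<lambda>j. ?e j) summable_on (UNIV::int set)"
  proof (rule summable_on_int)
    have *: "summable (\<lambda>n. exp (\<kappa> * pi) * exp (- (\<kappa> * pi) * real n))" "summable (\<lambda>n. exp (- (\<kappa> * pi) * real n))"
      using summable_exp_linear[of "\<kappa> * pi"] assms by (auto intro: summable_mult)
    show "(\<lambda>n::nat. ?e (int n)) summable_on UNIV"
      using *(1) by (intro summable_nonneg_imp_summable_on) (auto simp: algebra_simps simp flip: exp_add)
    show "(\<lambda>n::nat. ?e (- int n - 1)) summable_on UNIV"
      using *(2) by (intro summable_nonneg_imp_summable_on) (auto simp: algebra_simps)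
  qed
  then show s: "?e summable_on (-{0})"
    by (rule summable_on_subset_banach) simp
  have "sum ?e {1} \<le> infsum ?e (-{0})"
    by (rule finite_sum_le_infsum[OF s]) auto
  then show "1 \<le> lattice_sum \<kappa>" by (simp add: lattice_sum_def)
qed

text \<open>What all regularized profiles share, with C and \<kappa> independent of the
  regularization. By contrast \<open>n_bdd\<close> is qualitative: it secures convergence of the
  periodizations and enters no constant of the final estimates.\<close>

locale periodization =
  fixes g g1 g2 n :: "real \<Rightarrow> real" and c C \<kappa> :: real
  assumes c: "1 \<le> c" and C: "1 \<le> C" and \<kappa>: "0 < \<kappa>"
    and g_pos: "0 < g x"
    and g_deriv: "(g has_real_derivative g1 x) (at x)"
    and g1_deriv: "(g1 has_real_derivative g2 x) (at x)"
    and g1_le: "\<bar>g1 x\<bar> \<le> C * n x * g x"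
    and g2_le: "\<bar>g2 x\<bar> \<le> 2 * C * (n x)\<^sup>2 * g x"
    and n_ge: "c \<le> n x"
    and n_le: "1 \<le> \<bar>x\<bar> \<Longrightarrow> n x \<le> 2 * c"
    and n_bdd: "\<exists>M. \<forall>x. n x \<le> M"
    and g_shift: "\<bar>\<eta>\<bar> \<le> pi \<Longrightarrow> k \<noteq> 0 \<Longrightarrow> g (\<eta> + 2 * pi * of_int k) * (n \<eta>)\<^sup>2
      \<le> 4 * c\<^sup>2 * g \<eta> * exp (- \<kappa> * c * (\<bar>\<eta> + 2 * pi * of_int k\<bar> - pi * \<bar>of_int k\<bar>))"
begin

lemma n_pos: "0 < n x" using n_ge[of x] c by simp

lemma far_from_origin:
  assumes "\<bar>\<eta>\<bar> \<le> pi" "k \<noteq> 0"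
  shows "2 * pi * \<bar>of_int k\<bar> - \<bar>\<eta>\<bar> \<le> \<bar>\<eta> + 2 * pi * of_int k\<bar>" "1 \<le> \<bar>of_int k :: real\<bar>"
    and "pi * (2 * \<bar>of_int k\<bar> - 1) \<le> \<bar>\<eta> + 2 * pi * of_int k\<bar>"
    and "pi \<le> \<bar>\<eta> + 2 * pi * of_int k\<bar>"
proof -
  have "\<bar>2 * pi * of_int k\<bar> = 2 * pi * \<bar>of_int k\<bar>" by (simp add: abs_mult)
  then show 1: "2 * pi * \<bar>of_int k\<bar> - \<bar>\<eta>\<bar> \<le> \<bar>\<eta> + 2 * pi * of_int k\<bar>"
    using abs_triangle_ineq[of "\<eta> + 2 * pi * of_int k" "- \<eta>"] by simp
  show k: "1 \<le> \<bar>of_int k :: real\<bar>" using assms(2) by linarith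
  show 3: "pi * (2 * \<bar>of_int k\<bar> - 1) \<le> \<bar>\<eta> + 2 * pi * of_int k\<bar>"
    using 1 assms(1) by (simp add: algebra_simps)
  have "pi * 1 \<le> pi * (2 * \<bar>of_int k\<bar> - 1)"
    using k by (intro mult_left_mono) auto
  then show "pi \<le> \<bar>\<eta> + 2 * pi * of_int k\<bar>" using 3 by linarith
qed

text \<open>Re-expresses the decay by the distance of the point from pi at the price of half the
  rate; this is the origin of \<kappa> / 2 in the bounds for the symbol.\<close>

lemma half_distance:
  assumes "\<bar>\<eta>\<bar> \<le> pi" "k \<noteq> 0"
  shows "(\<bar>\<eta> + 2 * pi * of_int k\<bar> - pi) / 2 \<le> \<bar>\<eta> + 2 * pi * of_int k\<bar> - pi * \<bar>of_int k\<bar>"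
proof -
  have *: "(y - p) / 2 \<le> y - p * a" if "p * (2 * a - 1) \<le> y" for y p a :: real
    using that by (simp add: field_simps)
  show ?thesis by (rule *[OF far_from_origin(3)[OF assms]])
qed

lemma g_shift':
  assumes "\<bar>\<eta>\<bar> \<le> pi" "k \<noteq> 0"
  shows "g (\<eta> + 2 * pi * of_int k)
      \<le> 4 * g \<eta> * exp (- \<kappa> * c * (\<bar>\<eta> + 2 * pi * of_int k\<bar> - pi * \<bar>of_int k\<bar>))" (is "?g \<le> ?r")
proof -
  have "?g * c\<^sup>2 \<le> ?g * (n \<eta>)\<^sup>2"
    using n_ge[of \<eta>] c g_pos by (intro mult_left_mono power_mono) (auto intro: less_imp_le)
  also have "\<dots> \<le> ?r * c\<^sup>2" using g_shift[OF assms] by (simp add: mult_ac)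
  finally show ?thesis using c by simp
qed

text \<open>Compactness bounds g on the central cell and \<open>g_shift'\<close> compares all other
  cells with it. The constants may depend on the regularization and serve only summability.\<close>

lemma g_exp_decaying: "exp_decaying g" "exp_decaying g1" "exp_decaying g2"
proof -
  have "continuous_on {-pi..pi} g"
    using g_deriv by (intro continuous_at_imp_continuous_on ballI DERIV_isCont)
  from compact_imp_bounded[OF compact_continuous_image[OF this compact_Icc]]
  obtain B where "\<forall>y\<in>g ` {-pi..pi}. norm y \<le> B"
    unfolding bounded_iff by blast
  then have B: "\<bar>g x\<bar> \<le> B" if "x \<in> {-pi..pi}" for x
    using that by simp
  let ?l = "\<kappa> * c / 2"
  define K where "K = 4 * (\<bar>B\<bar> + 1) * exp (?l * pi)"
  have K: "0 < K" by (auto simp: K_def)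
  have l: "0 < ?l" using \<kappa> c by simp
  have g: "\<bar>g x\<bar> \<le> K * exp (- ?l * \<bar>x\<bar>)" for x
  proof -
    obtain k \<eta> where k: "x = \<eta> + 2 * pi * of_int k" "\<bar>\<eta>\<bar> \<le> pi" by (rule nearest_lattice_point)
    have "g x \<le> 4 * g \<eta> * exp (- ?l * (\<bar>x\<bar> - pi))"
    proof (cases "k = 0")
      case True
      then have "0 \<le> - ?l * (\<bar>x\<bar> - pi)" using k l by (intro mult_nonpos_nonpos) auto
      then have "1 \<le> exp (- ?l * (\<bar>x\<bar> - pi))" by simp
      then have "1 \<le> 4 * exp (- ?l * (\<bar>x\<bar> - pi))" by linarith
      from mult_right_mono[OF this less_imp_le[OF g_pos[of x]]]
      show ?thesis using True k by (simp add: mult_ac)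
    next
      case False
      have "- \<kappa> * c * (\<bar>x\<bar> - pi * \<bar>of_int k\<bar>) \<le> - ?l * (\<bar>x\<bar> - pi)"
        using mult_left_mono[OF half_distance[OF k(2) False], of "\<kappa> * c"] \<kappa> c by (simp add: k(1))
      then show ?thesis
        using g_shift'[OF k(2) False] g_pos[of \<eta>] k(1)
        by (auto intro: order_trans mult_left_mono)
    qed
    also have "\<dots> \<le> 4 * (\<bar>B\<bar> + 1) * exp (- ?l * (\<bar>x\<bar> - pi))"
    proof (intro mult_right_mono mult_left_mono)
      have "\<eta> \<in> {-pi..pi}" using k by auto
      from B[OF this] show "g \<eta> \<le> \<bar>B\<bar> + 1" by linarith
    qed auto
    also have "- ?l * (\<bar>x\<bar> - pi) = ?l * pi + - ?l * \<bar>x\<bar>"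
      by (simp add: right_diff_distrib diff_divide_distrib)
    finally have "g x \<le> K * exp (- ?l * \<bar>x\<bar>)"
      by (simp only: K_def exp_add mult_ac)
    then show ?thesis using g_pos[of x] by simp
  qed
  obtain M where M: "\<And>x. n x \<le> M" using n_bdd by auto
  have M0: "0 < M" using M[of 0] n_pos[of 0] by simp
  show "exp_decaying g" unfolding exp_decaying_def using K l g by blast
  have "\<bar>g1 x\<bar> \<le> (C * M * K) * exp (- ?l * \<bar>x\<bar>)" for x
  proof -
    have "\<bar>g1 x\<bar> \<le> (C * n x) * g x" by (rule g1_le)
    also have "\<dots> \<le> (C * M) * (K * exp (- ?l * \<bar>x\<bar>))"
      using M[of x] g[of x] g_pos[of x] C M0 n_pos[of x] by (intro mult_mono) auto
    finally show ?thesis by simp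
  qed
  moreover have "0 < C * M * K" using C M0 K by simp
  ultimately show "exp_decaying g1" unfolding exp_decaying_def using l by blast
  have "\<bar>g2 x\<bar> \<le> (2 * C * M\<^sup>2 * K) * exp (- ?l * \<bar>x\<bar>)" for x
  proof -
    have "\<bar>g2 x\<bar> \<le> (2 * C * (n x)\<^sup>2) * g x" by (rule g2_le)
    also have "\<dots> \<le> (2 * C * M\<^sup>2) * (K * exp (- ?l * \<bar>x\<bar>))"
      using M[of x] g[of x] g_pos[of x] C M0 n_pos[of x] by (intro mult_mono power_mono) auto
    finally show ?thesis by simp
  qed
  moreover have "0 < 2 * C * M\<^sup>2 * K" using C M0 K by simp
  ultimately show "exp_decaying g2" unfolding exp_decaying_def using l by blast
qed

abbreviation "Z \<equiv> lattice_sum \<kappa>"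

text \<open>The exponent is at least (pi - |\<eta>|) + pi * (|j| - 1). The first part keeps the full
  rate c and describes the transition layer; in the second, c is lowered to 1 so that the sum over j
  becomes the fixed constant Z.\<close>

lemma tail_sum:
  assumes \<eta>: "\<bar>\<eta>\<bar> \<le> pi"
  shows "(n \<eta>)\<^sup>2 * (\<Sum>\<^sub>\<infinity>j\<in>-{0}. g (\<eta> + 2 * pi * of_int j))
    \<le> 4 * c\<^sup>2 * g \<eta> * (Z * exp (- \<kappa> * c * (pi - \<bar>\<eta>\<bar>)))"
proof -
  let ?E = "exp (- \<kappa> * c * (pi - \<bar>\<eta>\<bar>))"
  have "(n \<eta>)\<^sup>2 * (\<Sum>\<^sub>\<infinity>j\<in>-{0}. g (\<eta> + 2 * pi * of_int j))
      = (\<Sum>\<^sub>\<infinity>j\<in>-{0}. (n \<eta>)\<^sup>2 * g (\<eta> + 2 * pi * of_int j))"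
    by (rule infsum_cmult_right'[symmetric])
  also have "\<dots> \<le> (\<Sum>\<^sub>\<infinity>j\<in>-{0::int}. 4 * c\<^sup>2 * g \<eta> * ?E * exp (- \<kappa> * pi * (\<bar>of_int j\<bar> - 1)))"
  proof (rule infsum_mono)
    show "(\<lambda>j. (n \<eta>)\<^sup>2 * g (\<eta> + 2 * pi * real_of_int j)) summable_on - {0}"
      by (intro summable_on_cmult_right periodize_split(1) g_exp_decaying)
    show "(\<lambda>j::int. 4 * c\<^sup>2 * g \<eta> * ?E * exp (- \<kappa> * pi * (\<bar>of_int j\<bar> - 1))) summable_on - {0}"
      by (intro summable_on_cmult_right lattice_sum \<kappa>)
    fix j :: int assume "j \<in> -{0}"
    then have j: "j \<noteq> 0" by simp
    let ?d = "\<bar>\<eta> + 2 * pi * of_int j\<bar> - pi * \<bar>of_int j\<bar>"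
    let ?p = "pi * (\<bar>of_int j\<bar> - 1)"
    have "0 \<le> ?p" using far_from_origin(2)[OF \<eta> j] by simp
    then have "\<kappa> * 1 * ?p \<le> \<kappa> * c * ?p"
      using \<kappa> c by (intro mult_right_mono mult_left_mono) auto
    moreover have "\<kappa> * c * ((pi - \<bar>\<eta>\<bar>) + ?p) \<le> \<kappa> * c * ?d"
      using far_from_origin(1)[OF \<eta> j] \<kappa> c by (intro mult_left_mono) (auto simp: algebra_simps)
    ultimately have "- \<kappa> * c * ?d \<le> - \<kappa> * c * (pi - \<bar>\<eta>\<bar>) + - \<kappa> * ?p"
      by (simp add: distrib_left)
    then have "exp (- \<kappa> * c * ?d) \<le> ?E * exp (- \<kappa> * pi * (\<bar>of_int j\<bar> - 1))"
      by (simp add: mult.assoc flip: exp_add)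
    then have "4 * c\<^sup>2 * g \<eta> * exp (- \<kappa> * c * ?d) \<le> 4 * c\<^sup>2 * g \<eta> * (?E * exp (- \<kappa> * pi * (\<bar>of_int j\<bar> - 1)))"
      using g_pos[of \<eta>] by (intro mult_left_mono) auto
    then show "(n \<eta>)\<^sup>2 * g (\<eta> + 2 * pi * of_int j)
        \<le> 4 * c\<^sup>2 * g \<eta> * ?E * exp (- \<kappa> * pi * (\<bar>of_int j\<bar> - 1))"
      using g_shift[OF \<eta> j] by (simp add: mult_ac)
  qed
  also have "\<dots> = 4 * c\<^sup>2 * g \<eta> * ?E * Z"
    unfolding lattice_sum_def by (rule infsum_cmult_right')
  finally show ?thesis by (simp add: mult_ac)
qed


section \<open>The symbol and its first two derivatives\<close>

abbreviation "S \<equiv> periodize g"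
abbreviation "S1 \<equiv> periodize g1"
abbreviation "S2 \<equiv> periodize g2"

text \<open>The Leibniz rule for F * S = g, solved each time for the highest derivative of F, so
  that no higher powers of S appear in the denominator.\<close>

definition "F x = g x / S x"
definition "F1 x = (g1 x - F x * S1 x) / S x"
definition "F2 x = (g2 x - 2 * F1 x * S1 x - F x * S2 x) / S x"

lemma g_le_S: "g x \<le> S x"
proof -
  have "0 \<le> (\<Sum>\<^sub>\<infinity>j\<in>-{0}. g (x + 2 * pi * of_int j))"
    by (rule infsum_nonneg) (simp add: g_pos less_imp_le)
  then show ?thesis using periodize_split(2)[OF g_exp_decaying(1), of x] by simp
qed

lemma S_pos: "0 < S x"
  using g_le_S[of x] g_pos[of x] by simp

lemma F_deriv: "(F has_real_derivative F1 x) (at x)"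
proof -
  have "((\<lambda>x. g x / S x) has_real_derivative F1 x) (at x)"
    using S_pos[of x]
    by (auto intro!: derivative_eq_intros g_deriv periodize_has_derivative[of g g1] g_exp_decaying
        simp: F_def F1_def field_simps)
  then show ?thesis by (simp add: F_def[abs_def])
qed

lemma F1_deriv: "(F1 has_real_derivative F2 x) (at x)"
proof -
  have "((\<lambda>x. (g1 x - F x * S1 x) / S x) has_real_derivative F2 x) (at x)"
    using S_pos[of x]
    by (auto intro!: derivative_eq_intros g1_deriv F_deriv periodize_has_derivative[of g g1]
        periodize_has_derivative[of g1 g2] g_exp_decaying g_deriv
        simp: F1_def F2_def field_simps)
  then show ?thesis by (simp add: F1_def[abs_def])
qed

text \<open>h and l * g agree at \<eta>, so the two periodizations differ only in the terms with j
  nonzero, which \<open>tail_sum\<close> controls.\<close>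

lemma tail_difference:
  assumes \<eta>: "\<bar>\<eta>\<bar> \<le> pi" and h: "exp_decaying h" and "0 \<le> B"
    and le: "\<And>j. j \<noteq> 0 \<Longrightarrow> \<bar>h (\<eta> + 2 * pi * of_int j) - l * g (\<eta> + 2 * pi * of_int j)\<bar>
      \<le> B * g (\<eta> + 2 * pi * of_int j)"
    and l: "h \<eta> = l * g \<eta>"
  shows "(n \<eta>)\<^sup>2 * \<bar>periodize h \<eta> - l * S \<eta>\<bar>
    \<le> B * (4 * c\<^sup>2 * g \<eta> * (Z * exp (- \<kappa> * c * (pi - \<bar>\<eta>\<bar>))))"
proof -
  let ?g = "\<lambda>j. g (\<eta> + 2 * pi * of_int j)" and ?h = "\<lambda>j. h (\<eta> + 2 * pi * of_int j)"
  note sg = periodize_split(1)[OF g_exp_decaying(1), of \<eta>]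
  note sh = periodize_split(1)[OF h, of \<eta>]
  have "periodize h \<eta> - l * S \<eta> = (\<Sum>\<^sub>\<infinity>j\<in>-{0}. ?h j) - l * (\<Sum>\<^sub>\<infinity>j\<in>-{0}. ?g j)"
    unfolding periodize_split(2)[OF h] periodize_split(2)[OF g_exp_decaying(1)] l
    by (simp add: algebra_simps)
  moreover have "\<bar>(\<Sum>\<^sub>\<infinity>j\<in>-{0}. ?h j) - l * (\<Sum>\<^sub>\<infinity>j\<in>-{0}. ?g j)\<bar> \<le> B * (\<Sum>\<^sub>\<infinity>j\<in>-{0}. ?g j)"
  proof -
    have "((\<lambda>j. ?h j + (- l) * ?g j) has_sum ((\<Sum>\<^sub>\<infinity>j\<in>-{0}. ?h j) + (- l) * (\<Sum>\<^sub>\<infinity>j\<in>-{0}. ?g j))) (-{0})"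
      by (intro has_sum_add has_sum_cmult_right has_sum_infsum sg sh)
    moreover have "((\<lambda>j. B * ?g j) has_sum (B * (\<Sum>\<^sub>\<infinity>j\<in>-{0}. ?g j))) (-{0})"
      by (intro has_sum_cmult_right has_sum_infsum sg)
    ultimately show ?thesis
      using norm_infsum_le[where f = "\<lambda>j. ?h j - l * ?g j" and X = "-{0}" and g = "\<lambda>j. B * ?g j"] le
      by simp
  qed
  ultimately have "(n \<eta>)\<^sup>2 * \<bar>periodize h \<eta> - l * S \<eta>\<bar> \<le> (n \<eta>)\<^sup>2 * (B * (\<Sum>\<^sub>\<infinity>j\<in>-{0}. ?g j))"
    by (intro mult_left_mono) auto
  also have "\<dots> = B * ((n \<eta>)\<^sup>2 * (\<Sum>\<^sub>\<infinity>j\<in>-{0}. ?g j))" by simp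
  also have "\<dots> \<le> B * (4 * c\<^sup>2 * g \<eta> * (Z * exp (- \<kappa> * c * (pi - \<bar>\<eta>\<bar>))))"
    by (rule mult_left_mono[OF tail_sum[OF \<eta>] \<open>0 \<le> B\<close>])
  finally show ?thesis .
qed


text \<open>
  Write \<open>x = \<eta> + 2 * pi * k\<close> with \<open>\<bar>\<eta>\<bar> \<le> pi\<close>. Numerator and denominator of \<open>F\<close> may both be divided by
  \<open>g \<eta>\<close>; in the derivatives this amounts to subtracting the multiples \<open>l0\<close>, \<open>m0\<close> of \<open>g\<close> that cancel
  the dominant term, which leaves only exponentially small contributions.
\<close>

lemma pointwise_bounds:
  defines "E \<equiv> \<lambda>x. exp (- (\<kappa> / 2) * c * \<bar>\<bar>x\<bar> - pi\<bar>)"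
  shows "0 < F x" "F x \<le> 4 * exp (- (\<kappa> / 2) * (\<bar>x\<bar> - pi))"
    and "\<bar>F1 x\<bar> \<le> 60 * C * Z * c * E x"
    and "\<bar>F2 x\<bar> \<le> 1760 * C\<^sup>2 * Z\<^sup>2 * c\<^sup>2 * E x"
proof -
  obtain k \<eta> where x: "x = \<eta> + 2 * pi * of_int k" and \<eta>: "\<bar>\<eta>\<bar> \<le> pi" by (rule nearest_lattice_point)
  have S: "S x = S \<eta>" "S1 x = S1 \<eta>" "S2 x = S2 \<eta>" unfolding x by (simp_all add: periodize_shift)
  \<comment> \<open>Up to constants, \<open>e\<close> measures g x against g \<eta> when x lies
    outside the central cell, and \<open>T\<close> measures the sum of the translates against g
    \<eta>. \<open>X\<close> is the one that governs the cell of x.\<close>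
  define e where "e = exp (- \<kappa> * c * (\<bar>x\<bar> - pi * \<bar>of_int k\<bar>))"
  define T where "T = exp (- \<kappa> * c * (pi - \<bar>\<eta>\<bar>))"
  define X where "X = (if k = 0 then T else e)"
  define l0 where "l0 = g1 \<eta> / g \<eta>"
  define m0 where "m0 = g2 \<eta> / g \<eta>"
  have Z: "1 \<le> Z" by (rule lattice_sum(2)[OF \<kappa>])
  have g0: "0 < g \<eta>" by (rule g_pos)
  have n0: "0 < n \<eta>" "c \<le> n \<eta>" using n_pos n_ge by auto
  have T1: "T \<le> 1" "0 < T" using \<kappa> c \<eta> by (auto simp: T_def)
  have l0: "\<bar>l0\<bar> \<le> C * n \<eta>" and l0_eq: "g1 \<eta> = l0 * g \<eta>"
    using g1_le[of \<eta>] g0 by (auto simp: l0_def abs_div divide_le_eq)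
  have m0: "\<bar>m0\<bar> \<le> 2 * C * (n \<eta>)\<^sup>2" and m0_eq: "g2 \<eta> = m0 * g \<eta>"
    using g2_le[of \<eta>] g0 by (auto simp: m0_def abs_div divide_le_eq)
  \<comment> \<open>Outside the central cell n y <= 2 * c <= 2 * n \<eta>, so the bounds at y and at
    \<eta> add up to 2 + 1 = 3 and to 2 * 4 + 2 = 10.\<close>
  have dif: "\<bar>g1 y - l0 * g y\<bar> \<le> 3 * C * n \<eta> * g y"
    "\<bar>g2 y - m0 * g y\<bar> \<le> 10 * C * (n \<eta>)\<^sup>2 * g y"
    if "y = \<eta> + 2 * pi * of_int j" "j \<noteq> 0" for y j
  proof -
    have "1 \<le> \<bar>y\<bar>" using far_from_origin(4)[OF \<eta> that(2)] that(1) pi_gt3 by linarith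
    then have ny: "n y \<le> 2 * n \<eta>" using n_le[of y] n0 by linarith
    have "\<bar>g1 y - l0 * g y\<bar> \<le> \<bar>g1 y\<bar> + \<bar>l0\<bar> * g y"
      using abs_triangle_ineq4[of "g1 y" "l0 * g y"] g_pos[of y] by (simp add: abs_mult)
    also have "\<dots> \<le> C * (2 * n \<eta>) * g y + C * n \<eta> * g y"
      using g1_le[of y] l0 ny g_pos[of y] C
      by (intro add_mono mult_right_mono order_trans[OF g1_le] mult_left_mono) auto
    finally show "\<bar>g1 y - l0 * g y\<bar> \<le> 3 * C * n \<eta> * g y" by (simp add: algebra_simps)
    have "\<bar>g2 y - m0 * g y\<bar> \<le> \<bar>g2 y\<bar> + \<bar>m0\<bar> * g y"
      using abs_triangle_ineq4[of "g2 y" "m0 * g y"] g_pos[of y] by (simp add: abs_mult)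
    also have "\<dots> \<le> 2 * C * (2 * n \<eta>)\<^sup>2 * g y + 2 * C * (n \<eta>)\<^sup>2 * g y"
      using m0 ny g_pos[of y] C n_pos[of y]
      by (intro add_mono mult_right_mono order_trans[OF g2_le] mult_left_mono power_mono) auto
    finally show "\<bar>g2 y - m0 * g y\<bar> \<le> 10 * C * (n \<eta>)\<^sup>2 * g y"
      by (simp add: power2_eq_square algebra_simps)
  qed
  define D1 where "D1 = S1 \<eta> - l0 * S \<eta>"
  define D2 where "D2 = S2 \<eta> - m0 * S \<eta>"
  define d1 where "d1 = g1 x - l0 * g x"
  define d2 where "d2 = g2 x - m0 * g x"
  have D1: "n \<eta> * \<bar>D1\<bar> \<le> 12 * C * c\<^sup>2 * Z * T * g \<eta>"
  proof -
    have "(n \<eta>)\<^sup>2 * \<bar>D1\<bar> \<le> (3 * C * n \<eta>) * (4 * c\<^sup>2 * g \<eta> * (Z * T))"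
      unfolding D1_def T_def
      by (rule tail_difference[OF \<eta> g_exp_decaying(2)]) (use C n0 l0_eq dif(1) in auto)
    then have "n \<eta> * (n \<eta> * \<bar>D1\<bar>) \<le> n \<eta> * (12 * C * c\<^sup>2 * Z * T * g \<eta>)"
      by (simp add: power2_eq_square mult_ac)
    then show ?thesis using n0 by simp
  qed
  have D2: "\<bar>D2\<bar> \<le> 40 * C * c\<^sup>2 * Z * T * g \<eta>"
  proof -
    have "(n \<eta>)\<^sup>2 * \<bar>D2\<bar> \<le> (10 * C * (n \<eta>)\<^sup>2) * (4 * c\<^sup>2 * g \<eta> * (Z * T))"
      unfolding D2_def T_def
      by (rule tail_difference[OF \<eta> g_exp_decaying(3)]) (use C n0 m0_eq dif(2) in auto)
    then have "(n \<eta>)\<^sup>2 * \<bar>D2\<bar> \<le> (n \<eta>)\<^sup>2 * (40 * C * c\<^sup>2 * Z * T * g \<eta>)"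
      by (simp add: mult_ac)
    then show ?thesis using n0 by simp
  qed
  have d1: "n \<eta> * \<bar>d1\<bar> \<le> 12 * C * c\<^sup>2 * e * g \<eta>" and d2: "\<bar>d2\<bar> \<le> 40 * C * c\<^sup>2 * e * g \<eta>"
    and Fe: "g x \<le> 4 * g \<eta> * e" if "k \<noteq> 0"
  proof -
    have gx: "g x * (n \<eta>)\<^sup>2 \<le> 4 * c\<^sup>2 * g \<eta> * e"
      using g_shift[OF \<eta> that] by (simp add: e_def x)
    have "n \<eta> * \<bar>d1\<bar> \<le> n \<eta> * (3 * C * n \<eta> * g x)"
      unfolding d1_def using dif(1)[OF x that] n0 by (intro mult_left_mono) auto
    also have "\<dots> = 3 * C * (g x * (n \<eta>)\<^sup>2)" by (simp add: power2_eq_square)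
    also have "\<dots> \<le> 3 * C * (4 * c\<^sup>2 * g \<eta> * e)" using C by (intro mult_left_mono gx) auto
    finally show "n \<eta> * \<bar>d1\<bar> \<le> 12 * C * c\<^sup>2 * e * g \<eta>" by (simp add: mult_ac)
    have "\<bar>d2\<bar> \<le> 10 * C * (g x * (n \<eta>)\<^sup>2)"
      unfolding d2_def using dif(2)[OF x that] by (simp add: mult_ac)
    also have "\<dots> \<le> 10 * C * (4 * c\<^sup>2 * g \<eta> * e)" using C by (intro mult_left_mono gx) auto
    finally show "\<bar>d2\<bar> \<le> 40 * C * c\<^sup>2 * e * g \<eta>" by (simp add: mult_ac)
    show "g x \<le> 4 * g \<eta> * e" using g_shift'[OF \<eta> that] by (simp add: e_def x)
  qed
  have d0: "d1 = 0" "d2 = 0" if "k = 0" using that x l0_eq m0_eq by (auto simp: d1_def d2_def)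
  have S0: "g \<eta> \<le> S \<eta>" "0 < S \<eta>" using g_le_S S_pos by auto
  have F0: "0 < F x" "F x \<le> 1" using g_pos[of x] S_pos[of x] g_le_S[of x] by (auto simp: F_def)
  have FS: "F x * S \<eta> = g x" using S0 by (simp add: F_def S)
  have div_S: "\<bar>a\<bar> / S \<eta> \<le> b" if "\<bar>a\<bar> \<le> b * g \<eta>" for a b
  proof -
    have "\<bar>a\<bar> / S \<eta> \<le> \<bar>a\<bar> / g \<eta>" using S0 g0 by (intro divide_left_mono) auto
    also have "\<dots> \<le> b" using that g0 by (simp add: divide_le_eq)
    finally show ?thesis .
  qed
  have Fe': "F x \<le> 4 * e" if "k \<noteq> 0"
    using Fe[OF that] div_S[of "g x" "4 * e"] g_pos[of x] by (simp add: F_def S mult_ac)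
  have X0: "0 < X" by (auto simp: X_def e_def T_def)
  \<comment> \<open>5 = 4 + 1. Outside the central cell F x itself is at most 4 * e, which makes the
    contribution of the denominator as small as that of the numerator even where T is close to
    1.\<close>
  have FT: "(if k = 0 then 0 else e) + F x * (Z * T) \<le> 5 * Z * X"
  proof (cases "k = 0")
    case True
    have "F x * (Z * T) \<le> 1 * (Z * T)" using F0 Z T1 by (intro mult_right_mono) auto
    also have "\<dots> \<le> 5 * (Z * T)" using Z T1 by simp
    finally show ?thesis using True by (simp add: X_def)
  next
    case False
    have e: "0 < e" by (simp add: e_def)
    have "F x * (Z * T) \<le> 4 * e * (Z * 1)"
      using Fe'[OF False] F0 Z T1 e by (intro mult_mono) auto
    moreover have "1 * e \<le> Z * e" using Z e by (intro mult_right_mono) auto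
    ultimately show ?thesis using False by (simp add: X_def algebra_simps)
  qed
  have F1: "F1 x = (d1 - F x * D1) / S \<eta>"
    unfolding F1_def S d1_def D1_def FS[symmetric] by (simp add: algebra_simps)
  \<comment> \<open>Only the last term retains an uncancelled logarithmic derivative, l0, which may
    be as large as C * n \<eta>.\<close>
  have F2: "F2 x = (d2 - F x * D2 - 2 * F1 x * D1) / S \<eta> - 2 * F1 x * l0"
    unfolding F2_def S d2_def D2_def D1_def FS[symmetric] using S0 by (simp add: field_simps)
  \<comment> \<open>The weight n \<eta>, which is large near a pole, is kept on the left so that it
    can absorb l0 in the bound for F2.\<close>
  have nF1: "n \<eta> * \<bar>F1 x\<bar> \<le> 60 * C * Z * c\<^sup>2 * X"
  proof -
    have "\<bar>n \<eta> * (d1 - F x * D1)\<bar> \<le> n \<eta> * \<bar>d1\<bar> + F x * (n \<eta> * \<bar>D1\<bar>)"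
      using abs_triangle_ineq4[of "n \<eta> * d1" "n \<eta> * (F x * D1)"] n0 F0
      by (simp add: abs_mult right_diff_distrib mult_ac)
    also have "\<dots> \<le> 12 * C * c\<^sup>2 * (if k = 0 then 0 else e) * g \<eta> + F x * (12 * C * c\<^sup>2 * Z * T * g \<eta>)"
      using d1 d0 D1 F0 by (intro add_mono mult_left_mono) auto
    also have "\<dots> = 12 * C * c\<^sup>2 * ((if k = 0 then 0 else e) + F x * (Z * T)) * g \<eta>"
      by (simp add: algebra_simps)
    also have "\<dots> \<le> 12 * C * c\<^sup>2 * (5 * Z * X) * g \<eta>"
      using FT C g0 by (intro mult_right_mono mult_left_mono) auto
    finally have "\<bar>n \<eta> * (d1 - F x * D1)\<bar> / S \<eta> \<le> 12 * C * c\<^sup>2 * (5 * Z * X)" by (rule div_S)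
    then show ?thesis using n0 S0 by (simp add: F1 abs_mult mult_ac)
  qed
  have F1b: "\<bar>F1 x\<bar> \<le> 60 * C * Z * c * X"
  proof -
    have "c * \<bar>F1 x\<bar> \<le> n \<eta> * \<bar>F1 x\<bar>" using n0 by (intro mult_right_mono) auto
    also note nF1
    finally have "c * \<bar>F1 x\<bar> \<le> c * (60 * C * Z * c * X)" by (simp add: power2_eq_square mult_ac)
    then show ?thesis using c by simp
  qed
  have F2b: "\<bar>F2 x\<bar> \<le> 1760 * C\<^sup>2 * Z\<^sup>2 * c\<^sup>2 * X"
  proof -
    have "\<bar>d2 - F x * D2\<bar> \<le> \<bar>d2\<bar> + F x * \<bar>D2\<bar>"
      using abs_triangle_ineq4[of d2 "F x * D2"] F0 by (simp add: abs_mult)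
    also have "\<dots> \<le> 40 * C * c\<^sup>2 * (if k = 0 then 0 else e) * g \<eta> + F x * (40 * C * c\<^sup>2 * Z * T * g \<eta>)"
      using d2 d0 D2 F0 by (intro add_mono mult_left_mono) auto
    also have "\<dots> = 40 * C * c\<^sup>2 * ((if k = 0 then 0 else e) + F x * (Z * T)) * g \<eta>"
      by (simp add: algebra_simps)
    also have "\<dots> \<le> 40 * C * c\<^sup>2 * (5 * Z * X) * g \<eta>"
      using FT C g0 by (intro mult_right_mono mult_left_mono) auto
    finally have a: "\<bar>d2 - F x * D2\<bar> / S \<eta> \<le> 40 * C * c\<^sup>2 * (5 * Z * X)" by (rule div_S)
    have "c * \<bar>D1\<bar> \<le> n \<eta> * \<bar>D1\<bar>" using n0 by (intro mult_right_mono) auto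
    also have "\<dots> \<le> 12 * C * c\<^sup>2 * Z * 1 * g \<eta>"
      by (rule order_trans[OF D1]) (use C Z T1 g0 in \<open>intro mult_right_mono mult_left_mono, auto\<close>)
    also have "\<dots> = c * (12 * C * c * Z * g \<eta>)" by (simp add: power2_eq_square)
    finally have "\<bar>D1\<bar> \<le> 12 * C * c * Z * g \<eta>" using c by simp
    then have b': "\<bar>D1\<bar> / S \<eta> \<le> 12 * C * c * Z" by (rule div_S)
    have b: "2 * \<bar>F1 x\<bar> * (\<bar>D1\<bar> / S \<eta>) \<le> 2 * (60 * C * Z * c * X) * (12 * C * c * Z)"
      using F1b b' C Z c X0 S0 by (intro mult_mono) auto
    have d: "2 * \<bar>F1 x\<bar> * \<bar>l0\<bar> \<le> 2 * (C * (60 * C * Z * c\<^sup>2 * X))"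
    proof -
      have "\<bar>F1 x\<bar> * \<bar>l0\<bar> \<le> \<bar>F1 x\<bar> * (C * n \<eta>)" using l0 by (intro mult_left_mono) auto
      also have "\<dots> = C * (n \<eta> * \<bar>F1 x\<bar>)" by simp
      also have "\<dots> \<le> C * (60 * C * Z * c\<^sup>2 * X)" using nF1 C by (intro mult_left_mono) auto
      finally show ?thesis by linarith
    qed
    have "\<bar>F2 x\<bar> \<le> \<bar>d2 - F x * D2\<bar> / S \<eta> + 2 * \<bar>F1 x\<bar> * (\<bar>D1\<bar> / S \<eta>) + 2 * \<bar>F1 x\<bar> * \<bar>l0\<bar>"
    proof -
      have "F2 x = (d2 - F x * D2) / S \<eta> - 2 * F1 x * (D1 / S \<eta>) - 2 * F1 x * l0"
        unfolding F2 by (simp add: diff_divide_distrib)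
      then show ?thesis
        using abs_triangle_ineq4[of "(d2 - F x * D2) / S \<eta> - 2 * F1 x * (D1 / S \<eta>)" "2 * F1 x * l0"]
          abs_triangle_ineq4[of "(d2 - F x * D2) / S \<eta>" "2 * F1 x * (D1 / S \<eta>)"] S0
        by (simp add: abs_mult)
    qed
    also have "\<dots> \<le> 40 * C * c\<^sup>2 * (5 * Z * X) + 2 * (60 * C * Z * c * X) * (12 * C * c * Z)
        + 2 * (C * (60 * C * Z * c\<^sup>2 * X))"
      by (intro add_mono a b d)
    \<comment> \<open>200 = 40 * 5, 1440 = 2 * 60 * 12 and 120 = 2 * 60. As C and Z are at least 1,
      all three products are at most (C * Z)^2, and the coefficients add up to 1760.\<close>
    also have "\<dots> = c\<^sup>2 * X * (200 * (C * Z) + 1440 * (C * Z * (C * Z)) + 120 * (C * (C * Z)))"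
      by (simp add: power2_eq_square algebra_simps)
    also have "\<dots> \<le> c\<^sup>2 * X * (200 * (C * Z * (C * Z)) + 1440 * (C * Z * (C * Z)) + 120 * (C * Z * (C * Z)))"
    proof (intro mult_left_mono add_mono)
      have CZ: "1 \<le> C * Z" using C Z mult_mono[of 1 C 1 Z] by simp
      then show "C * Z \<le> C * Z * (C * Z)" by (simp add: mult_le_cancel_left1)
      have "C \<le> C * Z" using C Z by (simp add: mult_le_cancel_left1)
      then show "C * (C * Z) \<le> C * Z * (C * Z)" using CZ by (intro mult_right_mono) auto
    qed (use X0 C Z in auto)
    also have "\<dots> = 1760 * C\<^sup>2 * Z\<^sup>2 * c\<^sup>2 * X" by (simp add: power2_eq_square algebra_simps)
    finally show ?thesis .
  qed
  \<comment> \<open>Inside the central cell the full rate \<kappa> * c is available; outside,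
    \<open>half_distance\<close> leaves half of it.\<close>
  have XE: "X \<le> E x"
  proof (cases "k = 0")
    case True
    then have "X = exp (- (\<kappa> * c) * \<bar>\<bar>x\<bar> - pi\<bar>)" using x \<eta> by (simp add: X_def T_def)
    also have "\<dots> \<le> E x" unfolding E_def using \<kappa> c by (simp add: mult_right_mono)
    finally show ?thesis .
  next
    case False
    have "(\<bar>x\<bar> - pi) / 2 \<le> \<bar>x\<bar> - pi * \<bar>of_int k\<bar>" "pi \<le> \<bar>x\<bar>"
      using half_distance[OF \<eta> False] far_from_origin(4)[OF \<eta> False] by (simp_all add: x)
    then have "\<kappa> * c * (\<bar>\<bar>x\<bar> - pi\<bar> / 2) \<le> \<kappa> * c * (\<bar>x\<bar> - pi * \<bar>of_int k\<bar>)"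
      using \<kappa> c by (intro mult_left_mono) auto
    then show ?thesis using False by (simp add: X_def e_def E_def)
  qed
  show "0 < F x" by (rule F0)
  show "F x \<le> 4 * exp (- (\<kappa> / 2) * (\<bar>x\<bar> - pi))"
  proof (cases "k = 0")
    case True
    then have "0 \<le> - (\<kappa> / 2) * (\<bar>x\<bar> - pi)" using \<kappa> \<eta> x by (intro mult_nonpos_nonpos) auto
    then have "1 \<le> exp (- (\<kappa> / 2) * (\<bar>x\<bar> - pi))" by simp
    then show ?thesis using F0 by linarith
  next
    case False
    have h: "(\<bar>x\<bar> - pi) / 2 \<le> \<bar>x\<bar> - pi * \<bar>of_int k\<bar>" "pi \<le> \<bar>x\<bar>"
      using half_distance[OF \<eta> False] far_from_origin(4)[OF \<eta> False] by (simp_all add: x)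
    have "\<kappa> * 1 * ((\<bar>x\<bar> - pi) / 2) \<le> \<kappa> * c * (\<bar>x\<bar> - pi * \<bar>of_int k\<bar>)"
      using \<kappa> c h by (intro mult_mono) auto
    then have "e \<le> exp (- (\<kappa> / 2) * (\<bar>x\<bar> - pi))" by (simp add: e_def)
    then show ?thesis using Fe'[OF False] by linarith
  qed
  show "\<bar>F1 x\<bar> \<le> 60 * C * Z * c * E x"
    by (rule order_trans[OF F1b]) (use XE C Z c in \<open>intro mult_left_mono, auto\<close>)
  show "\<bar>F2 x\<bar> \<le> 1760 * C\<^sup>2 * Z\<^sup>2 * c\<^sup>2 * E x"
    by (rule order_trans[OF F2b]) (use XE C Z c in \<open>intro mult_left_mono, auto\<close>)
qed

end

section \<open>Smoothing at the lattice points\<close>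

context radial_profile
begin

lemma G_antimono: "0 < a \<Longrightarrow> a \<le> b \<Longrightarrow> G b \<le> G a"
  by (rule antimono_on_interval[where f = G and f' = "\<lambda>r. - W r"]) (simp_all add: G_deriv W_nonneg)

lemma decay': "0 < a \<Longrightarrow> a \<le> b \<Longrightarrow> 1 \<le> b \<Longrightarrow> G b \<le> 4 * G a * exp (- \<delta> * c * (b - max 1 a))"
proof -
  assume ab: "0 < a" "a \<le> b" "1 \<le> b"
  have "G b * c\<^sup>2 \<le> G b * (N a)\<^sup>2"
    using N_ge[OF ab(1)] c G_pos[of b] ab by (intro mult_left_mono power_mono) auto
  also have "\<dots> \<le> 4 * G a * exp (- \<delta> * c * (b - max 1 a)) * c\<^sup>2"
    using decay[OF ab] by (simp add: mult_ac)
  finally show ?thesis using c by simp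
qed

text \<open>
  Replacing \<open>\<bar>x\<bar>\<close> by \<open>sqrt (x\<^sup>2 + e\<^sup>2)\<close> removes the singularities on the lattice, with bounds that
  are uniform in \<open>e\<close>.
\<close>

lemma smoothed_gap:
  assumes e: "0 < e" "e \<le> 1" and \<eta>: "\<bar>\<eta>\<bar> \<le> pi" and k: "k \<noteq> (0::int)"
  defines "b \<equiv> sqrt ((\<eta> + 2 * pi * of_int k)\<^sup>2 + e\<^sup>2)" and "a \<equiv> sqrt (\<eta>\<^sup>2 + e\<^sup>2)"
  shows "0 < a" "a \<le> b" "1 \<le> b"
    and "(\<bar>\<eta> + 2 * pi * of_int k\<bar> - pi * \<bar>of_int k\<bar>) / 2 \<le> b - max 1 a"
proof -
  define y where "y = \<eta> + 2 * pi * of_int k"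
  define K where "K = pi * \<bar>real_of_int k\<bar>"
  have k1: "1 \<le> \<bar>real_of_int k\<bar>" using k by linarith
  then have K: "pi \<le> K" by (simp add: K_def)
  have yK: "\<exists>s. \<bar>s\<bar> = \<bar>\<eta>\<bar> \<and> \<bar>y\<bar> = 2 * K + s"
  proof (cases "0 < k")
    case True
    then have "K = pi * of_int k" by (simp add: K_def)
    then have "y = \<eta> + 2 * K" by (simp add: y_def)
    moreover have "- \<eta> \<le> pi" using \<eta> by (simp add: abs_le_iff)
    ultimately have "\<bar>y\<bar> = 2 * K + \<eta>" using K pi_gt3 by (simp add: abs_of_nonneg)
    then show ?thesis by blast
  next
    case False
    then have "K = - (pi * of_int k)" by (simp add: K_def)
    then have "y = \<eta> - 2 * K" by (simp add: y_def)
    moreover have "\<eta> \<le> pi" using \<eta> by (simp add: abs_le_iff)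
    ultimately have "\<bar>y\<bar> = 2 * K + - \<eta>" using K pi_gt3 by (simp add: abs_of_nonpos)
    moreover have "\<bar>- \<eta>\<bar> = \<bar>\<eta>\<bar>" by simp
    ultimately show ?thesis by blast
  qed
  then obtain s where s: "\<bar>s\<bar> = \<bar>\<eta>\<bar>" "\<bar>y\<bar> = 2 * K + s" by blast
  define Y where "Y = \<bar>y\<bar>"
  have s2: "s\<^sup>2 = \<eta>\<^sup>2" using s(1) by (simp only: power2_eq_iff abs_eq_iff)
  have Y: "Y = 2 * K + s" "- pi \<le> s" "s \<le> pi" using s \<eta> by (auto simp: Y_def)
  have b_eq: "b = sqrt (y\<^sup>2 + e\<^sup>2)" by (simp add: b_def y_def)
  have b: "Y \<le> b" unfolding b_eq Y_def by (rule real_sqrt_ge_abs1)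
  then show b1: "1 \<le> b" using Y K pi_gt3 by linarith
  have "b \<le> Y + \<bar>e\<bar>" unfolding b_eq Y_def by (rule sqrt_sum_squares_le_sum_abs)
  then have "b \<le> Y + e" using e by simp
  then have b4: "b \<le> 4 * K" using Y K e pi_gt3 by linarith
  have ab2: "a\<^sup>2 = \<eta>\<^sup>2 + e\<^sup>2" "b\<^sup>2 = y\<^sup>2 + e\<^sup>2" by (auto simp: a_def b_eq)
  show a0: "0 < a" unfolding a_def using e by (simp add: add_nonneg_pos)
  have y2: "y\<^sup>2 = Y\<^sup>2" by (simp add: Y_def)
  \<comment> \<open>The regularization cancels in b^2 - a^2 = y^2 - \<eta>^2 = 4 * K * (K + s).
    Dividing by a + b <= 8 * K gives b - a >= (K + s) / 2 = (|y| - K) / 2, so the loss of one half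
    does not depend on e.\<close>
  have "b\<^sup>2 - a\<^sup>2 = (2 * K + s)\<^sup>2 - s\<^sup>2" unfolding ab2 y2 Y(1) s2 by simp
  also have "\<dots> = 4 * K * (K + s)" by (simp add: power2_eq_square algebra_simps)
  finally have eq: "(b - a) * (b + a) = 4 * K * (K + s)" by (simp add: power2_eq_square algebra_simps)
  have "0 \<le> 4 * K * (K + s)" using K Y pi_gt3 by (intro mult_nonneg_nonneg) linarith+
  then have "a\<^sup>2 \<le> b\<^sup>2" using eq by (simp add: power2_eq_square algebra_simps)
  then show ab: "a \<le> b" by (rule power2_le_imp_le) (use b1 in linarith)
  have "4 * K * (K + s) \<le> (b - a) * (8 * K)"
    unfolding eq[symmetric] using ab b4 by (intro mult_left_mono) linarith+
  then have "K * (4 * K + 4 * s) \<le> K * (8 * b - 8 * a)" by (simp only: algebra_simps)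
  then have "4 * K + 4 * s \<le> 8 * b - 8 * a"
    by (rule mult_le_cancel_left_pos[THEN iffD1, rotated]) (use K pi_gt3 in linarith)
  then have "(Y - K) / 2 \<le> b - a" using Y(1) by simp
  moreover have "Y - K \<le> 2 * b - 2" using b b1 K pi_gt3 by linarith
  then have "(Y - K) / 2 \<le> b - 1" by simp
  ultimately have "(Y - K) / 2 \<le> b - max 1 a" by (cases "1 \<le> a") (simp_all only: max_def if_True if_False)
  then show "(\<bar>\<eta> + 2 * pi * of_int k\<bar> - pi * \<bar>of_int k\<bar>) / 2 \<le> b - max 1 a"
    by (simp only: y_def K_def Y_def)
qed

text \<open>The second derivative of \<rho> is e^2 / \<rho>^3, at most 1 / \<rho> uniformly in e. It
  is multiplied by W, which is why a profile must bound W / r. This term and the one with V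
  contribute C each, whence 2 * C; the rate \<delta> / 2 is the loss in
  \<open>smoothed_gap\<close>.\<close>

lemma smoothed_periodization:
  assumes e: "0 < e" "e \<le> 1"
  defines "\<rho> \<equiv> \<lambda>x. sqrt (x\<^sup>2 + e\<^sup>2)"
  shows "periodization (\<lambda>x. G (\<rho> x)) (\<lambda>x. - W (\<rho> x) * (x / \<rho> x))
    (\<lambda>x. V (\<rho> x) * (x / \<rho> x)\<^sup>2 - W (\<rho> x) / \<rho> x * (e / \<rho> x)\<^sup>2) (\<lambda>x. N (\<rho> x)) c C (\<delta> / 2)"
proof -
  have \<rho>0: "0 < \<rho> x" for x unfolding \<rho>_def using e by (simp add: add_nonneg_pos)
  have \<rho>2: "(\<rho> x)\<^sup>2 = x\<^sup>2 + e\<^sup>2" for x by (simp add: \<rho>_def)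
  have \<rho>_ge: "\<bar>x\<bar> \<le> \<rho> x" "e \<le> \<rho> x" for x
    unfolding \<rho>_def by (rule real_sqrt_ge_abs1, rule real_sqrt_sum_squares_ge2)
  have \<rho>_der: "(\<rho> has_real_derivative x / \<rho> x) (at x)" for x
    unfolding \<rho>_def using \<rho>0[of x] e
    by (auto intro!: derivative_eq_intros simp: not_sum_power2_lt_zero add_nonneg_pos field_simps)
  have der: "((\<lambda>x. f (\<rho> x)) has_real_derivative - f' (\<rho> x) * (x / \<rho> x)) (at x)"
    if "\<And>r. 0 < r \<Longrightarrow> (f has_real_derivative - f' r) (at r)" for f f' x
    by (rule DERIV_chain2[where f = f and g = \<rho>]) (use that \<rho>0 \<rho>_der in auto)
  have sq: "0 \<le> (x / \<rho> x)\<^sup>2" "(x / \<rho> x)\<^sup>2 \<le> 1" "0 \<le> (e / \<rho> x)\<^sup>2" "(e / \<rho> x)\<^sup>2 \<le> 1" for x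
    unfolding power_divide \<rho>2 by (auto simp: divide_le_eq not_sum_power2_lt_zero)
  show ?thesis
  proof
    fix x
    show "((\<lambda>x. G (\<rho> x)) has_real_derivative - W (\<rho> x) * (x / \<rho> x)) (at x)"
      by (rule der) (rule G_deriv)
    have "((\<lambda>x. - W (\<rho> x) * (x / \<rho> x)) has_real_derivative
        - (- V (\<rho> x) * (x / \<rho> x)) * (x / \<rho> x)
        + (1 * \<rho> x - x * (x / \<rho> x)) / (\<rho> x * \<rho> x) * (- W (\<rho> x))) (at x)"
      using \<rho>0[of x]
      by (intro DERIV_mult DERIV_minus DERIV_divide DERIV_ident \<rho>_der der[of W V] W_deriv) auto
    moreover have "(1 * \<rho> x - x * (x / \<rho> x)) / (\<rho> x * \<rho> x) = 1 / \<rho> x * (e / \<rho> x)\<^sup>2"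
    proof -
      have "1 * \<rho> x - x * (x / \<rho> x) = ((\<rho> x)\<^sup>2 - x\<^sup>2) / \<rho> x"
        using \<rho>0[of x] by (simp add: field_simps power2_eq_square)
      then show ?thesis unfolding \<rho>2 by (simp add: power2_eq_square)
    qed
    ultimately show "((\<lambda>x. - W (\<rho> x) * (x / \<rho> x)) has_real_derivative
        V (\<rho> x) * (x / \<rho> x)\<^sup>2 - W (\<rho> x) / \<rho> x * (e / \<rho> x)\<^sup>2) (at x)"
      by (elim DERIV_cong) (simp only:, simp add: power2_eq_square mult_ac)
    have "\<bar>- W (\<rho> x) * (x / \<rho> x)\<bar> \<le> W (\<rho> x) * 1"
      unfolding abs_mult using W_nonneg[OF \<rho>0] \<rho>_ge[of x] \<rho>0[of x]
      by (intro mult_mono) (auto simp: divide_le_eq)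
    then show "\<bar>- W (\<rho> x) * (x / \<rho> x)\<bar> \<le> C * N (\<rho> x) * G (\<rho> x)"
      using W_le[OF \<rho>0, of x] by linarith
    have "\<bar>V (\<rho> x) * (x / \<rho> x)\<^sup>2\<bar> \<le> \<bar>V (\<rho> x)\<bar> * 1"
      unfolding abs_mult using sq[of x] by (intro mult_left_mono) auto
    moreover have "\<bar>W (\<rho> x) / \<rho> x * (e / \<rho> x)\<^sup>2\<bar> \<le> W (\<rho> x) / \<rho> x * 1"
      unfolding abs_mult using sq[of x] W_nonneg[OF \<rho>0, of x] \<rho>0[of x] by (intro mult_mono) auto
    ultimately show "\<bar>V (\<rho> x) * (x / \<rho> x)\<^sup>2 - W (\<rho> x) / \<rho> x * (e / \<rho> x)\<^sup>2\<bar>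
        \<le> 2 * C * (N (\<rho> x))\<^sup>2 * G (\<rho> x)"
      using V_le[OF \<rho>0, of x] W_div_le[OF \<rho>0, of x] by linarith
    show "N (\<rho> x) \<le> 2 * c" if "1 \<le> \<bar>x\<bar>"
      by (rule N_le) (use that \<rho>_ge[of x] in linarith)
  next
    show "\<exists>M. \<forall>x. N (\<rho> x) \<le> M"
      using N_antimono[OF e(1) \<rho>_ge(2)] by blast
  next
    fix \<eta> :: real and k :: int assume a: "\<bar>\<eta>\<bar> \<le> pi" "k \<noteq> 0"
    let ?b = "\<rho> (\<eta> + 2 * pi * of_int k)" and ?a = "\<rho> \<eta>"
    have gap: "0 < ?a" "?a \<le> ?b" "1 \<le> ?b"
      "(\<bar>\<eta> + 2 * pi * of_int k\<bar> - pi * \<bar>of_int k\<bar>) / 2 \<le> ?b - max 1 ?a"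
      unfolding \<rho>_def by (rule smoothed_gap[OF e a])+
    have "- \<delta> * c * (?b - max 1 ?a) \<le> - (\<delta> / 2) * c * (\<bar>\<eta> + 2 * pi * of_int k\<bar> - pi * \<bar>of_int k\<bar>)"
      using mult_left_mono[OF gap(4), of "\<delta> * c"] \<delta> c by simp
    then have "4 * c\<^sup>2 * G ?a * exp (- \<delta> * c * (?b - max 1 ?a)) \<le>
        4 * c\<^sup>2 * G ?a * exp (- (\<delta> / 2) * c * (\<bar>\<eta> + 2 * pi * of_int k\<bar> - pi * \<bar>of_int k\<bar>))"
      using G_pos[OF \<rho>0[of \<eta>]] by (intro mult_left_mono) auto
    with decay[OF gap(1-3)]
    show "G ?b * (N ?a)\<^sup>2 \<le> 4 * c\<^sup>2 * G ?a * exp (- (\<delta> / 2) * c * (\<bar>\<eta> + 2 * pi * of_int k\<bar> - pi * \<bar>of_int k\<bar>))"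
      by linarith
  qed (use c C \<delta> G_pos[OF \<rho>0] N_ge[OF \<rho>0] in auto)
qed

text \<open>Off the lattice all translates of x stay at least d away from the origin. As G decreases
  and \<rho> m y >= |y|, the exponentially decaying function G (max d |y|) dominates every
  regularized term, and Tannery's theorem applies.\<close>

lemma smoothed_limit:
  assumes x: "\<And>k::int. x \<noteq> 2 * pi * of_int k"
  defines "\<rho> \<equiv> \<lambda>m y. sqrt (y\<^sup>2 + (1 / real (Suc m))\<^sup>2)"
  shows "(\<lambda>m. G (\<rho> m x)) \<longlonglongrightarrow> G \<bar>x\<bar>"
    and "(\<lambda>m. periodize (\<lambda>y. G (\<rho> m y)) x) \<longlonglongrightarrow> periodize (\<lambda>y. G \<bar>y\<bar>) x"
    and "0 < periodize (\<lambda>y. G \<bar>y\<bar>) x"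
proof -
  obtain k \<eta> where k: "x = \<eta> + 2 * pi * of_int k" "\<bar>\<eta>\<bar> \<le> pi" by (rule nearest_lattice_point)
  define d where "d = min 1 \<bar>\<eta>\<bar>"
  have "\<eta> \<noteq> 0" using x[of k] k by auto
  then have d: "0 < d" "d \<le> 1" by (auto simp: d_def)
  have dist: "d \<le> \<bar>x + 2 * pi * of_int j\<bar>" for j
  proof (cases "k + j = 0")
    case True
    then have "k = - j" by simp
    then have "x + 2 * pi * of_int j = \<eta>" using k(1) by simp
    then show ?thesis by (simp add: d_def)
  next
    case False
    have eq: "x + 2 * pi * of_int j = \<eta> + 2 * pi * of_int (k + j)" using k by (simp add: algebra_simps)
    have "1 \<le> \<bar>real_of_int (k + j)\<bar>" using False by linarith
    then have "2 * pi * 1 \<le> 2 * pi * \<bar>real_of_int (k + j)\<bar>" by (intro mult_left_mono) auto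
    also have "\<dots> = \<bar>2 * pi * of_int (k + j)\<bar>" by (simp add: abs_mult)
    finally show ?thesis unfolding eq using k(2) pi_gt3 d(2)
        abs_triangle_ineq[of "\<eta> + 2 * pi * of_int (k + j)" "- \<eta>"] by simp
  qed
  define h where "h y = G (max d \<bar>y\<bar>)" for y
  have dm: "0 < max d y" for y using d by simp
  have h: "exp_decaying h"
  proof -
    define K where "K = (4 * G 1 + G d) * exp (\<delta> * c)"
    have G1: "0 < G 1" "0 < G d" using G_pos d by auto
    have "\<bar>h y\<bar> \<le> K * exp (- (\<delta> * c) * \<bar>y\<bar>)" for y
    proof -
      have "h y \<le> (4 * G 1 + G d) * exp (- \<delta> * c * (\<bar>y\<bar> - 1))"
      proof (cases "1 \<le> \<bar>y\<bar>")
        case True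
        then have "h y \<le> 4 * G 1 * exp (- \<delta> * c * (\<bar>y\<bar> - 1))"
          using decay'[of 1 "\<bar>y\<bar>"] d by (simp add: h_def max_def)
        also have "\<dots> \<le> (4 * G 1 + G d) * exp (- \<delta> * c * (\<bar>y\<bar> - 1))"
          using G1 by (intro mult_right_mono) auto
        finally show ?thesis .
      next
        case False
        then have "0 \<le> (- \<delta> * c) * (\<bar>y\<bar> - 1)" using \<delta> c by (intro mult_nonpos_nonpos) auto
        then have "1 \<le> exp (- \<delta> * c * (\<bar>y\<bar> - 1))" by simp
        then have "(4 * G 1 + G d) * 1 \<le> (4 * G 1 + G d) * exp (- \<delta> * c * (\<bar>y\<bar> - 1))"
          using G1 by (intro mult_left_mono) auto
        moreover have "h y \<le> G d" unfolding h_def by (rule G_antimono) (use d in auto)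
        then have "h y \<le> (4 * G 1 + G d) * 1" using G1 by simp
        ultimately show ?thesis by (rule order_trans[rotated])
      qed
      also have "- \<delta> * c * (\<bar>y\<bar> - 1) = \<delta> * c + - (\<delta> * c) * \<bar>y\<bar>" by (simp add: algebra_simps)
      finally have "h y \<le> K * exp (- (\<delta> * c) * \<bar>y\<bar>)" by (simp only: K_def exp_add mult_ac)
      moreover have "0 < h y" unfolding h_def by (rule G_pos[OF dm])
      ultimately show ?thesis by simp
    qed
    moreover have "0 < K" using G1 by (simp add: K_def add_pos_pos)
    moreover have "0 < \<delta> * c" using \<delta> c by simp
    ultimately show ?thesis unfolding exp_decaying_def by blast
  qed
  have Gh: "G \<bar>x + 2 * pi * of_int j\<bar> = h (x + 2 * pi * of_int j)" for j
    using dist[of j] by (simp add: h_def max_def)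
  then have Ph: "periodize (\<lambda>y. G \<bar>y\<bar>) x = periodize h x" by (simp add: periodize_def)
  have \<rho>_ge: "\<bar>y\<bar> \<le> \<rho> m y" for m y unfolding \<rho>_def by (rule real_sqrt_ge_abs1)
  have lim: "(\<lambda>m. G (\<rho> m y)) \<longlonglongrightarrow> G \<bar>y\<bar>" if "0 < \<bar>y\<bar>" for y
  proof (rule isCont_tendsto_compose[where g = G])
    show "isCont G \<bar>y\<bar>" by (rule DERIV_isCont[OF G_deriv[OF that]])
    have "(\<lambda>m. sqrt (y\<^sup>2 + (1 / real (Suc m))\<^sup>2)) \<longlonglongrightarrow> sqrt (y\<^sup>2 + 0\<^sup>2)"
      by (intro tendsto_intros LIMSEQ_Suc[OF lim_1_over_n])
    then show "(\<lambda>m. \<rho> m y) \<longlonglongrightarrow> \<bar>y\<bar>" by (simp add: \<rho>_def)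
  qed
  have pos: "0 < \<bar>x + 2 * pi * of_int j\<bar>" for j using dist[of j] d by linarith
  show "(\<lambda>m. G (\<rho> m x)) \<longlonglongrightarrow> G \<bar>x\<bar>" using pos[of 0] by (intro lim) simp
  let ?T = "\<lambda>f n. f (x + 2 * pi * of_int (int n)) + f (x + 2 * pi * of_int (- int n - 1))"
  have sm: "(\<lambda>n. ?T (\<lambda>y. G (\<rho> m y)) n) sums periodize (\<lambda>y. G (\<rho> m y)) x" for m
  proof -
    interpret P: periodization "\<lambda>y. G (\<rho> m y)" "\<lambda>x. - W (\<rho> m x) * (x / \<rho> m x)"
      "\<lambda>x. V (\<rho> m x) * (x / \<rho> m x)\<^sup>2 - W (\<rho> m x) / \<rho> m x * (1 / real (Suc m) / \<rho> m x)\<^sup>2"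
      "\<lambda>x. N (\<rho> m x)" c C "\<delta> / 2"
      using smoothed_periodization[of "1 / real (Suc m)"] by (simp add: \<rho>_def)
    show ?thesis by (rule periodize_sums[OF P.g_exp_decaying(1)])
  qed
  have "(\<lambda>m. suminf (\<lambda>n. ?T (\<lambda>y. G (\<rho> m y)) n)) \<longlonglongrightarrow> suminf (\<lambda>n. ?T (\<lambda>y. G \<bar>y\<bar>) n)"
  proof (rule tannerys_theorem[THEN conjunct2, THEN conjunct2])
    show "(\<lambda>m. ?T (\<lambda>y. G (\<rho> m y)) n) \<longlonglongrightarrow> ?T (\<lambda>y. G \<bar>y\<bar>) n" for n
      by (intro tendsto_add lim pos)
    show "summable (?T h)" using periodize_sums[OF h] by (rule sums_summable)
    have "norm (?T (\<lambda>y. G (\<rho> m y)) n) \<le> ?T h n" for m n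
    proof -
      have "0 \<le> G (\<rho> m (x + 2 * pi * of_int j)) \<and> G (\<rho> m (x + 2 * pi * of_int j)) \<le> h (x + 2 * pi * of_int j)" for j
      proof
        have "0 < \<rho> m (x + 2 * pi * of_int j)" using pos[of j] \<rho>_ge by (rule less_le_trans)
        then show "0 \<le> G (\<rho> m (x + 2 * pi * of_int j))" using G_pos less_imp_le by blast
        show "G (\<rho> m (x + 2 * pi * of_int j)) \<le> h (x + 2 * pi * of_int j)"
          unfolding Gh[symmetric] by (rule G_antimono[OF pos \<rho>_ge])
      qed
      note this[of "int n", THEN conjunct1] this[of "int n", THEN conjunct2]
        this[of "- int n - 1", THEN conjunct1] this[of "- int n - 1", THEN conjunct2]
      then show ?thesis unfolding real_norm_def by (intro abs_leI) linarith+
    qed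
    then show "\<forall>\<^sub>F (k, n) in sequentially \<times>\<^sub>F sequentially. norm (?T (\<lambda>y. G (\<rho> n y)) k) \<le> ?T h k"
      by (intro always_eventually) (simp only: split_paired_All prod.case simp_thms)
  qed simp
  moreover have "suminf (\<lambda>n. ?T (\<lambda>y. G \<bar>y\<bar>) n) = periodize (\<lambda>y. G \<bar>y\<bar>) x"
    using sums_unique[OF periodize_sums[OF h, of x]] unfolding Gh Ph by (rule sym)
  moreover have "suminf (\<lambda>n. ?T (\<lambda>y. G (\<rho> m y)) n) = periodize (\<lambda>y. G (\<rho> m y)) x" for m
    by (rule sums_unique[symmetric, OF sm])
  ultimately show "(\<lambda>m. periodize (\<lambda>y. G (\<rho> m y)) x) \<longlonglongrightarrow> periodize (\<lambda>y. G \<bar>y\<bar>) x" by simp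
  have "0 \<le> (\<Sum>\<^sub>\<infinity>j\<in>-{0}. h (x + 2 * pi * of_int j))"
    by (rule infsum_nonneg) (simp add: h_def G_pos[OF dm] less_imp_le)
  moreover have "0 < h x" unfolding h_def by (rule G_pos[OF dm])
  ultimately show "0 < periodize (\<lambda>y. G \<bar>y\<bar>) x"
    unfolding Ph periodize_split(2)[OF h] by linarith
qed

end

section \<open>Fourier decay\<close>

lemma integral_exp_abs:
  fixes l a :: real
  assumes l: "0 < l"
  shows "integrable lborel (\<lambda>x. exp (- l * \<bar>x - a\<bar>))"
    and "(LINT x|lborel. exp (- l * \<bar>x - a\<bar>)) \<le> 2 / l"
proof -
  let ?h = "\<lambda>x. indicator {0..} x *\<^sub>R exp (- l * x)"
  have "(\<integral>\<^sup>+x. ennreal (exp (- l * x)) * indicator {0..} x \<partial>lborel) = ennreal (0 - (- exp (- l * 0) / l))"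
  proof (rule nn_integral_FTC_atLeast)
    have "((\<lambda>x. exp (- l * x)) \<longlongrightarrow> 0) at_top"
      by (rule filterlim_compose[OF exp_at_bot filterlim_tendsto_neg_mult_at_bot[OF tendsto_const _ filterlim_ident]])
        (use l in simp)
    then show "((\<lambda>x. - exp (- l * x) / l) \<longlongrightarrow> 0) at_top"
      using tendsto_divide[OF tendsto_minus tendsto_const, of _ 0 _ l] l by fastforce
  qed (use l in \<open>auto intro!: derivative_eq_intros\<close>)
  then have "(\<integral>\<^sup>+x. ennreal (?h x) \<partial>lborel) = ennreal (1 / l)"
    by (simp add: ennreal_mult ennreal_indicator mult.commute[of _ "indicator _ _"])
  then have h: "has_bochner_integral lborel ?h (1 / l)"
    using l by (intro has_bochner_integral_nn_integral) auto
  have h1: "has_bochner_integral lborel (\<lambda>x. ?h (- a + 1 * x)) (1 / l)"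
    using lborel_has_bochner_integral_real_affine_iff[of 1 ?h "1 / l" "- a"] h by simp
  have h2: "has_bochner_integral lborel (\<lambda>x. ?h (a + (- 1) * x)) (1 / l)"
    using lborel_has_bochner_integral_real_affine_iff[of "- 1" ?h "1 / l" a] h by simp
  have s: "has_bochner_integral lborel (\<lambda>x. ?h (- a + 1 * x) + ?h (a + (- 1) * x)) (1 / l + 1 / l)"
    by (rule has_bochner_integral_add[OF h1 h2])
  have le: "exp (- l * \<bar>x - a\<bar>) \<le> ?h (- a + 1 * x) + ?h (a + (- 1) * x)" for x
    by (auto simp: indicator_def abs_if algebra_simps)
  show int: "integrable lborel (\<lambda>x. exp (- l * \<bar>x - a\<bar>))"
    by (rule Bochner_Integration.integrable_bound[OF integrable.intros[OF s]])
      (use le in \<open>auto intro!: AE_I2 order_trans[OF le] simp: abs_of_nonneg simp del: mult_minus_left\<close>)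
  have "(LINT x|lborel. exp (- l * \<bar>x - a\<bar>)) \<le> (LINT x|lborel. ?h (- a + 1 * x) + ?h (a + (- 1) * x))"
    by (rule integral_mono[OF int integrable.intros[OF s] le])
  also have "\<dots> = 2 / l" using has_bochner_integral_integral_eq[OF s] by simp
  finally show "(LINT x|lborel. exp (- l * \<bar>x - a\<bar>)) \<le> 2 / l" .
qed

lemma integral_exp_two_centers:
  fixes l p :: real
  assumes l: "0 < l"
  shows "integrable lborel (\<lambda>x. exp (- l * \<bar>\<bar>x\<bar> - p\<bar>))"
    and "(LINT x|lborel. exp (- l * \<bar>\<bar>x\<bar> - p\<bar>)) \<le> 4 / l"
proof -
  note i = integral_exp_abs[OF l, of p] integral_exp_abs[OF l, of "- p"]
  have le: "exp (- l * \<bar>\<bar>x\<bar> - p\<bar>) \<le> exp (- l * \<bar>x - p\<bar>) + exp (- l * \<bar>x - - p\<bar>)" for x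
  proof (cases "0 \<le> x")
    case False
    then have "\<bar>\<bar>x\<bar> - p\<bar> = \<bar>x - - p\<bar>" by simp
    then show ?thesis by simp
  qed simp
  show int: "integrable lborel (\<lambda>x. exp (- l * \<bar>\<bar>x\<bar> - p\<bar>))"
  proof (rule Bochner_Integration.integrable_bound)
    show "integrable lborel (\<lambda>x. exp (- l * \<bar>x - p\<bar>) + exp (- l * \<bar>x - - p\<bar>))" using i by simp
    show "AE x in lborel. norm (exp (- l * \<bar>\<bar>x\<bar> - p\<bar>)) \<le> norm (exp (- l * \<bar>x - p\<bar>) + exp (- l * \<bar>x - - p\<bar>))"
      using le by (intro AE_I2) (simp add: abs_of_nonneg add_nonneg_nonneg)
  qed simp
  have "(LINT x|lborel. exp (- l * \<bar>\<bar>x\<bar> - p\<bar>))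
      \<le> (LINT x|lborel. exp (- l * \<bar>x - p\<bar>) + exp (- l * \<bar>x - - p\<bar>))"
    by (rule integral_mono[OF int _ le]) (use i in simp)
  also have "\<dots> = (LINT x|lborel. exp (- l * \<bar>x - p\<bar>)) + (LINT x|lborel. exp (- l * \<bar>x - - p\<bar>))"
    by (rule Bochner_Integration.integral_add) (use i in auto)
  also have "\<dots> \<le> 2 / l + 2 / l" by (intro add_mono i)
  finally show "(LINT x|lborel. exp (- l * \<bar>\<bar>x\<bar> - p\<bar>)) \<le> 4 / l" by simp
qed

lemma integral_vector_derivative_eq_0:
  fixes f f' :: "real \<Rightarrow> complex"
  assumes der: "\<And>x. (f has_vector_derivative f' x) (at x)"
    and int: "integrable lborel f'"
    and lim: "(f \<longlongrightarrow> 0) at_top" "(f \<longlongrightarrow> 0) at_bot"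
  shows "(LINT x|lborel. f' x) = 0"
proof (rule LIMSEQ_unique)
  let ?s = "\<lambda>n x. indicator {- real n..real n} x *\<^sub>R f' x"
  show "(\<lambda>n. LINT x|lborel. ?s n x) \<longlonglongrightarrow> (LINT x|lborel. f' x)"
  proof (rule integral_dominated_convergence[where w = "\<lambda>x. norm (f' x)"])
    show "AE x in lborel. (\<lambda>n. ?s n x) \<longlonglongrightarrow> f' x"
    proof (rule AE_I2)
      fix x :: real
      obtain m :: nat where m: "\<bar>x\<bar> \<le> real m" using real_arch_simple by blast
      have "\<forall>\<^sub>F n in sequentially. ?s n x = f' x"
        using eventually_ge_at_top[of m]
      proof eventually_elim
        case (elim n)
        then have "real m \<le> real n" by simp
        with m have "x \<in> {- real n..real n}" by (auto simp: abs_le_iff)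
        then show ?case by simp
      qed
      then show "(\<lambda>n. ?s n x) \<longlonglongrightarrow> f' x" by (rule tendsto_eventually)
    qed
  qed (use int in \<open>auto intro!: AE_I2 simp: indicator_def\<close>)
  have "(LINT x|lborel. ?s n x) = f (real n) - f (- real n)" for n
  proof -
    have "set_integrable lborel {- real n..real n} f'"
      unfolding set_integrable_def by (intro integrable_mult_indicator int) simp
    then have "(LINT x|lborel. ?s n x) = integral {- real n..real n} f'"
      using set_borel_integral_eq_integral(2) by (simp add: set_lebesgue_integral_def)
    also have "\<dots> = f (real n) - f (- real n)"
      by (intro integral_unique fundamental_theorem_of_calculus)
        (auto intro: has_vector_derivative_at_within der)
    finally show ?thesis .
  qed
  moreover have "(\<lambda>n. f (real n) - f (- real n)) \<longlonglongrightarrow> 0 - 0"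
    by (intro tendsto_diff filterlim_compose[OF lim(1)] filterlim_compose[OF lim(2)]
        filterlim_real_sequentially filterlim_compose[OF filterlim_uminus_at_bot_at_top])
  ultimately show "(\<lambda>n. LINT x|lborel. ?s n x) \<longlonglongrightarrow> 0" by simp
qed

text \<open>A pointwise limit of difference quotients. This is meant for F2, which is known only as
  a derivative and not as a continuous function.\<close>

lemma borel_measurable_derivative:
  fixes f f' :: "real \<Rightarrow> real"
  assumes "\<And>x. (f has_real_derivative f' x) (at x)"
  shows "f' \<in> borel_measurable borel"
proof (rule borel_measurable_LIMSEQ_real)
  have [measurable]: "f \<in> borel_measurable borel"
    by (intro borel_measurable_continuous_onI continuous_at_imp_continuous_on ballI DERIV_isCont[OF assms])
  show "(\<lambda>x. (f (x + 1 / real (Suc n)) - f x) / (1 / real (Suc n))) \<in> borel_measurable borel" for n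
    by measurable
  have "filterlim (\<lambda>n. 1 / real (Suc n)) (at 0) sequentially"
    by (rule filterlim_atI[OF LIMSEQ_Suc[OF lim_1_over_n]]) simp
  then show "(\<lambda>n. (f (x + 1 / real (Suc n)) - f x) / (1 / real (Suc n))) \<longlonglongrightarrow> f' x" for x
    using assms[of x] unfolding DERIV_def by (rule filterlim_compose[rotated])
qed

text \<open>Integration by parts: the derivative of f times the exponential has integral 0. Norms
  suffice later and dispose of the factor i and the sign.\<close>

lemma fourier_derivative:
  fixes f f' :: "real \<Rightarrow> real" and t :: real
  assumes der: "\<And>x. (f has_real_derivative f' x) (at x)"
    and int: "integrable lborel f" "integrable lborel f'"
    and lim: "(f \<longlongrightarrow> 0) at_top" "(f \<longlongrightarrow> 0) at_bot"
  shows "\<bar>t\<bar> * norm (LINT x|lborel. of_real (f x) * exp (\<i> * of_real (t * x)))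
    = norm (LINT x|lborel. of_real (f' x) * exp (\<i> * of_real (t * x)))"
proof -
  let ?e = "\<lambda>x. exp (\<i> * of_real (t * x))"
  have ie: "integrable lborel (\<lambda>x. of_real (h x) * ?e x)" if "integrable lborel h" for h :: "real \<Rightarrow> real"
    by (rule Bochner_Integration.integrable_bound[OF that]) (use that in \<open>auto simp: norm_mult\<close>)
  have "(LINT x|lborel. of_real (f x) * (\<i> * of_real t * ?e x) + of_real (f' x) * ?e x) = 0"
  proof (rule integral_vector_derivative_eq_0)
    show "((\<lambda>x. of_real (f x) * ?e x) has_vector_derivative
        of_real (f x) * (\<i> * of_real t * ?e x) + of_real (f' x) * ?e x) (at x)" for x
    proof (rule has_vector_derivative_mult)
      show "((\<lambda>x. of_real (f x)) has_vector_derivative complex_of_real (f' x)) (at x)"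
        by (rule has_vector_derivative_of_real[OF der])
      have "((\<lambda>x. \<i> * of_real (t * x)) has_vector_derivative \<i> * of_real t) (at x)"
        by (auto intro!: derivative_eq_intros has_vector_derivative_mult_right)
      from field_vector_diff_chain_at[OF this DERIV_exp]
      show "(?e has_vector_derivative \<i> * of_real t * ?e x) (at x)" by (simp add: o_def)
    qed
    show "integrable lborel (\<lambda>x. of_real (f x) * (\<i> * of_real t * ?e x) + of_real (f' x) * ?e x)"
      using integrable_mult_right[OF ie[OF int(1)], of "\<i> * of_real t"] ie[OF int(2)]
      by (intro Bochner_Integration.integrable_add) (simp_all add: mult_ac)
    show "((\<lambda>x. of_real (f x) * ?e x) \<longlongrightarrow> 0) at_top" "((\<lambda>x. of_real (f x) * ?e x) \<longlongrightarrow> 0) at_bot"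
      using lim[THEN tendsto_rabs_zero]
      by (auto intro: Lim_null_comparison[where g = "\<lambda>x. \<bar>f x\<bar>"] simp: norm_mult)
  qed
  also have "(LINT x|lborel. of_real (f x) * (\<i> * of_real t * ?e x) + of_real (f' x) * ?e x)
      = (LINT x|lborel. \<i> * of_real t * (of_real (f x) * ?e x)) + (LINT x|lborel. of_real (f' x) * ?e x)"
    using integrable_mult_right[OF ie[OF int(1)], of "\<i> * of_real t"] ie[OF int(2)]
    by (subst Bochner_Integration.integral_add[symmetric]) (simp_all add: mult_ac)
  also have "(LINT x|lborel. \<i> * of_real t * (of_real (f x) * ?e x))
      = \<i> * of_real t * (LINT x|lborel. of_real (f x) * ?e x)"
    by (rule integral_mult_right_zero)
  finally have "(LINT x|lborel. of_real (f' x) * ?e x) = - (\<i> * of_real t * (LINT x|lborel. of_real (f x) * ?e x))"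
    by (simp add: add_eq_0_iff)
  then show ?thesis by (simp add: norm_mult)
qed

lemma norm_fourier_le:
  fixes f B :: "real \<Rightarrow> real"
  assumes "f \<in> borel_measurable borel" "integrable lborel B" "\<And>x. \<bar>f x\<bar> \<le> B x"
  shows "integrable lborel f"
    and "norm (LINT x|lborel. of_real (f x) * exp (\<i> * of_real (t * x))) \<le> (LINT x|lborel. B x)"
proof -
  show int: "integrable lborel f"
    by (rule Bochner_Integration.integrable_bound[OF assms(2)])
      (use assms in \<open>auto intro!: AE_I2 order_trans[OF assms(3) abs_ge_self]\<close>)
  have "norm (LINT x|lborel. of_real (f x) * exp (\<i> * of_real (t * x)))
      \<le> (LINT x|lborel. norm (of_real (f x) * exp (\<i> * of_real (t * x))))"
    by (rule integral_norm_bound)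
  also have "\<dots> = (LINT x|lborel. \<bar>f x\<bar>)" by (simp add: norm_mult)
  also have "\<dots> \<le> (LINT x|lborel. B x)"
    by (rule integral_mono) (use int assms in auto)
  finally show "norm (LINT x|lborel. of_real (f x) * exp (\<i> * of_real (t * x))) \<le> (LINT x|lborel. B x)" .
qed

lemma exp_abs_tendsto_0:
  assumes "0 < l"
  shows "((\<lambda>x::real. exp (- l * \<bar>\<bar>x\<bar> - p\<bar>)) \<longlongrightarrow> 0) at_top" "((\<lambda>x::real. exp (- l * \<bar>\<bar>x\<bar> - p\<bar>)) \<longlongrightarrow> 0) at_bot"
proof -
  have *: "((\<lambda>x::real. exp (l * p) * exp (- l * x)) \<longlongrightarrow> 0) at_top"
    by (rule tendsto_mult_right_zero, rule filterlim_compose[OF exp_at_bot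
        filterlim_tendsto_neg_mult_at_bot[OF tendsto_const _ filterlim_ident]]) (use assms in simp)
  have le: "norm (exp (- l * \<bar>\<bar>x\<bar> - p\<bar>)) \<le> exp (l * p) * exp (- l * y)" if "y = \<bar>x\<bar>" for x y
    using assms that abs_ge_self[of "\<bar>x\<bar> - p"] mult_left_mono[OF abs_ge_self[of "\<bar>x\<bar> - p"], of l]
    by (simp add: algebra_simps flip: exp_add)
  show "((\<lambda>x::real. exp (- l * \<bar>\<bar>x\<bar> - p\<bar>)) \<longlongrightarrow> 0) at_top"
  proof (rule Lim_null_comparison[OF _ *])
    show "\<forall>\<^sub>F x::real in at_top. norm (exp (- l * \<bar>\<bar>x\<bar> - p\<bar>)) \<le> exp (l * p) * exp (- l * x)"
      using eventually_ge_at_top[of 0] by eventually_elim (rule le, simp)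
  qed
  show "((\<lambda>x::real. exp (- l * \<bar>\<bar>x\<bar> - p\<bar>)) \<longlongrightarrow> 0) at_bot"
  proof (rule Lim_null_comparison[OF _ filterlim_compose[OF * filterlim_uminus_at_top_at_bot]])
    show "\<forall>\<^sub>F x::real in at_bot. norm (exp (- l * \<bar>\<bar>x\<bar> - p\<bar>)) \<le> exp (l * p) * exp (- l * - x)"
      using eventually_le_at_bot[of 0] by eventually_elim (rule le, simp)
  qed
qed

text \<open>A majorant that depends neither on c nor on the regularization. It bounds the integral
  of the symbol and later dominates when the regularization is removed.\<close>

lemma (in periodization) F_le_exp:
  "\<bar>F x\<bar> \<le> 4 * exp (\<kappa> * pi) * exp (- (\<kappa> / 2) * \<bar>\<bar>x\<bar> - pi\<bar>)"
proof -
  have "- (\<kappa> / 2) * (\<bar>x\<bar> - pi) \<le> \<kappa> * pi + - (\<kappa> / 2) * \<bar>\<bar>x\<bar> - pi\<bar>"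
  proof (cases "pi \<le> \<bar>x\<bar>")
    case True
    then show ?thesis using \<kappa> by simp
  next
    case False
    then have eq: "\<bar>\<bar>x\<bar> - pi\<bar> = pi - \<bar>x\<bar>" by simp
    have "0 \<le> \<kappa> * \<bar>x\<bar>" using \<kappa> by simp
    then show ?thesis unfolding eq by (simp add: field_simps)
  qed
  then have "exp (- (\<kappa> / 2) * (\<bar>x\<bar> - pi)) \<le> exp (\<kappa> * pi) * exp (- (\<kappa> / 2) * \<bar>\<bar>x\<bar> - pi\<bar>)"
    by (simp flip: exp_add)
  then show ?thesis using pointwise_bounds(1,2)[of x] by simp
qed

lemma (in periodization) fourier_F_bounds:
  fixes t :: real
  defines "I \<equiv> norm (LINT x|lborel. of_real (F x) * exp (\<i> * of_real (t * x)))"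
  shows "F \<in> borel_measurable borel"
    and "I \<le> 4 * exp (\<kappa> * pi) * (8 / \<kappa>)" "\<bar>t\<bar> * I \<le> 480 * C * Z / \<kappa>"
    and "t\<^sup>2 * I \<le> 14080 * C\<^sup>2 * Z\<^sup>2 / \<kappa> * c"
proof -
  let ?l = "\<kappa> / 2" and ?lc = "\<kappa> / 2 * c"
  have l: "0 < ?l" "0 < ?lc" using \<kappa> c by auto
  let ?B0 = "\<lambda>x. 4 * exp (\<kappa> * pi) * exp (- ?l * \<bar>\<bar>x\<bar> - pi\<bar>)"
  let ?B1 = "\<lambda>x. 60 * C * Z * c * exp (- ?lc * \<bar>\<bar>x\<bar> - pi\<bar>)"
  let ?B2 = "\<lambda>x. 1760 * C\<^sup>2 * Z\<^sup>2 * c\<^sup>2 * exp (- ?lc * \<bar>\<bar>x\<bar> - pi\<bar>)"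
  note B0 = F_le_exp
  have B1: "\<bar>F1 x\<bar> \<le> ?B1 x" and B2: "\<bar>F2 x\<bar> \<le> ?B2 x" for x
    using pointwise_bounds(3,4)[of x] by simp_all
  note i0 = integral_exp_two_centers[OF l(1), of pi] and i1 = integral_exp_two_centers[OF l(2), of pi]
  have J: "integrable lborel ?B0" "integrable lborel ?B1" "integrable lborel ?B2"
    by (intro integrable_mult_right impI i0 i1)+
  show mF: "F \<in> borel_measurable borel"
    by (intro borel_measurable_continuous_onI continuous_at_imp_continuous_on ballI DERIV_isCont[OF F_deriv])
  have m: "F1 \<in> borel_measurable borel" "F2 \<in> borel_measurable borel"
    by (rule borel_measurable_derivative[OF F_deriv], rule borel_measurable_derivative[OF F1_deriv])
  note n0 = norm_fourier_le[OF mF J(1) B0] and n1 = norm_fourier_le[OF m(1) J(2) B1]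
    and n2 = norm_fourier_le[OF m(2) J(3) B2]
  have null: "(f \<longlongrightarrow> 0) at_top \<and> (f \<longlongrightarrow> 0) at_bot"
    if "0 < l" "\<And>x. \<bar>f x\<bar> \<le> b * exp (- l * \<bar>\<bar>x\<bar> - pi\<bar>)" for f :: "real \<Rightarrow> real" and b l
  proof -
    have ev: "\<forall>\<^sub>F x in A. norm (f x) \<le> b * exp (- l * \<bar>\<bar>x\<bar> - pi\<bar>)" for A
      unfolding real_norm_def by (intro always_eventually allI that(2))
    show ?thesis
      by (intro conjI Lim_null_comparison[OF ev] tendsto_mult_right_zero exp_abs_tendsto_0 that(1))
  qed
  have lim: "(F \<longlongrightarrow> 0) at_top" "(F \<longlongrightarrow> 0) at_bot" "(F1 \<longlongrightarrow> 0) at_top" "(F1 \<longlongrightarrow> 0) at_bot"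
    using null[OF l(1) B0] null[OF l(2) B1] by blast+
  have e1: "\<bar>t\<bar> * I = norm (LINT x|lborel. of_real (F1 x) * exp (\<i> * of_real (t * x)))"
    unfolding I_def by (rule fourier_derivative[OF F_deriv n0(1) n1(1) lim(1,2)])
  have e2: "\<bar>t\<bar> * (\<bar>t\<bar> * I) = norm (LINT x|lborel. of_real (F2 x) * exp (\<i> * of_real (t * x)))"
    unfolding e1 by (rule fourier_derivative[OF F1_deriv n1(1) n2(1) lim(3,4)])
  have C0: "0 \<le> C" "0 \<le> Z" using C lattice_sum(2)[OF \<kappa>] by auto
  have "I \<le> 4 * exp (\<kappa> * pi) * (LINT x|lborel. exp (- ?l * \<bar>\<bar>x\<bar> - pi\<bar>))"
    using n0(2)[of t] unfolding I_def by simp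
  also have "\<dots> \<le> 4 * exp (\<kappa> * pi) * (4 / ?l)" by (intro mult_left_mono i0) auto
  finally show "I \<le> 4 * exp (\<kappa> * pi) * (8 / \<kappa>)" by simp
  have "\<bar>t\<bar> * I \<le> 60 * C * Z * c * (LINT x|lborel. exp (- ?lc * \<bar>\<bar>x\<bar> - pi\<bar>))"
    using n1(2)[of t] unfolding e1 by simp
  \<comment> \<open>The integral over the layers is at most 4 / (\<kappa> / 2 * c) = 8 / (\<kappa> *
    c), which cancels one power of c: 480 = 60 * 8 here and 14080 = 1760 * 8 below.\<close>
  also have "\<dots> \<le> 60 * C * Z * c * (4 / ?lc)" using C0 c by (intro mult_left_mono i1) auto
  also have "\<dots> = 480 * C * Z / \<kappa>" using c \<kappa> by simp
  finally show "\<bar>t\<bar> * I \<le> 480 * C * Z / \<kappa>" .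
  have "t\<^sup>2 * I = \<bar>t\<bar> * (\<bar>t\<bar> * I)" by (simp add: power2_eq_square flip: mult.assoc abs_mult)
  also have "\<dots> \<le> 1760 * C\<^sup>2 * Z\<^sup>2 * c\<^sup>2 * (LINT x|lborel. exp (- ?lc * \<bar>\<bar>x\<bar> - pi\<bar>))"
    using n2(2)[of t] unfolding e2 by simp
  also have "\<dots> \<le> 1760 * C\<^sup>2 * Z\<^sup>2 * c\<^sup>2 * (4 / ?lc)" using C0 c by (intro mult_left_mono i1) auto
  also have "\<dots> = 14080 * C\<^sup>2 * Z\<^sup>2 / \<kappa> * c" using c \<kappa> by (simp add: power2_eq_square)
  finally show "t\<^sup>2 * I \<le> 14080 * C\<^sup>2 * Z\<^sup>2 / \<kappa> * c" .
qed

definition lambda_kernel :: "real \<Rightarrow> real \<Rightarrow> real" where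
  "lambda_kernel c t = c / ((1 + \<bar>t\<bar>) * (1 + \<bar>t\<bar> + c))"

text \<open>Multiply out: (1 + |t|) * (1 + |t| + c) = (1 + c) + (2 + c) * |t| + t^2. The weights 2,
  3 and 1 come from 1 + c <= 2 * c and 2 + c <= 3 * c.\<close>

lemma le_lambda_kernel:
  fixes I :: real
  assumes "1 \<le> c" "0 \<le> A0" "0 \<le> A1" "I \<le> A0" "\<bar>t\<bar> * I \<le> A1" "t\<^sup>2 * I \<le> A2 * c"
  shows "I \<le> (2 * A0 + 3 * A1 + A2) * lambda_kernel c t"
proof -
  have "(1 + \<bar>t\<bar>) * (1 + \<bar>t\<bar> + c) * I = (1 + c) * I + (2 + c) * (\<bar>t\<bar> * I) + t\<^sup>2 * I"
    by (simp add: power2_eq_square algebra_simps)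
  also have "\<dots> \<le> (2 * c) * A0 + (3 * c) * A1 + A2 * c"
    using assms by (intro add_mono order_trans[OF mult_left_mono[of _ A0] mult_right_mono]
      order_trans[OF mult_left_mono[of _ A1] mult_right_mono]) auto
  finally have "(1 + \<bar>t\<bar>) * (1 + \<bar>t\<bar> + c) * I \<le> (2 * A0 + 3 * A1 + A2) * c"
    by (simp add: algebra_simps)
  moreover have "0 < (1 + \<bar>t\<bar>) * (1 + \<bar>t\<bar> + c)" using assms(1) by (intro mult_pos_pos) auto
  ultimately show ?thesis
    by (simp add: lambda_kernel_def pos_le_divide_eq mult.commute)
qed

lemma countable_lattice: "countable {x. \<exists>k::int. x = 2 * pi * of_int k}"
proof -
  have "{x. \<exists>k::int. x = 2 * pi * of_int k} = range (\<lambda>k::int. 2 * pi * of_int k)" by auto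
  then show ?thesis by simp
qed

text \<open>The combination 2 * A0 + 3 * A1 + A2 of \<open>le_lambda_kernel\<close> for the
  constants of \<open>fourier_F_bounds\<close>; neither c nor the regularization enters.\<close>

definition transform_const :: "real \<Rightarrow> real \<Rightarrow> real" where
  "transform_const C \<kappa> = 2 * (4 * exp (\<kappa> * pi) * (8 / \<kappa>)) + 3 * (480 * C * lattice_sum \<kappa> / \<kappa>)
    + 14080 * C\<^sup>2 * (lattice_sum \<kappa>)\<^sup>2 / \<kappa>"

text \<open>The regularized symbols obey the bound with one common constant and converge to H off
  the lattice, which is a null set; dominated convergence hands the bound on to H.\<close>

lemma (in radial_profile) transform_bound:
  fixes H :: "real \<Rightarrow> real"
  assumes H: "\<And>x. (\<And>k::int. x \<noteq> 2 * pi * of_int k) \<Longrightarrow> H x = G \<bar>x\<bar> / periodize (\<lambda>y. G \<bar>y\<bar>) x"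
  shows "H \<in> borel_measurable borel"
    and "norm (LINT x|lborel. of_real (H x) * exp (\<i> * of_real (t * x)))
      \<le> transform_const C (\<delta> / 2) * lambda_kernel c t"
proof -
  define \<rho> where "\<rho> m y = sqrt (y\<^sup>2 + (1 / real (Suc m))\<^sup>2)" for m y
  define Fm where "Fm m x = G (\<rho> m x) / periodize (\<lambda>y. G (\<rho> m y)) x" for m x
  let ?X = "{x. \<exists>k::int. x = 2 * pi * of_int k}"
  let ?\<kappa> = "\<delta> / 2"
  let ?D = "\<lambda>x. 4 * exp (?\<kappa> * pi) * exp (- (?\<kappa> / 2) * \<bar>\<bar>x\<bar> - pi\<bar>)"
  have \<kappa>: "0 < ?\<kappa>" using \<delta> by simp
  have smooth: "Fm m \<in> borel_measurable borel" "\<bar>Fm m x\<bar> \<le> ?D x"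
    "norm (LINT x|lborel. of_real (Fm m x) * exp (\<i> * of_real (t * x)))
      \<le> transform_const C (\<delta> / 2) * lambda_kernel c t" for m x
  proof -
    interpret P: periodization "\<lambda>y. G (\<rho> m y)" "\<lambda>x. - W (\<rho> m x) * (x / \<rho> m x)"
      "\<lambda>x. V (\<rho> m x) * (x / \<rho> m x)\<^sup>2 - W (\<rho> m x) / \<rho> m x * (1 / real (Suc m) / \<rho> m x)\<^sup>2"
      "\<lambda>x. N (\<rho> m x)" c C ?\<kappa>
      using smoothed_periodization[of "1 / real (Suc m)"] by (simp add: \<rho>_def)
    have PF: "P.F = Fm m" by (simp add: P.F_def Fm_def fun_eq_iff)
    show "Fm m \<in> borel_measurable borel" using P.fourier_F_bounds(1) by (simp add: PF)
    show "\<bar>Fm m x\<bar> \<le> ?D x" using P.F_le_exp[of x] by (simp only: PF)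
    show "norm (LINT x|lborel. of_real (Fm m x) * exp (\<i> * of_real (t * x)))
      \<le> transform_const C (\<delta> / 2) * lambda_kernel c t"
      unfolding transform_const_def
    proof (rule le_lambda_kernel[OF c])
      show "0 \<le> 480 * C * lattice_sum ?\<kappa> / ?\<kappa>"
        using C \<kappa> lattice_sum(2)[OF \<kappa>] by (intro divide_nonneg_pos mult_nonneg_nonneg) auto
    qed (use P.fourier_F_bounds(2-4)[of t] \<kappa> in \<open>simp_all only: PF\<close>, simp)
  qed
  have lim: "(\<lambda>m. Fm m x) \<longlonglongrightarrow> H x" if "x \<notin> ?X" for x
    unfolding Fm_def using smoothed_limit[of x] that H[of x]
    by (auto simp: \<rho>_def intro!: tendsto_divide)
  \<comment> \<open>The value 0 on the lattice makes \<open>H'\<close> a pointwise limit everywhere,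
    hence measurable; H differs from it only on a countable set.\<close>
  define H' where "H' x = (if x \<in> ?X then 0 else H x)" for x
  have H'm: "H' \<in> borel_measurable borel"
  proof (rule borel_measurable_LIMSEQ_real)
    have "?X \<in> sets borel" by (rule sets.countable[OF _ countable_lattice]) simp
    then show "(\<lambda>x. if x \<in> ?X then 0 else Fm m x) \<in> borel_measurable borel" for m
      using smooth(1)[of m] by (intro measurable_If_set) auto
    show "(\<lambda>m. if x \<in> ?X then 0 else Fm m x) \<longlonglongrightarrow> H' x" for x
      using lim[of x] by (cases "x \<in> ?X") (simp_all add: H'_def)
  qed
  show Hm: "H \<in> borel_measurable borel"
    by (rule measurable_discrete_difference[OF H'm countable_lattice]) (auto simp: H'_def)
  have AE: "AE x in lborel. x \<notin> ?X"
    using countable_imp_null_set_lborel[OF countable_lattice] by (rule AE_not_in)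
  have "(\<lambda>m. LINT x|lborel. of_real (Fm m x) * exp (\<i> * of_real (t * x)))
      \<longlonglongrightarrow> (LINT x|lborel. complex_of_real (H x) * exp (\<i> * of_real (t * x)))"
  proof (rule integral_dominated_convergence[where w = ?D])
    show "integrable lborel ?D"
      by (intro integrable_mult_right impI integral_exp_two_centers) (use \<kappa> in simp)
    show "AE x in lborel. (\<lambda>m. of_real (Fm m x) * exp (\<i> * of_real (t * x)))
        \<longlonglongrightarrow> complex_of_real (H x) * exp (\<i> * of_real (t * x))"
      using AE by eventually_elim (intro tendsto_intros lim)
    show "AE x in lborel. norm (of_real (Fm m x) * exp (\<i> * of_real (t * x)) :: complex) \<le> ?D x" for m
      using smooth(2) by (intro AE_I2) (simp add: norm_mult del: mult_minus_left)
  qed (use Hm smooth(1) in auto)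
  then show "norm (LINT x|lborel. of_real (H x) * exp (\<i> * of_real (t * x)))
      \<le> transform_const C (\<delta> / 2) * lambda_kernel c t"
    by (rule LIMSEQ_le_const2[OF tendsto_norm]) (use smooth(3) in auto)
qed

section \<open>Lebesgue sums and operator norms\<close>

lemma infsum_int_ennreal:
  fixes f :: "int \<Rightarrow> ennreal"
  shows "(\<Sum>\<^sub>\<infinity>j. f j) = (\<Sum>n. f (int n) + f (- int n - 1))"
  by (rule sums_unique[OF sums_infsum_int]) (auto intro: nonneg_summable_on_complete)

lemma finite_sum_le_infsum_ennreal:
  fixes f :: "'a \<Rightarrow> ennreal"
  shows "finite A \<Longrightarrow> sum f A \<le> (\<Sum>\<^sub>\<infinity>x. f x)"
  by (subst nonneg_infsum_complete) (auto intro!: SUP_upper)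

lemma summable_on_of_ennreal_bound:
  fixes f :: "'a \<Rightarrow> real"
  assumes "\<And>x. 0 \<le> f x" "(\<Sum>\<^sub>\<infinity>x. ennreal (f x)) \<le> ennreal M"
  shows "f summable_on UNIV"
proof (rule nonneg_bdd_above_summable_on)
  have "sum f A \<le> \<bar>M\<bar>" if "finite A" for A
  proof -
    have "ennreal (sum f A) = (\<Sum>x\<in>A. ennreal (f x))" using assms(1) by simp
    also have "\<dots> \<le> (\<Sum>\<^sub>\<infinity>x. ennreal (f x))"
      by (rule finite_sum_le_infsum_ennreal[OF that])
    also have "\<dots> \<le> ennreal \<bar>M\<bar>" using assms(2) by (rule order_trans) (simp add: ennreal_leI)
    finally show ?thesis by (simp add: ennreal_le_iff)
  qed
  then show "bdd_above (sum f ` {F. F \<subseteq> UNIV \<and> finite F})" by (auto intro!: bdd_aboveI)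
qed (rule assms)

lemma norm_infsum_le_ennreal:
  fixes f :: "'a \<Rightarrow> complex"
  shows "ennreal (norm (\<Sum>\<^sub>\<infinity>x\<in>A. f x)) \<le> (\<Sum>\<^sub>\<infinity>x\<in>A. ennreal (norm (f x)))"
proof (cases "f summable_on A")
  case True
  then have abs: "(\<lambda>x. norm (f x)) summable_on A" using summable_on_iff_abs_summable_on_complex by blast
  have "ennreal (norm (\<Sum>\<^sub>\<infinity>x\<in>A. f x)) \<le> ennreal (\<Sum>\<^sub>\<infinity>x\<in>A. norm (f x))"
    by (intro ennreal_leI norm_infsum_bound abs)
  also have "\<dots> = infsum (ennreal \<circ> (\<lambda>x. norm (f x))) A"
    by (rule infsum_comm_additive_general[symmetric]) (use abs in \<open>auto simp: o_def\<close>)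
  finally show ?thesis by (simp add: o_def)
next
  case False
  \<comment> \<open>Without summability the sum on the left has the default value 0.\<close>
  then show ?thesis by (simp add: infsum_not_exists)
qed

section \<open>Lattice sums and integral of the majorant\<close>

lemma lambda_kernel_nonneg: "1 \<le> c \<Longrightarrow> 0 \<le> lambda_kernel c t"
  by (simp add: lambda_kernel_def)

lemma lambda_kernel_antimono:
  assumes "1 \<le> c" "\<bar>s\<bar> \<le> \<bar>t\<bar>" shows "lambda_kernel c t \<le> lambda_kernel c s"
  unfolding lambda_kernel_def using assms
  by (intro divide_left_mono mult_mono mult_pos_pos) auto

lemma lambda_kernel_primitive:
  assumes "1 \<le> c" "0 \<le> t"
  shows "((\<lambda>t. ln (1 + t) - ln (1 + t + c)) has_real_derivative lambda_kernel c t) (at t)"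
  using assms by (auto intro!: derivative_eq_intros simp: lambda_kernel_def field_simps)

text \<open>Integral comparison: the kernel decreases, so each term after the first is at most an
  increment of the primitive D, and the increments telescope. The first term is c / (1 + c) <= 1,
  and D m - D 0 <= ln (1 + c) because D is negative.\<close>

lemma sum_lambda_kernel:
  assumes c: "1 \<le> c"
  shows "(\<Sum>n<m. lambda_kernel c (real n)) \<le> 1 + ln (1 + c)"
proof -
  define D where "D t = ln (1 + t) - ln (1 + t + c)" for t
  have step: "lambda_kernel c (real (Suc n)) \<le> D (real (Suc n)) - D (real n)" for n
  proof -
    obtain z where z: "real n < z" "z < real (Suc n)"
      "D (real (Suc n)) - D (real n) = (real (Suc n) - real n) * lambda_kernel c z"
      using MVT2[of "real n" "real (Suc n)" D "lambda_kernel c"] lambda_kernel_primitive[OF c]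
      unfolding D_def[abs_def] by auto
    have "lambda_kernel c (real (Suc n)) \<le> lambda_kernel c z"
      using z by (intro lambda_kernel_antimono c) auto
    then show ?thesis using z(3) by simp
  qed
  have "(\<Sum>n<Suc m. lambda_kernel c (real n)) \<le> 1 + (D (real m) - D 0)" for m
  proof (induction m)
    case 0
    show ?case using c by (simp add: lambda_kernel_def)
  next
    case (Suc m)
    then show ?case using step[of m] by simp
  qed
  also have "1 + (D (real m) - D 0) \<le> 1 + ln (1 + c)" for m
    using c by (simp add: D_def)
  finally have "(\<Sum>n<Suc m. lambda_kernel c (real n)) \<le> 1 + ln (1 + c)" for m .
  from this[of m] show ?thesis
    using lambda_kernel_nonneg[OF c, of "real m"] by simp
qed

lemma log_factor:
  assumes "1 \<le> (c::real)" shows "1 + ln (1 + c) \<le> 3 * max 1 (ln c)"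
proof -
  have "ln (1 + c) \<le> ln (2 * c)" using assms by (subst ln_le_cancel_iff) auto
  also have "\<dots> = ln 2 + ln c" using assms by (simp add: ln_mult)
  also have "ln 2 \<le> (1::real)" using ln_le_minus_one[of 2] by simp
  finally have "1 + ln (1 + c) \<le> 2 + ln c" by simp
  also have "\<dots> \<le> 3 * max 1 (ln c)" by (simp add: max_def)
  finally show ?thesis .
qed

text \<open>By periodicity x may be replaced by its fractional part y; then y + n and y - n - 1 have
  absolute value at least n, which gives twice the one-sided sum. The factor is 6 = 2 * 3 with the 3
  of \<open>log_factor\<close>.\<close>

lemma infsum_lambda_kernel:
  assumes c: "1 \<le> c"
  shows "(\<Sum>\<^sub>\<infinity>j\<in>(UNIV::int set). ennreal (lambda_kernel c (x + of_int j))) \<le> ennreal (6 * max 1 (ln c))"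
proof -
  define y where "y = x - of_int \<lfloor>x\<rfloor>"
  have y: "0 \<le> y" "y \<le> 1" unfolding y_def by linarith+
  have "(\<Sum>\<^sub>\<infinity>j\<in>(UNIV::int set). ennreal (lambda_kernel c (x + of_int j)))
      = (\<Sum>\<^sub>\<infinity>j\<in>(UNIV::int set). ennreal (lambda_kernel c (y + of_int j)))"
    by (rule infsum_reindex_bij_witness[where i = "\<lambda>j. j - \<lfloor>x\<rfloor>" and j = "\<lambda>j. j + \<lfloor>x\<rfloor>"])
      (auto simp: y_def algebra_simps)
  also have "\<dots> = (\<Sum>n. ennreal (lambda_kernel c (y + of_int (int n)))
      + ennreal (lambda_kernel c (y + of_int (- int n - 1))))"
    by (rule infsum_int_ennreal)
  also have "\<dots> \<le> ennreal (6 * max 1 (ln c))"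
    unfolding suminf_eq_SUP
  proof (rule SUP_least)
    fix m
    have "(\<Sum>n<m. ennreal (lambda_kernel c (y + of_int (int n))) + ennreal (lambda_kernel c (y + of_int (- int n - 1))))
        \<le> (\<Sum>n<m. ennreal (2 * lambda_kernel c (real n)))"
    proof (rule sum_mono)
      fix n
      have "lambda_kernel c (y + of_int (int n)) \<le> lambda_kernel c (real n)"
        "lambda_kernel c (y + of_int (- int n - 1)) \<le> lambda_kernel c (real n)"
        using y by (auto intro!: lambda_kernel_antimono c)
      then show "ennreal (lambda_kernel c (y + of_int (int n))) + ennreal (lambda_kernel c (y + of_int (- int n - 1)))
          \<le> ennreal (2 * lambda_kernel c (real n))"
        using lambda_kernel_nonneg[OF c, of "real n"] unfolding mult_2
        by (subst ennreal_plus) (auto intro!: add_mono ennreal_leI)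
    qed
    also have "\<dots> = ennreal (2 * (\<Sum>n<m. lambda_kernel c (real n)))"
      using lambda_kernel_nonneg[OF c] by (subst sum_ennreal) (auto simp: sum_distrib_left)
    also have "\<dots> \<le> ennreal (6 * max 1 (ln c))"
      using sum_lambda_kernel[OF c, of m] log_factor[OF c] by (intro ennreal_leI) linarith
    finally show "(\<Sum>n<m. ennreal (lambda_kernel c (y + of_int (int n)))
        + ennreal (lambda_kernel c (y + of_int (- int n - 1)))) \<le> ennreal (6 * max 1 (ln c))" .
  qed
  finally show ?thesis .
qed

lemma nn_integral_lambda_kernel:
  assumes c: "1 \<le> c"
  shows "(\<integral>\<^sup>+t. ennreal (lambda_kernel c t) \<partial>lborel) \<le> ennreal (6 * max 1 (ln c))"
proof -
  have m[measurable]: "lambda_kernel c \<in> borel_measurable borel"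
    unfolding lambda_kernel_def[abs_def] by measurable
  let ?h = "\<lambda>t. ennreal (lambda_kernel c t) * indicator {0..} t"
  have half: "(\<integral>\<^sup>+t. ?h t \<partial>lborel) = ennreal (0 - (ln (1 + 0) - ln (1 + 0 + c)))"
  proof (rule nn_integral_FTC_atLeast)
    have "((\<lambda>t. ln ((1 + t) / (1 + t + c))) \<longlongrightarrow> ln 1) at_top"
    proof (rule tendsto_ln)
      have "((\<lambda>t. 1 - c / (1 + c + t)) \<longlongrightarrow> 1 - 0) at_top"
        by (intro tendsto_diff tendsto_const tendsto_divide_0[OF tendsto_const]
            filterlim_at_top_imp_at_infinity filterlim_tendsto_add_at_top[OF tendsto_const] filterlim_ident)
      moreover have "\<forall>\<^sub>F t in at_top. 1 - c / (1 + c + t) = (1 + t) / (1 + t + c)"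
        using eventually_ge_at_top[of 0] by eventually_elim (use c in \<open>simp add: field_simps\<close>)
      ultimately show "((\<lambda>t. (1 + t) / (1 + t + c)) \<longlongrightarrow> 1) at_top"
        using Lim_transform_eventually by force
    qed simp
    moreover have "\<forall>\<^sub>F t in at_top. ln ((1 + t) / (1 + t + c)) = ln (1 + t) - ln (1 + t + c)"
      using eventually_ge_at_top[of 0] by eventually_elim (use c in \<open>simp add: ln_div\<close>)
    ultimately show "((\<lambda>t. ln (1 + t) - ln (1 + t + c)) \<longlongrightarrow> 0) at_top"
      using Lim_transform_eventually by force
  qed (use c lambda_kernel_primitive lambda_kernel_nonneg in auto)
  have "(\<integral>\<^sup>+t. ennreal (lambda_kernel c t) \<partial>lborel) \<le> (\<integral>\<^sup>+t. ?h t + ?h (0 + (- 1) * t) \<partial>lborel)"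
    by (intro nn_integral_mono) (auto simp: indicator_def lambda_kernel_def)
  also have "\<dots> = (\<integral>\<^sup>+t. ?h t \<partial>lborel) + (\<integral>\<^sup>+t. ?h (0 + (- 1) * t) \<partial>lborel)"
    by (rule nn_integral_add) measurable
  also have "(\<integral>\<^sup>+t. ?h (0 + (- 1) * t) \<partial>lborel) = (\<integral>\<^sup>+t. ?h t \<partial>lborel)"
    using nn_integral_real_affine[of ?h "- 1" 0] by simp
  also have "(\<integral>\<^sup>+t. ?h t \<partial>lborel) + (\<integral>\<^sup>+t. ?h t \<partial>lborel) = ennreal (2 * ln (1 + c))"
    unfolding half using c by (simp flip: ennreal_plus)
  also have "\<dots> \<le> ennreal (6 * max 1 (ln c))"
    using log_factor[OF c] by (intro ennreal_leI) simp
  finally show ?thesis .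
qed

section \<open>From the multiquadric transform to the fundamental function\<close>

lemma multiquadric_hat_eq:
  assumes "0 < c" "\<xi> \<noteq> 0"
  shows "multiquadric_hat \<alpha> c \<xi> = (2 powr (1 + \<alpha>) / Gamma (- \<alpha>) * c powr (\<alpha> + 1/2)) *
    (\<bar>\<xi>\<bar> powr (- (\<alpha> + 1/2)) * bessel_K (\<alpha> + 1/2) (c * \<bar>\<xi>\<bar>))"
  using assms by (simp add: multiquadric_hat_def powr_divide powr_minus_divide divide_simps)

lemma L_hat_eq:
  assumes "0 < c" "\<alpha> \<notin> \<nat>" and \<xi>: "\<And>k::int. \<xi> \<noteq> 2 * pi * of_int k"
  defines "G \<equiv> \<lambda>r. r powr (- (\<alpha> + 1/2)) * bessel_K (\<alpha> + 1/2) (c * r)"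
  shows "L_hat \<alpha> c \<xi> = G \<bar>\<xi>\<bar> / periodize (\<lambda>y. G \<bar>y\<bar>) \<xi>"
proof -
  let ?C = "2 powr (1 + \<alpha>) / Gamma (- \<alpha>) * c powr (\<alpha> + 1/2)"
  \<comment> \<open>\<open>Gamma\<close> is 0 at its poles by convention. As \<alpha> is not a
    natural number, - \<alpha> avoids them, so the prefactor is nonzero and cancels in the
    quotient.\<close>
  have "- \<alpha> \<notin> \<int>\<^sub>\<le>\<^sub>0"
  proof
    assume "- \<alpha> \<in> \<int>\<^sub>\<le>\<^sub>0"
    then obtain n where "- \<alpha> = - of_nat n" by (rule nonpos_Ints_cases')
    then show False using assms(2) by simp
  qed
  then have C: "?C \<noteq> 0" using assms(1) by (simp add: Gamma_eq_zero_iff)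
  have nz: "\<xi> + 2 * pi * of_int j \<noteq> 0" for j
    using \<xi>[of "- j"] by (auto simp: add_eq_0_iff)
  have \<xi>0: "\<xi> \<noteq> 0" using nz[of 0] by simp
  have "L_hat \<alpha> c \<xi> = cardinal_ratio \<alpha> c \<xi>" using \<xi> by (simp add: L_hat_def)
  also have "\<dots> = ?C * G \<bar>\<xi>\<bar> / (\<Sum>\<^sub>\<infinity>j\<in>(UNIV::int set). ?C * G \<bar>\<xi> + 2 * pi * of_int j\<bar>)"
    unfolding cardinal_ratio_def G_def multiquadric_hat_eq[OF assms(1) \<xi>0] multiquadric_hat_eq[OF assms(1) nz] ..
  also have "\<dots> = ?C * G \<bar>\<xi>\<bar> / (?C * periodize (\<lambda>y. G \<bar>y\<bar>) \<xi>)"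
    unfolding periodize_def by (simp only: infsum_cmult_right')
  also have "\<dots> = G \<bar>\<xi>\<bar> / periodize (\<lambda>y. G \<bar>y\<bar>) \<xi>" using C by (rule mult_divide_mult_cancel_left)
  finally show ?thesis .
qed

lemma fundamental_L_bound:
  fixes \<alpha> :: real
  assumes \<alpha>: "\<alpha> \<in> {..< -3/2} \<union> ({1/2..} - \<nat>)"
  obtains T where "0 < T" "\<And>c x. 1 \<le> c \<Longrightarrow> norm (fundamental_L \<alpha> c x) \<le> T * lambda_kernel c x"
    and "\<And>c. 1 \<le> c \<Longrightarrow> fundamental_L \<alpha> c \<in> borel_measurable borel"
proof -
  have "\<alpha> \<notin> \<nat>" using \<alpha> by (auto elim!: Nats_cases)
  have mu: "\<alpha> + 1/2 \<in> {..<-1} \<union> {1..}" using \<alpha> by auto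
  \<comment> \<open>C and \<delta> are fixed before c, so that T below depends on \<alpha>
    alone.\<close>
  obtain C \<delta> where prof: "\<And>c. 1 \<le> c \<Longrightarrow> \<exists>W V N.
      radial_profile (\<lambda>r. r powr (- (\<alpha> + 1/2)) * bessel_K (\<alpha> + 1/2) (c * r)) W V N c C \<delta>"
    using bessel_profile[OF mu] by blast
  define T where "T = max 1 (transform_const C (\<delta> / 2))"
  have main: "L_hat \<alpha> c \<in> borel_measurable borel \<and> (\<forall>x. norm (fundamental_L \<alpha> c x) \<le> T * lambda_kernel c x)"
    if c: "1 \<le> c" for c
  proof -
    from prof[OF c] obtain W V N where
      "radial_profile (\<lambda>r. r powr (- (\<alpha> + 1/2)) * bessel_K (\<alpha> + 1/2) (c * r)) W V N c C \<delta>" by blast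
    then interpret R: radial_profile "\<lambda>r. r powr (- (\<alpha> + 1/2)) * bessel_K (\<alpha> + 1/2) (c * r)" W V N c C \<delta> .
    have H: "L_hat \<alpha> c x = \<bar>x\<bar> powr (- (\<alpha> + 1/2)) * bessel_K (\<alpha> + 1/2) (c * \<bar>x\<bar>) /
        periodize (\<lambda>y. \<bar>y\<bar> powr (- (\<alpha> + 1/2)) * bessel_K (\<alpha> + 1/2) (c * \<bar>y\<bar>)) x"
      if "\<And>k::int. x \<noteq> 2 * pi * of_int k" for x
      using L_hat_eq[OF _ \<open>\<alpha> \<notin> \<nat>\<close> that] c by simp
    note tb = R.transform_bound[of "L_hat \<alpha> c", OF H]
    have "norm (fundamental_L \<alpha> c x) \<le> T * lambda_kernel c x" for x
    proof -
      have "norm (fundamental_L \<alpha> c x)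
          = 1 / (2 * pi) * norm (LINT \<xi>|lborel. of_real (L_hat \<alpha> c \<xi>) * exp (\<i> * of_real (x * \<xi>)))"
        by (simp add: fundamental_L_def norm_mult norm_divide)
      also have "\<dots> \<le> 1 * norm (LINT \<xi>|lborel. of_real (L_hat \<alpha> c \<xi>) * exp (\<i> * of_real (x * \<xi>)))"
        using pi_gt3 by (intro mult_right_mono) auto
      also have "\<dots> \<le> transform_const C (\<delta> / 2) * lambda_kernel c x"
        using tb(2)[of x] by simp
      also have "\<dots> \<le> T * lambda_kernel c x"
        using lambda_kernel_nonneg[OF c] by (intro mult_right_mono) (auto simp: T_def)
      finally show ?thesis .
    qed
    with tb(1) show ?thesis by blast
  qed
  show ?thesis
  proof (rule that[of T])
    show "fundamental_L \<alpha> c \<in> borel_measurable borel" if c: "1 \<le> c" for c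
    proof -
      have [measurable]: "L_hat \<alpha> c \<in> borel_measurable borel" using main[OF c] by blast
      show ?thesis unfolding fundamental_L_def[abs_def] by measurable
    qed
  qed (use main in \<open>auto simp: T_def\<close>)
qed

text \<open>The two endpoint criteria for a kernel: uniformly bounded lattice sums control the
  supremum norm, an integral bound controls the norm of L_1. A single number B serves for
  both.\<close>

locale summable_kernel =
  fixes L :: "real \<Rightarrow> complex" and B :: real
  assumes measurable_L[measurable]: "L \<in> borel_measurable borel" and B_nonneg: "0 \<le> B"
    and lebesgue_sum: "(\<Sum>\<^sub>\<infinity>j\<in>(UNIV::int set). ennreal (norm (L (x + of_int j)))) \<le> ennreal B"
    and L1: "(\<integral>\<^sup>+x. ennreal (norm (L x)) \<partial>lborel) \<le> ennreal B"
begin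

definition interp :: "(int \<Rightarrow> complex) \<Rightarrow> real \<Rightarrow> complex" where
  "interp y x = (\<Sum>\<^sub>\<infinity>j\<in>(UNIV::int set). y j * L (x - of_int j))"

lemma lebesgue_sum': "(\<Sum>\<^sub>\<infinity>j\<in>(UNIV::int set). ennreal (norm (L (x - of_int j)))) \<le> ennreal B"
proof -
  have "(\<Sum>\<^sub>\<infinity>j\<in>(UNIV::int set). ennreal (norm (L (x - of_int j))))
      = (\<Sum>\<^sub>\<infinity>j\<in>(UNIV::int set). ennreal (norm (L (x + of_int j))))"
    by (rule infsum_reindex_bij_witness[where i = uminus and j = uminus]) auto
  then show ?thesis using lebesgue_sum[of x] by simp
qed

lemma interp_summable:
  assumes "\<And>j. norm (y j) \<le> 1"
  shows "(\<lambda>j::int. y j * L (x - of_int j)) summable_on UNIV"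
proof -
  have "(\<lambda>j::int. norm (L (x - of_int j))) summable_on UNIV"
    using lebesgue_sum'[of x] by (intro summable_on_of_ennreal_bound) auto
  then have "(\<lambda>j::int. norm (y j * L (x - of_int j))) summable_on UNIV"
    by (rule Infinite_Sum.abs_summable_on_comparison_test')
      (use assms in \<open>auto simp: norm_mult intro: mult_left_le_one_le\<close>)
  then show ?thesis by (rule Infinite_Sum.abs_summable_summable)
qed

lemma measurable_interp:
  assumes "\<And>j. norm (y j) \<le> 1"
  shows "interp y \<in> borel_measurable borel"
proof (rule borel_measurable_LIMSEQ_metric)
  let ?f = "\<lambda>x j. y j * L (x - of_int j)"
  show "(\<lambda>m. \<Sum>n<m. ?f x (int n) + ?f x (- int n - 1)) \<longlonglongrightarrow> interp y x" for x
  proof -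
    note s = interp_summable[OF assms, where x = x]
    have "(\<lambda>n. ?f x (int n)) summable_on UNIV" "(\<lambda>n. ?f x (- int n - 1)) summable_on UNIV"
      using summable_on_subset_banach[OF s, of "range int"] summable_on_subset_banach[OF s, of "range (\<lambda>n. - int n - 1)"]
      by (auto simp: summable_on_reindex inj_on_def o_def)
    from sums_infsum_int[where f = "?f x", OF this] show ?thesis
      by (simp only: sums_def interp_def)
  qed
qed measurable

lemma interp_pointwise:
  "ennreal (norm (interp y x)) \<le> (\<Sum>\<^sub>\<infinity>j. ennreal (norm (y j)) * ennreal (norm (L (x - of_int j))))"
  using norm_infsum_le_ennreal[of "\<lambda>j. y j * L (x - of_int j)" UNIV]
  by (simp add: interp_def norm_mult ennreal_mult)

lemma operator_norm_infty: "operator_norm ell_infty_norm L_infty_norm interp \<le> ennreal B"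
  unfolding operator_norm_def
proof (rule SUP_least)
  fix y assume "y \<in> {y. ell_infty_norm y \<le> 1}"
  then have "(SUP j. ennreal (norm (y j))) \<le> 1" by (simp add: ell_infty_norm_def)
  then have y: "ennreal (norm (y j)) \<le> 1" for j
    using SUP_upper[of j UNIV "\<lambda>j. ennreal (norm (y j))"] order_trans by blast
  then have y': "norm (y j) \<le> 1" for j using ennreal_le_1[of "norm (y j)"] by simp
  note [measurable] = measurable_interp[OF y']
  have "ennreal (norm (interp y x)) \<le> ennreal B" for x
  proof -
    note interp_pointwise
    also have "(\<Sum>\<^sub>\<infinity>j. ennreal (norm (y j)) * ennreal (norm (L (x - of_int j))))
        \<le> (\<Sum>\<^sub>\<infinity>j\<in>(UNIV::int set). ennreal (norm (L (x - of_int j))))"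
      by (rule infsum_mono)
        (use mult_right_mono[OF y] in \<open>auto intro: nonneg_summable_on_complete\<close>)
    also note lebesgue_sum'
    finally show ?thesis .
  qed
  then show "L_infty_norm (interp y) \<le> ennreal B"
    unfolding L_infty_norm_def by (auto intro!: esssup_I)
qed

text \<open>Tonelli and translation invariance: the coefficient y j contributes its modulus times
  the L_1 norm of L.\<close>

lemma operator_norm_1: "operator_norm ell_1_norm L_1_norm interp \<le> ennreal B"
  unfolding operator_norm_def
proof (rule SUP_least)
  fix y assume "y \<in> {y. ell_1_norm y \<le> 1}"
  then have y1: "(\<Sum>\<^sub>\<infinity>j. ennreal (norm (y j))) \<le> 1" by (simp add: ell_1_norm_def)
  \<comment> \<open>The unit ball for \<open>ell_1_norm\<close> lies in that for
    \<open>ell_infty_norm\<close>, which makes \<open>measurable_interp\<close> applicable.\<close>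
  have "ennreal (norm (y j)) \<le> 1" for j
  proof -
    have "sum (\<lambda>j. ennreal (norm (y j))) {j} \<le> (\<Sum>\<^sub>\<infinity>j. ennreal (norm (y j)))"
      by (rule finite_sum_le_infsum_ennreal) simp
    also note y1
    finally show ?thesis by (simp del: ennreal_le_1)
  qed
  then have y': "norm (y j) \<le> 1" for j using ennreal_le_1[of "norm (y j)"] by simp
  note [measurable] = measurable_interp[OF y']
  let ?I = "\<integral>\<^sup>+x. ennreal (norm (L x)) \<partial>lborel"
  have shift: "(\<integral>\<^sup>+x. ennreal (norm (y j)) * ennreal (norm (L (x - of_int j))) \<partial>lborel) = ennreal (norm (y j)) * ?I" for j
    using nn_integral_real_affine[of "\<lambda>x. ennreal (norm (L x))" 1 "- of_int j"]
    by (simp add: nn_integral_cmult)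
  have "(\<integral>\<^sup>+x. ennreal (norm (interp y x)) \<partial>lborel)
      \<le> (\<integral>\<^sup>+x. (\<Sum>\<^sub>\<infinity>j. ennreal (norm (y j)) * ennreal (norm (L (x - of_int j)))) \<partial>lborel)"
    by (intro nn_integral_mono interp_pointwise)
  also have "\<dots> = (\<Sum>\<^sub>\<infinity>j. (\<integral>\<^sup>+x. ennreal (norm (y j)) * ennreal (norm (L (x - of_int j))) \<partial>lborel))"
    unfolding infsum_int_ennreal by (subst nn_integral_suminf) (auto simp: nn_integral_add)
  also have "\<dots> = (\<Sum>\<^sub>\<infinity>j. ennreal (norm (y j))) * ?I"
    unfolding shift infsum_int_ennreal by (simp add: distrib_right[symmetric] ennreal_suminf_multc)
  also have "\<dots> \<le> 1 * ennreal B" by (intro mult_mono y1 L1) auto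
  finally show "L_1_norm (interp y) \<le> ennreal B"
    unfolding L_1_norm_def by simp
qed

end

(* The factor is max 1 (ln c), which equals ln c for c >= e: ln 1 = 0, whereas
   Lambda alpha c 0 >= |L(0)| = 1 for every c, so a bare ln c cannot serve near c = 1. *)
theorem proposition23:
  fixes \<alpha> :: real
  assumes "\<alpha> \<in> {..< -3/2} \<union> ({1/2..} - \<nat>)"
  shows "(\<exists>A>0. \<forall>c\<ge>1. \<forall>x. Lambda \<alpha> c x \<le> ennreal (A * max 1 (ln c))) \<and>
         (\<exists>A>0. \<forall>c\<ge>1. operator_norm ell_infty_norm L_infty_norm (cardinal_interp \<alpha> c)
                   \<le> ennreal (A * max 1 (ln c))) \<and>
         (\<exists>A>0. \<forall>c\<ge>1. operator_norm ell_1_norm L_1_norm (cardinal_interp \<alpha> c)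
                   \<le> ennreal (A * max 1 (ln c)))"
proof -
  obtain T where T: "0 < T" "\<And>c x. 1 \<le> c \<Longrightarrow> norm (fundamental_L \<alpha> c x) \<le> T * lambda_kernel c x"
    and meas: "\<And>c. 1 \<le> c \<Longrightarrow> fundamental_L \<alpha> c \<in> borel_measurable borel"
    using fundamental_L_bound[OF assms] by blast
  have le: "ennreal (norm (fundamental_L \<alpha> c x)) \<le> ennreal T * ennreal (lambda_kernel c x)" if "1 \<le> c" for c x
    using T(2)[OF that, of x] T(1) lambda_kernel_nonneg[OF that]
    by (subst ennreal_mult[symmetric]) (auto intro: ennreal_leI)
  have scale: "ennreal T * ennreal (6 * max 1 (ln c)) = ennreal (6 * T * max 1 (ln c))" for c
    using T(1) by (subst ennreal_mult[symmetric]) (auto simp: mult_ac)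
  \<comment> \<open>The factor 6 is the same for the lattice sums and for the integral of the
    kernel, so that 6 * T is a common constant for all three claims.\<close>
  have K: "summable_kernel (fundamental_L \<alpha> c) (6 * T * max 1 (ln c))" if c: "1 \<le> c" for c
  proof
    show "fundamental_L \<alpha> c \<in> borel_measurable borel" by (rule meas[OF c])
    show "0 \<le> 6 * T * max 1 (ln c)" using T(1) by simp
    show "(\<Sum>\<^sub>\<infinity>j\<in>(UNIV::int set). ennreal (norm (fundamental_L \<alpha> c (x + of_int j)))) \<le> ennreal (6 * T * max 1 (ln c))" for x
    proof -
      have "(\<Sum>\<^sub>\<infinity>j\<in>(UNIV::int set). ennreal (norm (fundamental_L \<alpha> c (x + of_int j))))
          \<le> (\<Sum>\<^sub>\<infinity>j\<in>(UNIV::int set). ennreal T * ennreal (lambda_kernel c (x + of_int j)))"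
        by (rule infsum_mono) (auto intro: nonneg_summable_on_complete le[OF c])
      also have "\<dots> = ennreal T * (\<Sum>\<^sub>\<infinity>j\<in>(UNIV::int set). ennreal (lambda_kernel c (x + of_int j)))"
        unfolding infsum_int_ennreal by (simp add: distrib_left[symmetric])
      also have "\<dots> \<le> ennreal T * ennreal (6 * max 1 (ln c))"
        by (intro mult_left_mono infsum_lambda_kernel c) simp
      finally show ?thesis unfolding scale .
    qed
    have "(\<integral>\<^sup>+x. ennreal (norm (fundamental_L \<alpha> c x)) \<partial>lborel)
        \<le> (\<integral>\<^sup>+x. ennreal T * ennreal (lambda_kernel c x) \<partial>lborel)"
      by (intro nn_integral_mono le[OF c])
    also have "\<dots> = ennreal T * (\<integral>\<^sup>+x. ennreal (lambda_kernel c x) \<partial>lborel)"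
      by (rule nn_integral_cmult) (simp add: lambda_kernel_def[abs_def])
    also have "\<dots> \<le> ennreal T * ennreal (6 * max 1 (ln c))"
      by (intro mult_left_mono nn_integral_lambda_kernel c) simp
    finally show "(\<integral>\<^sup>+x. ennreal (norm (fundamental_L \<alpha> c x)) \<partial>lborel) \<le> ennreal (6 * T * max 1 (ln c))"
      unfolding scale .
  qed
  have interp: "cardinal_interp \<alpha> c = summable_kernel.interp (fundamental_L \<alpha> c)" if "1 \<le> c" for c
    by (intro ext) (simp add: cardinal_interp_def summable_kernel.interp_def[OF K[OF that]])
  have T6: "0 < 6 * T" using T(1) by simp
  show ?thesis
    using summable_kernel.lebesgue_sum[OF K] summable_kernel.operator_norm_infty[OF K]
      summable_kernel.operator_norm_1[OF K] T6
    by (auto simp: Lambda_def interp intro!: exI[of _ "6 * T"])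
qed

end
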